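(* Let $\Phi$ be the distribution function of a positive waiting time, $\widetilde\phi(s)=\int_0^\infty e^{-st}\,d\Phi(t)$, and let $\widetilde H(s)=\dfrac{1-\widetilde\phi(s)}{s\,\widetilde\phi(s)}$ for $s>0$. Let $W$ be the distribution function of a real jump, with $\widehat w(\kappa)=\int_{-\infty}^\infty e^{i\kappa x}\,dW(x)$. Assume that $W$ is symmetric, i.e. $W(-x)+W(x)=1$ for all continuity points $x$ of $W$, and that either (a) $\sigma^2:=\int_{-\infty}^{\infty}x^2\,dW(x)<\infty$, in which case put $\alpha=2$, $\mu=\sigma^2/2$; or (b) there are $0<\alpha<2$ and $b>0$ such that $\int_x^\infty dW(x')\sim b\,\alpha^{-1}x^{-\alpha}$ as $x\to\infty$, in which case put $\mu=\dfrac{b\,\pi}{\Gamma(\alpha+1)\sin(\alpha\pi/2)}$. Assume $\mu>0$. For $h>0$ let $\widehat{\widetilde q}_h(\kappa,s)$ ($\kappa\in\mathbb R$, $s>0$) be the solution of the spatially rescaled and respeeded equation $$\widetilde H(s)\left[s\,\widehat{\widetilde q}_h(\kappa,s)-1\right]=\frac{\widehat w(\kappa h)-1}{\mu h^\alpha}\,\widehat{\widetilde q}_h(\kappa,s).$$ Then for all fixed $\kappa\in\mathbb R$ and $s>0$, as $h\to0^+$, $\widehat{\widetilde q}_h(\kappa,s)$ converges to the solution $\widehat{\widetilde u}(\kappa,s)$ of $$\widetilde H(s)\left[s\,\widehat{\widetilde u}(\kappa,s)-1\right]=-|\kappa|^\alpha\,\widehat{\widetilde u}(\kappa,s),$$ which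 is the Fourier-Laplace form of the Cauchy problem $$\int_0^t H(t-t')\,\frac{\partial}{\partial t'}u(x,t')\,dt'={}_xD_0^\alpha u(x,t),\qquad u(x,0)=\delta(x).$$ In particular, for the Mittag-Leffler memory function, $\widetilde H(s)=s^{\beta-1}$ with $0<\beta\le1$, the limit equation is the Fourier-Laplace form of the space-time fractional diffusion Cauchy problem $${}_tD_*^\beta u(x,t)={}_xD_0^\alpha u(x,t),\qquad u(x,0)=\delta(x).$$
   Context: Transforms: $\widehat f(\kappa)=\int_{-\infty}^{\infty}e^{i\kappa x}f(x)\,dx$, $\widetilde g(s)=\int_0^\infty e^{-st}g(t)\,dt$; $\widehat{\widetilde q}(\kappa,s)$ denotes the Fourier transform in space and Laplace transform in time. Densities may be generalized functions representing measures. $H$ is the (possibly generalized) function with Laplace transform $\widetilde H$, called the memory function; the Mittag-Leffler memory function is $H_\beta^{ML}(t)=t^{-\beta}/\Gamma(1-\beta)$ for $0<\beta<1$ and $\delta(t)$ for $\beta=1$, with Laplace transform $s^{\beta-1}$, corresponding to the waiting time transform $\widetilde\phi(s)=1/(1+s^\beta)$. The CTRW with independent waiting times (distribution $\Phi$) and jumps (distribution $W$) has sojourn density $p(x,t)$ satisfying $\widetilde H(s)[s\widehat{\widetilde p}(\kappa,s)-1]=[\widehat w(\kappa)-1]\widehat{\widetilde p}(\kappa,s)$. The equation for $q_h$ arises by replacing the jumps $X$ by $hX$ (so $\widehat w(\kappa)$ becomes $\widehat w(\kappa h)$) and multiplying the right-hand side by the respeeding factor $1/(\mu h^\alpha)$.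 ${}_xD_0^\alpha$ is the Riesz operator, $\widehat{{}_xD_0^\alpha f}(\kappa)=-|\kappa|^\alpha\widehat f(\kappa)$. For $0<\beta<1$, ${}_tD_*^\beta$ is the Caputo derivative ${}_tD_*^\beta g(t)=\frac{1}{\Gamma(1-\beta)}\frac{d}{dt}\int_0^t\frac{g(t')}{(t-t')^\beta}dt'-\frac{g(0)t^{-\beta}}{\Gamma(1-\beta)}$, whose Laplace transform is $s^\beta\widetilde g(s)-s^{\beta-1}g(0)$, and ${}_tD_*^1=\frac{d}{dt}$. *)

theory Defs
  imports "HOL-Probability.Probability" "HOL-Library.Landau_Symbols"
begin

text \<open>Probability laws are Borel measures satisfying \<^const>\<open>real_distribution\<close>; their
  distribution functions are \<^const>\<open>cdf\<close>, their Fourier transforms \<^const>\<open>char\<close>.\<close>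

definition waiting_laplace :: "real measure \<Rightarrow> real \<Rightarrow> real" where
  "waiting_laplace \<Phi> s = (LINT t:{0..}|\<Phi>. exp (- s * t))"

definition memory_laplace :: "real measure \<Rightarrow> real \<Rightarrow> real" where
  "memory_laplace \<Phi> s = (1 - waiting_laplace \<Phi> s) / (s * waiting_laplace \<Phi> s)"

definition symmetric_law :: "real measure \<Rightarrow> bool" where
  "symmetric_law W \<longleftrightarrow> (\<forall>x. isCont (cdf W) x \<longrightarrow> cdf W (- x) + cdf W x = 1)"

text \<open>Cases (a) and (b) for the jump law, together with the resulting order and scale.\<close>

definition jump_scaling :: "real measure \<Rightarrow> real \<Rightarrow> real \<Rightarrow> bool" where
  "jump_scaling W \<alpha> \<mu> \<longleftrightarrow>
     (integrable W (\<lambda>x. x\<^sup>2) \<and> \<alpha> = 2 \<and> \<mu> = (LINT x|W. x\<^sup>2) / 2)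
   \<or> (0 < \<alpha> \<and> \<alpha> < 2 \<and>
      (\<exists>b>0. (\<lambda>x. measure W {x<..}) \<sim>[at_top] (\<lambda>x. b / \<alpha> * x powr (- \<alpha>)) \<and>
             \<mu> = b * pi / (Gamma (\<alpha> + 1) * sin (\<alpha> * pi / 2))))"

definition rescaled_equation ::
    "(real \<Rightarrow> real) \<Rightarrow> real measure \<Rightarrow> real \<Rightarrow> real \<Rightarrow> real \<Rightarrow> real \<Rightarrow> real \<Rightarrow> complex \<Rightarrow> bool" where
  "rescaled_equation Hs W \<alpha> \<mu> h \<kappa> s q \<longleftrightarrow>
     of_real (Hs s) * (of_real s * q - 1) =
     (char W (\<kappa> * h) - 1) / of_real (\<mu> * h powr \<alpha>) * q"

definition limit_equation :: "(real \<Rightarrow> real) \<Rightarrow> real \<Rightarrow> real \<Rightarrow> real \<Rightarrow> complex \<Rightarrow> bool" where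
  "limit_equation Hs \<alpha> \<kappa> s u \<longleftrightarrow>
     of_real (Hs s) * (of_real s * u - 1) = - of_real (\<bar>\<kappa>\<bar> powr \<alpha>) * u"

text \<open>Smooth functions on the line, and the Schwartz space used as test functions in space.\<close>

definition nth_deriv :: "nat \<Rightarrow> (real \<Rightarrow> complex) \<Rightarrow> real \<Rightarrow> complex" where
  "nth_deriv n f = ((\<lambda>g x. vector_derivative g (at x)) ^^ n) f"

definition smooth :: "(real \<Rightarrow> complex) \<Rightarrow> bool" where
  "smooth f \<longleftrightarrow> (\<forall>n x. nth_deriv n f differentiable (at x))"

definition schwartz :: "(real \<Rightarrow> complex) \<Rightarrow> bool" where
  "schwartz \<psi> \<longleftrightarrow> smooth \<psi> \<and> (\<forall>m n. bounded (range (\<lambda>x. x ^ m *\<^sub>R nth_deriv n \<psi> x)))"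

definition fourier :: "(real \<Rightarrow> complex) \<Rightarrow> real \<Rightarrow> complex" where
  "fourier f \<kappa> = (LINT x|lborel. iexp (\<kappa> * x) * f x)"

text \<open>The Riesz operator on Schwartz functions: the inverse Fourier transform (for this sign
  convention) of the transform multiplied by \<open>- \<bar>\<kappa>\<bar> powr \<alpha>\<close>.  As the multiplier is even, the
  operator is its own transpose, so it acts on a measure by \<open>\<psi> \<mapsto> \<integral> riesz \<alpha> \<psi>\<close>.\<close>

definition riesz :: "real \<Rightarrow> (real \<Rightarrow> complex) \<Rightarrow> real \<Rightarrow> complex" where
  "riesz \<alpha> \<psi> x =
     (LINT \<kappa>|lborel. iexp (- (\<kappa> * x)) * (- of_real (\<bar>\<kappa>\<bar> powr \<alpha>) * fourier \<psi> \<kappa>)) / of_real (2 * pi)"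

text \<open>Generalized functions of time, carried by the closed half-line and Laplace transformable on
  \<open>s > 0\<close>, in the sense of Zemanian: functionals on smooth functions decaying exponentially with
  all their derivatives.  The seminorms see only \<open>t \<ge> 0\<close>, which enforces the support condition.
  The Laplace transform is the value at the exponential.\<close>

definition time_test_rate :: "real \<Rightarrow> (real \<Rightarrow> complex) \<Rightarrow> bool" where
  "time_test_rate c \<phi> \<longleftrightarrow>
     smooth \<phi> \<and> (\<forall>n. bounded ((\<lambda>t. exp (c * t) *\<^sub>R nth_deriv n \<phi> t) ` {0..}))"

definition time_test :: "(real \<Rightarrow> complex) \<Rightarrow> bool" where
  "time_test \<phi> \<longleftrightarrow> (\<exists>c>0. time_test_rate c \<phi>)"

definition time_gf :: "((real \<Rightarrow> complex) \<Rightarrow> complex) \<Rightarrow> bool" where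
  "time_gf T \<longleftrightarrow>
     (\<forall>\<phi> \<phi>'. time_test \<phi> \<longrightarrow> time_test \<phi>' \<longrightarrow> T (\<lambda>t. \<phi> t + \<phi>' t) = T \<phi> + T \<phi>') \<and>
     (\<forall>a \<phi>. time_test \<phi> \<longrightarrow> T (\<lambda>t. a * \<phi> t) = a * T \<phi>) \<and>
     (\<forall>c>0. \<exists>C N. \<forall>\<phi>. time_test_rate c \<phi> \<longrightarrow>
        norm (T \<phi>) \<le> C * (\<Sum>n\<le>N. SUP t\<in>{0..}. norm (exp (c * t) *\<^sub>R nth_deriv n \<phi> t)))"

definition gf_laplace :: "((real \<Rightarrow> complex) \<Rightarrow> complex) \<Rightarrow> real \<Rightarrow> complex" where
  "gf_laplace T s = T (\<lambda>t. of_real (exp (- s * t)))"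

definition gf_of_fun :: "(real \<Rightarrow> complex) \<Rightarrow> (real \<Rightarrow> complex) \<Rightarrow> complex" where
  "gf_of_fun g \<phi> = (LINT t:{0..}|lborel. g t * \<phi> t)"

text \<open>The derivative of \<open>g\<close> on \<open>t > 0\<close>, extended by zero: for continuously differentiable \<open>g\<close>
  this is \<open>gf_of_fun\<close> of the derivative, by partial integration.  In contrast to the
  distributional derivative of \<open>g\<close> cut off at \<open>0\<close>, the jump at \<open>0\<close> does not contribute.\<close>

definition gf_deriv :: "(real \<Rightarrow> complex) \<Rightarrow> (real \<Rightarrow> complex) \<Rightarrow> complex" where
  "gf_deriv g \<phi> = - (LINT t:{0..}|lborel. g t * nth_deriv 1 \<phi> t) - g 0 * \<phi> 0"

definition gf_conv ::
    "((real \<Rightarrow> complex) \<Rightarrow> complex) \<Rightarrow> ((real \<Rightarrow> complex) \<Rightarrow> complex) \<Rightarrow> (real \<Rightarrow> complex) \<Rightarrow> complex"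
  where "gf_conv S T \<phi> = S (\<lambda>\<tau>. T (\<lambda>t. \<phi> (\<tau> + t)))"

definition memory_function ::
    "((real \<Rightarrow> complex) \<Rightarrow> complex) \<Rightarrow> (real \<Rightarrow> real) \<Rightarrow> bool" where
  "memory_function H Hs \<longleftrightarrow> time_gf H \<and> (\<forall>s>0. gf_laplace H s = of_real (Hs s))"

definition mittag_leffler_memory :: "real \<Rightarrow> (real \<Rightarrow> complex) \<Rightarrow> complex" where
  "mittag_leffler_memory \<beta> =
     (if \<beta> = 1 then (\<lambda>\<phi>. \<phi> 0) else gf_of_fun (\<lambda>t. of_real (t powr (- \<beta>) / Gamma (1 - \<beta>))))"

text \<open>Time-dependent densities \<open>u(x,t)\<close>, possibly generalized: \<open>u t\<close> is the measure
  \<open>u(x,t) dx\<close>.  The mass may grow at most subexponentially, so that the Laplace transform in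
  time exists for all \<open>s > 0\<close>, and \<open>u\<close> is weakly continuous up to and including \<open>t = 0\<close>,
  which makes the initial condition meaningful.\<close>

definition density_evolution :: "(real \<Rightarrow> real measure) \<Rightarrow> bool" where
  "density_evolution u \<longleftrightarrow>
     (\<forall>t\<ge>0. finite_measure (u t) \<and> sets (u t) = sets borel) \<and>
     (\<forall>c>0. \<exists>C. \<forall>t\<ge>0. measure (u t) UNIV \<le> C * exp (c * t)) \<and>
     (\<forall>f::real \<Rightarrow> real. continuous_on UNIV f \<longrightarrow> bounded (range f) \<longrightarrow>
        continuous_on {0..} (\<lambda>t. LINT x|u t. f x))"

definition pairing :: "(real \<Rightarrow> real measure) \<Rightarrow> (real \<Rightarrow> complex) \<Rightarrow> real \<Rightarrow> complex" where
  "pairing u \<psi> t = (LINT x|u t. \<psi> x)"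

definition fourier_laplace :: "(real \<Rightarrow> real measure) \<Rightarrow> real \<Rightarrow> real \<Rightarrow> complex" where
  "fourier_laplace u \<kappa> s = (LINT t:{0..}|lborel. of_real (exp (- s * t)) * char (u t) \<kappa>)"

text \<open>The equation with memory \<open>H\<close> is required in the sense of generalized functions of \<open>x\<close>
  (tested with \<open>\<psi>\<close>) and of \<open>t\<close> (tested with \<open>\<phi>\<close>), since \<open>H\<close> need not be a function.\<close>

definition memory_cauchy_problem ::
    "((real \<Rightarrow> complex) \<Rightarrow> complex) \<Rightarrow> real \<Rightarrow> (real \<Rightarrow> real measure) \<Rightarrow> bool" where
  "memory_cauchy_problem H \<alpha> u \<longleftrightarrow>
     (\<forall>\<psi> \<phi>. schwartz \<psi> \<longrightarrow> time_test \<phi> \<longrightarrow>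
        gf_conv H (gf_deriv (pairing u \<psi>)) \<phi> = gf_of_fun (pairing u (riesz \<alpha> \<psi>)) \<phi>) \<and>
     u 0 = return borel 0"

definition has_caputo_derivative ::
    "real \<Rightarrow> (real \<Rightarrow> complex) \<Rightarrow> complex \<Rightarrow> real \<Rightarrow> bool" where
  "has_caputo_derivative \<beta> g D t \<longleftrightarrow>
     (if \<beta> = 1 then (g has_vector_derivative D) (at t)
      else \<exists>d. ((\<lambda>r. (LINT t':{0..r}|lborel. g t' / of_real ((r - t') powr \<beta>)) / of_real (Gamma (1 - \<beta>)))
                 has_vector_derivative d) (at t) \<and>
               D = d - g 0 * of_real (t powr (- \<beta>)) / of_real (Gamma (1 - \<beta>)))"

text \<open>Here the time derivative is pointwise for \<open>t > 0\<close>; only \<open>x\<close> is tested.\<close>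

definition fractional_cauchy_problem :: "real \<Rightarrow> real \<Rightarrow> (real \<Rightarrow> real measure) \<Rightarrow> bool" where
  "fractional_cauchy_problem \<beta> \<alpha> u \<longleftrightarrow>
     (\<forall>\<psi>. schwartz \<psi> \<longrightarrow>
        (\<forall>t>0. has_caputo_derivative \<beta> (pairing u \<psi>) (pairing u (riesz \<alpha> \<psi>) t) t)) \<and>
     u 0 = return borel 0"

end

theory Submission
  imports Defs
begin

text \<open>In Fourier-Laplace variables both the rescaled and the limiting equation read
  \<open>H (s q - 1) = z q\<close> with \<open>H > 0\<close> and a multiplier \<open>z\<close> of nonpositive real part, so the solution
  is \<open>H / (s H - z)\<close>, and the solutions converge as soon as the multipliers do:
  \<open>(w(\<kappa> h) - 1) / (\<mu> h\<^sup>\<alpha>) \<rightarrow> - \<bar>\<kappa>\<bar>\<^sup>\<alpha>\<close> (\<open>jump_symbol_limit\<close>).  By symmetry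
  \<open>1 - w(\<kappa>)\<close> is the expectation of \<open>1 - cos (\<kappa> X)\<close>.  For finite variance the limit is dominated
  convergence.  For a heavy tail, \<open>1 - cos\<close> is first stopped at a level \<open>A\<close>; the stopped
  expectation is an integral over \<open>{0..A}\<close> of \<open>sin\<close> against the tail of \<open>\<bar>X\<bar>\<close>, in which the tail may be
  replaced by its power law, and then \<open>A\<close> tends to infinity.  The constant in \<open>\<mu>\<close> is the value
  of the integral of \<open>sin u * u powr (- \<alpha>)\<close> over the half-line.

  The two Cauchy problems are compared with the limit equation through an intermediate form:
  test with a Schwartz function \<open>\<psi>\<close> in space and take the Laplace transform \<open>L\<close> in time.  With
  \<open>g\<close> and \<open>D\<close> the pairings of \<open>u\<close> with \<open>\<psi>\<close> and with its Riesz transform, the intermediate form is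
  \<open>H (s L g - g 0) = L D\<close> together with \<open>u 0 = \<delta>\<close>
  (\<open>limit_equation_iff_initial_and_tested\<close>).  By Fourier inversion the defect of this equation is,
  up to the factor \<open>2 * pi\<close>, the integral of the Fourier transform of \<open>\<psi>\<close> against the defect of the limit equation.  So the
  latter implies the former, and the converse follows by concentrating the transform of \<open>\<psi>\<close> at
  one frequency with Gaussians.  The limit equation also forces \<open>u 0 = \<delta>\<close>: since waiting times
  are positive, \<open>s H\<close> tends to infinity with \<open>s\<close>, hence \<open>s u(\<kappa>,s) \<rightarrow> 1\<close>, and by the initial value
  theorem this limit is the characteristic function of \<open>u 0\<close>.

  The problem with memory is an identity between two generalized functions of time.  A generalized
  function is determined by its Laplace transform, because linear combinations of exponentials
  are dense among the test functions (\<open>exponentials_dense\<close>, from Weierstrass approximation in the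
  variable \<open>exp (- t)\<close>), and the transform turns convolutions into products
  (\<open>time_gf_conv\<close>, \<open>gf_laplace_conv\<close>).  This gives \<open>memory_cauchy_problem_iff\<close>.

  The fractional problem is pointwise in time.  It says that the fractional integral of \<open>g\<close>
  of order \<open>1 - \<beta>\<close> has a prescribed continuous derivative on \<open>t > 0\<close>; for continuous functions
  up to \<open>t = 0\<close> this is equivalent to the transformed identity (\<open>derivative_iff_laplace\<close>), which is again
  the intermediate form with \<open>H = s powr (\<beta> - 1)\<close> (\<open>fractional_cauchy_problem_iff\<close>).\<close>

section \<open>Iterated derivatives\<close>

lemma nth_deriv_0 [simp]: "nth_deriv 0 f = f"
  by (simp add: nth_deriv_def)

lemma nth_deriv_Suc: "nth_deriv (Suc n) f = (\<lambda>x. vector_derivative (nth_deriv n f) (at x))"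
  by (simp add: nth_deriv_def)

lemma nth_deriv_nth_deriv: "nth_deriv n (nth_deriv m f) = nth_deriv (n + m) f"
  by (simp add: nth_deriv_def funpow_add)

text \<open>Iterated derivatives are computed by guessing the whole sequence of them.\<close>

lemma smooth_by_derivs:
  assumes "F 0 = f" and "\<And>n x. (F n has_vector_derivative F (Suc n) x) (at x)"
  shows nth_deriv_by_derivs: "nth_deriv n f = F n" and "smooth f"
proof -
  have *: "nth_deriv n f = F n" for n
  proof (induction n)
    case 0
    then show ?case using assms(1) by simp
  next
    case (Suc n)
    then show ?case
      using assms(2)[of n, THEN vector_derivative_at] by (simp add: nth_deriv_Suc)
  qed
  show "nth_deriv n f = F n" by (rule *)
  show "smooth f"
    unfolding smooth_def * using assms(2) by (blast intro: differentiableI_vector)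
qed

lemma smooth_has_vector_derivative:
  "smooth f \<Longrightarrow> (nth_deriv n f has_vector_derivative nth_deriv (Suc n) f x) (at x)"
  by (simp add: smooth_def nth_deriv_Suc vector_derivative_works)

lemma smooth_continuous_on: "smooth f \<Longrightarrow> continuous_on S (nth_deriv n f)"
  by (meson smooth_has_vector_derivative continuous_at_imp_continuous_on
      has_vector_derivative_continuous)

lemma smooth_nth_deriv: "smooth f \<Longrightarrow> smooth (nth_deriv m f)"
  by (simp add: smooth_def nth_deriv_nth_deriv)

lemma
  assumes "smooth f" "smooth g"
  shows nth_deriv_add: "nth_deriv n (\<lambda>x. f x + g x) = (\<lambda>x. nth_deriv n f x + nth_deriv n g x)"
    and smooth_add: "smooth (\<lambda>x. f x + g x)"
  by (rule smooth_by_derivs[where F = "\<lambda>n x. nth_deriv n f x + nth_deriv n g x"];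
      (intro has_vector_derivative_add smooth_has_vector_derivative assms)?; simp)+

lemma
  assumes "smooth f"
  shows nth_deriv_cmult: "nth_deriv n (\<lambda>x. a * f x) = (\<lambda>x. a * nth_deriv n f x)"
    and smooth_cmult: "smooth (\<lambda>x. a * f x)"
  by (rule smooth_by_derivs[where F = "\<lambda>n x. a * nth_deriv n f x"];
      (intro has_vector_derivative_mult_right smooth_has_vector_derivative assms)?; simp)+

lemma
  assumes "smooth f"
  shows nth_deriv_shift: "nth_deriv n (\<lambda>x. f (a + x)) = (\<lambda>x. nth_deriv n f (a + x))"
    and smooth_shift: "smooth (\<lambda>x. f (a + x))"
proof -
  have *: "((\<lambda>x. nth_deriv n f (a + x)) has_vector_derivative nth_deriv (Suc n) f (a + x)) (at x)"
    for n x
  proof -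
    have "((\<lambda>x. a + x) has_vector_derivative 1) (at x)"
      by (auto intro!: derivative_eq_intros)
    from vector_diff_chain_at[OF this smooth_has_vector_derivative[OF assms, of n "a + x"]]
    show ?thesis by (simp add: o_def)
  qed
  show "nth_deriv n (\<lambda>x. f (a + x)) = (\<lambda>x. nth_deriv n f (a + x))" "smooth (\<lambda>x. f (a + x))"
    by (rule smooth_by_derivs[where F = "\<lambda>n x. nth_deriv n f (a + x)"]; use * in simp)+
qed

lemma
  shows nth_deriv_exp: "nth_deriv n (\<lambda>t. of_real (exp (- s * t)))
          = (\<lambda>t. of_real ((- s) ^ n * exp (- s * t)))"
    and smooth_exp: "smooth (\<lambda>t. of_real (exp (- s * t)))"
proof -
  have *: "((\<lambda>t. complex_of_real ((- s) ^ n * exp (- s * t))) has_vector_derivative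
          of_real ((- s) ^ Suc n * exp (- s * t))) (at t)" for n t
    by (rule has_vector_derivative_of_real)
       (auto intro!: derivative_eq_intros simp: has_real_derivative_iff_has_vector_derivative[symmetric])
  show "nth_deriv n (\<lambda>t. of_real (exp (- s * t))) = (\<lambda>t. of_real ((- s) ^ n * exp (- s * t)))"
     "smooth (\<lambda>t. of_real (exp (- s * t)))"
    by (rule smooth_by_derivs[where F = "\<lambda>n t. of_real ((- s) ^ n * exp (- s * t))"]; use * in simp)+
qed

section \<open>Test functions of time and their seminorms\<close>

definition test_norm :: "real \<Rightarrow> nat \<Rightarrow> (real \<Rightarrow> complex) \<Rightarrow> real" where
  "test_norm c n \<phi> = (SUP t\<in>{0..}. norm (exp (c * t) *\<^sub>R nth_deriv n \<phi> t))"

lemma norm_exp_scale_le: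
  "norm (exp (c * t) *\<^sub>R z) \<le> B \<longleftrightarrow> norm z \<le> B * exp (- c * t)" for z :: complex
  by (simp add: exp_minus field_simps)

lemma time_test_rate_iff:
  "time_test_rate c \<phi> \<longleftrightarrow>
     smooth \<phi> \<and> (\<forall>n. \<exists>B. \<forall>t\<ge>0. norm (nth_deriv n \<phi> t) \<le> B * exp (- c * t))"
proof -
  have "bounded ((\<lambda>t. exp (c * t) *\<^sub>R nth_deriv n \<phi> t) ` {0..}) \<longleftrightarrow>
      (\<exists>B. \<forall>t\<ge>0. norm (nth_deriv n \<phi> t) \<le> B * exp (- c * t))" for n
    unfolding bounded_iff norm_exp_scale_le[symmetric] by auto
  then show ?thesis
    unfolding time_test_rate_def by blast
qed

text \<open>Boundedness of the weighted derivatives makes the supremum a genuine bound.\<close>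

lemma test_norm_bound:
  assumes "time_test_rate c \<phi>" "t \<ge> 0"
  shows "norm (nth_deriv n \<phi> t) \<le> test_norm c n \<phi> * exp (- c * t)"
proof -
  have "norm (exp (c * t) *\<^sub>R nth_deriv n \<phi> t) \<le> test_norm c n \<phi>"
    unfolding test_norm_def
  proof (rule cSUP_upper)
    show "bdd_above ((\<lambda>t. norm (exp (c * t) *\<^sub>R nth_deriv n \<phi> t)) ` {0..})"
      using assms(1) by (auto simp: time_test_rate_def bounded_iff bdd_above_def)
  qed (use assms in simp)
  then show ?thesis by (simp only: norm_exp_scale_le)
qed

lemma test_norm_le:
  assumes "\<And>t. t \<ge> 0 \<Longrightarrow> norm (nth_deriv n \<phi> t) \<le> B * exp (- c * t)"
  shows "test_norm c n \<phi> \<le> B"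
  unfolding test_norm_def by (rule cSUP_least) (use assms in \<open>simp_all only: norm_exp_scale_le, auto\<close>)

lemma test_norm_nonneg: "time_test_rate c \<phi> \<Longrightarrow> test_norm c n \<phi> \<ge> 0"
  using test_norm_bound[of c \<phi> 0 n] by (simp add: order_trans[OF norm_ge_zero])

lemma time_test_rate_smooth: "time_test_rate c \<phi> \<Longrightarrow> smooth \<phi>"
  by (simp add: time_test_rate_iff)

lemma time_test_rate_mono:
  assumes "time_test_rate c \<phi>" "c' \<le> c"
  shows "time_test_rate c' \<phi>"
  unfolding time_test_rate_iff
proof (intro conjI allI)
  fix n
  have "norm (nth_deriv n \<phi> t) \<le> test_norm c n \<phi> * exp (- c' * t)" if "t \<ge> 0" for t
  proof -
    have "c' * t \<le> c * t" using assms that by (simp add: mult_right_mono)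
    then show ?thesis
      using test_norm_bound[OF assms(1) that, of n] test_norm_nonneg[OF assms(1), of n]
      by (smt (verit) exp_le_cancel_iff mult_left_mono mult_minus_left)
  qed
  then show "\<exists>B. \<forall>t\<ge>0. norm (nth_deriv n \<phi> t) \<le> B * exp (- c' * t)" by blast
qed (use assms in \<open>simp add: time_test_rate_smooth\<close>)

lemma time_test_rate_add:
  assumes "time_test_rate c \<phi>" "time_test_rate c \<phi>'"
  shows "time_test_rate c (\<lambda>t. \<phi> t + \<phi>' t)"
  unfolding time_test_rate_iff
proof (intro conjI allI)
  fix n
  have "norm (nth_deriv n (\<lambda>t. \<phi> t + \<phi>' t) t) \<le> (test_norm c n \<phi> + test_norm c n \<phi>') * exp (- c * t)"
    if "t \<ge> 0" for t
    using test_norm_bound[OF assms(1) that, of n] test_norm_bound[OF assms(2) that, of n]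
      norm_triangle_ineq[of "nth_deriv n \<phi> t" "nth_deriv n \<phi>' t"]
      assms[THEN time_test_rate_smooth]
    by (simp add: nth_deriv_add distrib_right)
  then show "\<exists>B. \<forall>t\<ge>0. norm (nth_deriv n (\<lambda>t. \<phi> t + \<phi>' t) t) \<le> B * exp (- c * t)" by blast
qed (use assms in \<open>simp add: time_test_rate_smooth smooth_add\<close>)

lemma time_test_rate_cmult:
  assumes "time_test_rate c \<phi>"
  shows "time_test_rate c (\<lambda>t. a * \<phi> t)"
  unfolding time_test_rate_iff
proof (intro conjI allI)
  fix n
  have "norm (nth_deriv n (\<lambda>t. a * \<phi> t) t) \<le> (norm a * test_norm c n \<phi>) * exp (- c * t)"
    if "t \<ge> 0" for t
    using mult_left_mono[OF test_norm_bound[OF assms(1) that, of n], of "norm a"]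
      assms[THEN time_test_rate_smooth]
    by (simp add: nth_deriv_cmult norm_mult mult.assoc)
  then show "\<exists>B. \<forall>t\<ge>0. norm (nth_deriv n (\<lambda>t. a * \<phi> t) t) \<le> B * exp (- c * t)" by blast
qed (use assms in \<open>simp add: time_test_rate_smooth smooth_cmult\<close>)

lemma time_test_rate_exp:
  assumes "c \<le> s" shows "time_test_rate c (\<lambda>t. of_real (exp (- s * t)))"
proof -
  have "time_test_rate s (\<lambda>t. of_real (exp (- s * t)))"
    unfolding time_test_rate_iff nth_deriv_exp
    using smooth_exp[of s] by (auto simp: norm_mult norm_power intro!: exI)
  then show ?thesis using assms by (rule time_test_rate_mono)
qed

lemma time_test_add: "time_test \<phi> \<Longrightarrow> time_test \<phi>' \<Longrightarrow> time_test (\<lambda>t. \<phi> t + \<phi>' t)"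
proof -
  assume "time_test \<phi>" "time_test \<phi>'"
  then obtain c c' where "c > 0" "c' > 0" "time_test_rate c \<phi>" "time_test_rate c' \<phi>'"
    by (auto simp: time_test_def)
  then show ?thesis unfolding time_test_def
    by (intro exI[of _ "min c c'"] conjI time_test_rate_add)
       (auto intro: time_test_rate_mono)
qed

lemma time_test_cmult: "time_test \<phi> \<Longrightarrow> time_test (\<lambda>t. a * \<phi> t)"
  by (auto simp: time_test_def intro: time_test_rate_cmult)

lemma time_test_exp: "s > 0 \<Longrightarrow> time_test (\<lambda>t. of_real (exp (- s * t)))"
  unfolding time_test_def by (intro exI[of _ s] conjI time_test_rate_exp) auto

lemma time_test_rate_nth_deriv: "time_test_rate c \<phi> \<Longrightarrow> time_test_rate c (nth_deriv m \<phi>)"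
  by (auto simp: time_test_rate_iff smooth_nth_deriv nth_deriv_nth_deriv)

lemma test_norm_nth_deriv: "test_norm c n (nth_deriv m \<phi>) = test_norm c (n + m) \<phi>"
  by (simp add: test_norm_def nth_deriv_nth_deriv)

text \<open>The weight controls a test function only on \<open>t \<ge> 0\<close>, but a smooth function is bounded on the compact
  interval that is added when the bound is moved to the left.  This makes test functions stable
  under shifts in both directions, and convolution needs the shifted functional also at negative
  arguments, where it must still be smooth.\<close>

lemma time_test_bounded_right_of:
  assumes "time_test_rate c \<phi>"
  shows "\<exists>B\<ge>0. \<forall>t\<ge>a. norm (nth_deriv n \<phi> t) \<le> B * exp (- c * t)"
proof -
  have "compact ((\<lambda>t. exp (c * t) *\<^sub>R nth_deriv n \<phi> t) ` {a..0})"
    by (intro compact_continuous_image continuous_intros smooth_continuous_on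
        time_test_rate_smooth[OF assms] compact_Icc)
  then have "bounded ((\<lambda>t. exp (c * t) *\<^sub>R nth_deriv n \<phi> t) ` {a..0})"
    by (rule compact_imp_bounded)
  then have "\<exists>B. \<forall>t\<in>{a..0}. norm (exp (c * t) *\<^sub>R nth_deriv n \<phi> t) \<le> B"
    unfolding bounded_iff by simp
  then obtain B where B: "\<And>t. t \<in> {a..0} \<Longrightarrow> norm (exp (c * t) *\<^sub>R nth_deriv n \<phi> t) \<le> B"
    by blast
  have "norm (nth_deriv n \<phi> t) \<le> max B (test_norm c n \<phi>) * exp (- c * t)" if "t \<ge> a" for t
  proof (cases "t \<ge> 0")
    case True
    then show ?thesis using test_norm_bound[OF assms True, of n]
      by (smt (verit) exp_gt_zero mult_right_mono)
  next
    case False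
    then have "norm (exp (c * t) *\<^sub>R nth_deriv n \<phi> t) \<le> max B (test_norm c n \<phi>)"
      using B[of t] that by auto
    then show ?thesis by (simp only: norm_exp_scale_le)
  qed
  moreover have "max B (test_norm c n \<phi>) \<ge> 0"
    using test_norm_nonneg[OF assms, of n] by simp
  ultimately show ?thesis by (intro exI conjI) auto
qed

lemma time_test_rate_shift:
  assumes \<phi>: "time_test_rate c \<phi>"
  shows "time_test_rate c (\<lambda>t. \<phi> (a + t))"
proof -
  note sm = time_test_rate_smooth[OF \<phi>]
  have bound: "\<exists>B. \<forall>t\<ge>0. norm (nth_deriv n (\<lambda>t. \<phi> (a + t)) t) \<le> B * exp (- c * t)" for n
  proof -
    obtain B where B: "\<forall>t\<ge>a. norm (nth_deriv n \<phi> t) \<le> B * exp (- c * t)"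
      using time_test_bounded_right_of[OF \<phi>, of a n] by (elim exE conjE)
    have "norm (nth_deriv n (\<lambda>t. \<phi> (a + t)) t) \<le> (B * exp (- c * a)) * exp (- c * t)"
      if "t \<ge> 0" for t
    proof -
      have "exp (- c * (a + t)) = exp (- c * a) * exp (- c * t)"
        by (simp add: exp_add[symmetric] algebra_simps)
      moreover have "a + t \<ge> a" using that by simp
      ultimately have "norm (nth_deriv n \<phi> (a + t)) \<le> (B * exp (- c * a)) * exp (- c * t)"
        using B[rule_format, of "a + t"] by (simp only: mult.assoc)
      then show ?thesis by (simp only: nth_deriv_shift[OF sm, of n a])
    qed
    then show ?thesis by (intro exI[of _ "B * exp (- c * a)"] allI impI)
  qed
  show ?thesis
    using smooth_shift[OF sm, of a] bound unfolding time_test_rate_iff by (intro conjI allI)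
qed

lemma time_test_shift: "time_test \<phi> \<Longrightarrow> time_test (\<lambda>t. \<phi> (a + t))"
proof -
  assume "time_test \<phi>"
  then obtain c where "c > 0" "time_test_rate c \<phi>" unfolding time_test_def by blast
  show ?thesis unfolding time_test_def
  proof (intro exI conjI)
    show "c > 0" by fact
    show "time_test_rate c (\<lambda>t. \<phi> (a + t))"
      using \<open>time_test_rate c \<phi>\<close> by (rule time_test_rate_shift)
  qed
qed

lemma test_norm_shift:
  assumes "time_test_rate c \<phi>" "\<tau> \<ge> 0"
  shows "test_norm c n (\<lambda>t. \<phi> (\<tau> + t)) \<le> test_norm c n \<phi> * exp (- c * \<tau>)"
proof (rule test_norm_le)
  fix t :: real assume "t \<ge> 0"
  then have "\<tau> + t \<ge> 0" using assms(2) by simp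
  from test_norm_bound[OF assms(1) this, of n]
  have "norm (nth_deriv n (\<lambda>t. \<phi> (\<tau> + t)) t) \<le> test_norm c n \<phi> * exp (- c * (\<tau> + t))"
    unfolding nth_deriv_shift[OF time_test_rate_smooth[OF assms(1)]] .
  also have "exp (- c * (\<tau> + t)) = exp (- c * \<tau>) * exp (- c * t)"
    by (simp add: exp_add[symmetric] algebra_simps)
  finally show "norm (nth_deriv n (\<lambda>t. \<phi> (\<tau> + t)) t) \<le> test_norm c n \<phi> * exp (- c * \<tau>) * exp (- c * t)"
    by (simp only: mult.assoc)
qed

lemma time_gf_add: "time_gf T \<Longrightarrow> time_test \<phi> \<Longrightarrow> time_test \<phi>' \<Longrightarrow> T (\<lambda>t. \<phi> t + \<phi>' t) = T \<phi> + T \<phi>'"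
  by (simp add: time_gf_def)

lemma time_gf_cmult: "time_gf T \<Longrightarrow> time_test \<phi> \<Longrightarrow> T (\<lambda>t. a * \<phi> t) = a * T \<phi>"
  by (simp add: time_gf_def)

lemma time_gf_bound:
  assumes "time_gf T" "c > 0"
  obtains C N where "C \<ge> 0"
    "\<And>\<phi>. time_test_rate c \<phi> \<Longrightarrow> norm (T \<phi>) \<le> C * (\<Sum>n\<le>N. test_norm c n \<phi>)"
proof -
  obtain C N where CN: "\<And>\<phi>. time_test_rate c \<phi> \<Longrightarrow> norm (T \<phi>) \<le> C * (\<Sum>n\<le>N. test_norm c n \<phi>)"
    using assms unfolding time_gf_def test_norm_def by blast
  have "norm (T \<phi>) \<le> max C 0 * (\<Sum>n\<le>N. test_norm c n \<phi>)" if "time_test_rate c \<phi>" for \<phi>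
    using CN[OF that] sum_nonneg[of "{..N}" "\<lambda>n. test_norm c n \<phi>"] test_norm_nonneg[OF that]
    by (smt (verit) mult_right_mono)
  then show thesis using that[of "max C 0" N] by simp
qed

lemma time_gfI:
  assumes "\<And>\<phi> \<phi>'. time_test \<phi> \<Longrightarrow> time_test \<phi>' \<Longrightarrow> T (\<lambda>t. \<phi> t + \<phi>' t) = T \<phi> + T \<phi>'"
    and "\<And>a \<phi>. time_test \<phi> \<Longrightarrow> T (\<lambda>t. a * \<phi> t) = a * T \<phi>"
    and "\<And>c. c > 0 \<Longrightarrow> \<exists>C N. \<forall>\<phi>. time_test_rate c \<phi> \<longrightarrow> norm (T \<phi>) \<le> C * (\<Sum>n\<le>N. test_norm c n \<phi>)"
  shows "time_gf T"
  unfolding time_gf_def test_norm_def[symmetric]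
  by (intro conjI allI impI) (simp_all only: assms)

section \<open>Convolution of generalized functions\<close>

text \<open>Taylor's formula would give the factor one half; the weaker bound follows from the mean value
  inequality alone, which also holds for vector-valued functions.\<close>

lemma second_order_remainder:
  fixes f :: "real \<Rightarrow> 'a::real_normed_vector"
  assumes "\<And>y. (f has_vector_derivative f' y) (at y)" "\<And>y. (f' has_vector_derivative f'' y) (at y)"
    and "\<And>y. y \<in> closed_segment x (x + h) \<Longrightarrow> norm (f'' y) \<le> B"
  shows "norm (f (x + h) - f x - h *\<^sub>R f' x) \<le> B * h\<^sup>2"
proof -
  have f'_bound: "norm (f' y - f' x) \<le> \<bar>h\<bar> * B" if y: "y \<in> closed_segment x (x + h)" for y
  proof -
    have sub: "closed_segment x y \<subseteq> closed_segment x (x + h)"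
      using y by (simp add: subset_closed_segment)
    have "norm (f' y - f' x) \<le> B * norm (y - x)"
    proof (rule differentiable_bound[where f' = "\<lambda>y t. t *\<^sub>R f'' y" and S = "closed_segment x y"])
      show "(f' has_derivative (\<lambda>t. t *\<^sub>R f'' z)) (at z within closed_segment x y)" for z
        using assms(2)[of z] by (metis has_vector_derivative_def has_derivative_at_withinI)
      show "onorm (\<lambda>t. t *\<^sub>R f'' z) \<le> B" if "z \<in> closed_segment x y" for z
      proof -
        have "norm (f'' z) \<le> B" using that sub assms(3) by blast
        moreover have "onorm (\<lambda>t::real. t *\<^sub>R f'' z) \<le> norm (f'' z)"
          by (rule onorm_le) simp
        ultimately show ?thesis by simp
      qed
    qed (auto simp: convex_closed_segment)
    moreover have "norm (y - x) \<le> \<bar>h\<bar>"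
      using y segment_bound1[of y x "x + h"] by (simp add: abs_minus_commute)
    moreover have "B \<ge> 0" using assms(3)[OF y] norm_ge_zero[of "f'' y"] by linarith
    ultimately show ?thesis by (smt (verit) mult.commute mult_right_mono)
  qed
  have "norm (f (x + h) - f x - (x + h - x) *\<^sub>R f' x) \<le> norm (x + h - x) * (\<bar>h\<bar> * B)"
  proof (rule vector_differentiable_bound_linearization[where S = "closed_segment x (x + h)"])
    show "(f has_vector_derivative f' y) (at y within closed_segment x (x + h))" for y
      using assms(1) by (rule has_vector_derivative_at_within)
  qed (use f'_bound in auto)
  then show ?thesis by (simp add: power2_eq_square mult_ac)
qed

lemma has_vector_derivative_of_quadratic_remainder:
  fixes F :: "real \<Rightarrow> 'a::real_normed_vector"
  assumes "\<And>h. \<bar>h\<bar> \<le> 1 \<Longrightarrow> norm (F (x + h) - F x - h *\<^sub>R D) \<le> K * h\<^sup>2"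
  shows "(F has_vector_derivative D) (at x)"
  unfolding has_vector_derivative_def has_derivative_at
proof
  have K: "((\<lambda>h. K * \<bar>h\<bar>) \<longlongrightarrow> 0) (at 0)"
    by (rule tendsto_eq_intros refl | simp)+
  show "(\<lambda>h. norm (F (x + h) - F x - h *\<^sub>R D) / norm h) \<midarrow>0\<rightarrow> 0"
  proof (rule Lim_null_comparison[OF _ K])
    have "eventually (\<lambda>h. h \<in> {-1<..<1} - {0}) (at (0::real))"
      by (rule eventually_at_in_open) auto
    then show "\<forall>\<^sub>F h in at 0. norm (norm (F (x + h) - F x - h *\<^sub>R D) / norm h) \<le> K * \<bar>h\<bar>"
    proof eventually_elim
      case (elim h)
      then have "norm (F (x + h) - F x - h *\<^sub>R D) \<le> (K * \<bar>h\<bar>) * \<bar>h\<bar>"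
        using assms[of h] by (auto simp: power2_eq_square mult.assoc)
      then show ?case using elim by (simp add: divide_le_eq)
    qed
  qed
qed (auto intro: bounded_linear_scaleR_left)

text \<open>The second-order remainders of all derivatives of \<open>\<phi>\<close> decay at the same exponential rate as \<open>\<phi>\<close>.
  Hence the difference quotients of the shifts converge in every seminorm, and a continuous
  functional may be differentiated under its argument.\<close>

lemma gf_shift_has_vector_derivative:
  assumes T: "time_gf T" and c: "c > 0" and \<phi>: "time_test_rate c \<phi>"
  shows "((\<lambda>\<tau>. T (\<lambda>t. \<phi> (\<tau> + t))) has_vector_derivative T (\<lambda>t. nth_deriv 1 \<phi> (\<tau> + t))) (at \<tau>)"
proof -
  obtain C N where "C \<ge> 0" and CN:
    "\<And>\<phi>. time_test_rate c \<phi> \<Longrightarrow> norm (T \<phi>) \<le> C * (\<Sum>n\<le>N. test_norm c n \<phi>)"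
    using time_gf_bound[OF T c] by blast
  note sm = time_test_rate_smooth[OF \<phi>]
  have "\<forall>n. \<exists>B. B \<ge> 0 \<and> (\<forall>t\<ge>\<tau> - 1. norm (nth_deriv (Suc (Suc n)) \<phi> t) \<le> B * exp (- c * t))"
    using time_test_bounded_right_of[OF \<phi>] by blast
  then obtain B where B0: "\<And>n. B n \<ge> 0"
    and B: "\<And>n t. t \<ge> \<tau> - 1 \<Longrightarrow> norm (nth_deriv (Suc (Suc n)) \<phi> t) \<le> B n * exp (- c * t)"
    by metis
  define K where "K = C * (\<Sum>n\<le>N. B n * exp (- c * (\<tau> - 1)))"
  have rates: "time_test_rate c (\<lambda>t. \<phi> (r + t))" "time_test_rate c (\<lambda>t. nth_deriv 1 \<phi> (r + t))" for r
    by (intro time_test_rate_shift \<phi> time_test_rate_nth_deriv)+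
  have tests: "time_test (\<lambda>t. \<phi> (r + t))" "time_test (\<lambda>t. nth_deriv 1 \<phi> (r + t))" for r
    using rates c by (auto simp only: time_test_def)
  show ?thesis
  proof (rule has_vector_derivative_of_quadratic_remainder)
    fix h :: real assume h: "\<bar>h\<bar> \<le> 1"
    define \<rho> where "\<rho> = (\<lambda>t. \<phi> ((\<tau> + h) + t) + ((-1) * \<phi> (\<tau> + t) + (- of_real h) * nth_deriv 1 \<phi> (\<tau> + t)))"
    have \<rho>_rate: "time_test_rate c \<rho>"
      unfolding \<rho>_def by (intro time_test_rate_add time_test_rate_cmult rates)
    have eq: "T (\<lambda>t. \<phi> (\<tau> + h + t)) - T (\<lambda>t. \<phi> (\<tau> + t)) - h *\<^sub>R T (\<lambda>t. nth_deriv 1 \<phi> (\<tau> + t)) = T \<rho>"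
      unfolding \<rho>_def
      by (subst time_gf_add[OF T] time_gf_cmult[OF T],
          (intro tests time_test_add time_test_cmult)+)+ (simp add: scaleR_conv_of_real)
    have "test_norm c n \<rho> \<le> h\<^sup>2 * (B n * exp (- c * (\<tau> - 1)))" for n
    proof (rule test_norm_le)
      fix t :: real assume t: "t \<ge> 0"
      have nth: "nth_deriv n \<rho> t = nth_deriv n \<phi> ((\<tau> + t) + h) - nth_deriv n \<phi> (\<tau> + t)
          - h *\<^sub>R nth_deriv (Suc n) \<phi> (\<tau> + t)"
        unfolding \<rho>_def
        by (simp only: nth_deriv_add nth_deriv_cmult nth_deriv_shift smooth_add smooth_cmult
            smooth_shift smooth_nth_deriv sm nth_deriv_nth_deriv)
           (simp add: scaleR_conv_of_real algebra_simps)
      have "norm (nth_deriv n \<phi> ((\<tau> + t) + h) - nth_deriv n \<phi> (\<tau> + t)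
          - h *\<^sub>R nth_deriv (Suc n) \<phi> (\<tau> + t)) \<le> (B n * exp (- c * (\<tau> + t - 1))) * h\<^sup>2"
      proof (rule second_order_remainder[OF smooth_has_vector_derivative[OF sm] smooth_has_vector_derivative[OF sm]])
        fix y assume "y \<in> closed_segment (\<tau> + t) (\<tau> + t + h)"
        then have y: "y \<ge> \<tau> + t - 1" using h by (auto simp: closed_segment_eq_real_ivl split: if_splits)
        then have "norm (nth_deriv (Suc (Suc n)) \<phi> y) \<le> B n * exp (- c * y)"
          using t by (intro B) auto
        also have "\<dots> \<le> B n * exp (- c * (\<tau> + t - 1))"
          using y c B0[of n] by (intro mult_left_mono) auto
        finally show "norm (nth_deriv (Suc (Suc n)) \<phi> y) \<le> B n * exp (- c * (\<tau> + t - 1))" .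
      qed
      also have "exp (- c * (\<tau> + t - 1)) = exp (- c * (\<tau> - 1)) * exp (- c * t)"
        by (simp add: exp_add[symmetric] algebra_simps)
      finally show "norm (nth_deriv n \<rho> t) \<le> h\<^sup>2 * (B n * exp (- c * (\<tau> - 1))) * exp (- c * t)"
        by (simp only: nth mult_ac)
    qed
    then have "(\<Sum>n\<le>N. test_norm c n \<rho>) \<le> (\<Sum>n\<le>N. h\<^sup>2 * (B n * exp (- c * (\<tau> - 1))))"
      by (intro sum_mono)
    then have "norm (T \<rho>) \<le> C * (\<Sum>n\<le>N. h\<^sup>2 * (B n * exp (- c * (\<tau> - 1))))"
      using CN[OF \<rho>_rate] \<open>C \<ge> 0\<close> by (meson mult_left_mono order_trans)
    also have "\<dots> = K * h\<^sup>2"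
      by (simp add: K_def sum_distrib_left[symmetric])
    finally show "norm (T (\<lambda>t. \<phi> (\<tau> + h + t)) - T (\<lambda>t. \<phi> (\<tau> + t))
        - h *\<^sub>R T (\<lambda>t. nth_deriv 1 \<phi> (\<tau> + t))) \<le> K * h\<^sup>2"
      by (simp only: eq)
  qed
qed

lemma gf_shift:
  assumes T: "time_gf T" and c: "c > 0" and \<phi>: "time_test_rate c \<phi>"
  shows nth_deriv_gf_shift:
      "nth_deriv n (\<lambda>\<tau>. T (\<lambda>t. \<phi> (\<tau> + t))) = (\<lambda>\<tau>. T (\<lambda>t. nth_deriv n \<phi> (\<tau> + t)))"
    and smooth_gf_shift: "smooth (\<lambda>\<tau>. T (\<lambda>t. \<phi> (\<tau> + t)))"
proof -
  have *: "((\<lambda>\<tau>. T (\<lambda>t. nth_deriv n \<phi> (\<tau> + t))) has_vector_derivative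
        T (\<lambda>t. nth_deriv (Suc n) \<phi> (\<tau> + t))) (at \<tau>)" for n \<tau>
    using gf_shift_has_vector_derivative[OF T c time_test_rate_nth_deriv[OF \<phi>], of n \<tau>]
    by (simp add: nth_deriv_nth_deriv)
  note D = smooth_by_derivs[where F = "\<lambda>n \<tau>. T (\<lambda>t. nth_deriv n \<phi> (\<tau> + t))"
      and f = "\<lambda>\<tau>. T (\<lambda>t. \<phi> (\<tau> + t))", OF _ *]
  show "nth_deriv n (\<lambda>\<tau>. T (\<lambda>t. \<phi> (\<tau> + t))) = (\<lambda>\<tau>. T (\<lambda>t. nth_deriv n \<phi> (\<tau> + t)))"
    by (rule D) simp
  show "smooth (\<lambda>\<tau>. T (\<lambda>t. \<phi> (\<tau> + t)))"
    by (rule D) simp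
qed

text \<open>A continuous functional applied to shifts loses finitely many derivatives but no decay; the loss
  \<open>N\<close> is the same for every order \<open>n\<close>, which keeps the convolution of finite order.\<close>

lemma gf_shift_test_bound:
  assumes T: "time_gf T" and c: "c > 0"
  obtains C N where "C \<ge> 0"
    "\<And>\<phi>. time_test_rate c \<phi> \<Longrightarrow> time_test_rate c (\<lambda>\<tau>. T (\<lambda>t. \<phi> (\<tau> + t)))"
    "\<And>\<phi> n. time_test_rate c \<phi> \<Longrightarrow>
       test_norm c n (\<lambda>\<tau>. T (\<lambda>t. \<phi> (\<tau> + t))) \<le> C * (\<Sum>m\<le>N. test_norm c (n + m) \<phi>)"
proof -
  obtain C N where C: "C \<ge> 0" and CN:
    "\<And>\<phi>. time_test_rate c \<phi> \<Longrightarrow> norm (T \<phi>) \<le> C * (\<Sum>n\<le>N. test_norm c n \<phi>)"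
    using time_gf_bound[OF T c] by blast
  have bound: "norm (nth_deriv n (\<lambda>\<tau>. T (\<lambda>t. \<phi> (\<tau> + t))) \<tau>)
        \<le> (C * (\<Sum>m\<le>N. test_norm c (n + m) \<phi>)) * exp (- c * \<tau>)"
    if \<phi>: "time_test_rate c \<phi>" and \<tau>: "\<tau> \<ge> 0" for \<phi> n \<tau>
  proof -
    note \<phi>n = time_test_rate_nth_deriv[OF \<phi>, of n]
    have "norm (T (\<lambda>t. nth_deriv n \<phi> (\<tau> + t))) \<le> C * (\<Sum>m\<le>N. test_norm c m (\<lambda>t. nth_deriv n \<phi> (\<tau> + t)))"
      by (rule CN[OF time_test_rate_shift[OF \<phi>n]])
    also have "\<dots> \<le> C * (\<Sum>m\<le>N. test_norm c (n + m) \<phi> * exp (- c * \<tau>))"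
    proof (intro mult_left_mono sum_mono C)
      fix m
      show "test_norm c m (\<lambda>t. nth_deriv n \<phi> (\<tau> + t)) \<le> test_norm c (n + m) \<phi> * exp (- c * \<tau>)"
        using test_norm_shift[OF \<phi>n \<tau>, of m] by (simp only: test_norm_nth_deriv add.commute)
    qed
    finally show ?thesis
      by (simp only: nth_deriv_gf_shift[OF T c \<phi>] sum_distrib_right mult.assoc)
  qed
  show thesis
  proof (rule that[OF C])
    fix \<phi> assume \<phi>: "time_test_rate c \<phi>"
    show "time_test_rate c (\<lambda>\<tau>. T (\<lambda>t. \<phi> (\<tau> + t)))"
      unfolding time_test_rate_iff
      using smooth_gf_shift[OF T c \<phi>] bound[OF \<phi>] by (intro conjI allI) (blast+)
    show "test_norm c n (\<lambda>\<tau>. T (\<lambda>t. \<phi> (\<tau> + t))) \<le> C * (\<Sum>m\<le>N. test_norm c (n + m) \<phi>)" for n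
      using bound[OF \<phi>] by (rule test_norm_le)
  qed
qed

lemma time_test_gf_shift:
  assumes T: "time_gf T" and "time_test \<phi>"
  shows "time_test (\<lambda>\<tau>. T (\<lambda>t. \<phi> (\<tau> + t)))"
proof -
  obtain c where c: "c > 0" "time_test_rate c \<phi>" using assms(2) by (auto simp: time_test_def)
  have "time_test_rate c (\<lambda>\<tau>. T (\<lambda>t. \<phi> (\<tau> + t)))"
    by (rule gf_shift_test_bound[OF T c(1)]) (use c in blast)
  then show ?thesis unfolding time_test_def using c(1) by (intro exI[of _ c]) simp
qed

lemma time_gf_conv:
  assumes S: "time_gf S" and T: "time_gf T"
  shows "time_gf (gf_conv S T)"
proof (rule time_gfI)
  show "gf_conv S T (\<lambda>t. \<phi> t + \<phi>' t) = gf_conv S T \<phi> + gf_conv S T \<phi>'"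
    if "time_test \<phi>" "time_test \<phi>'" for \<phi> \<phi>'
    unfolding gf_conv_def
    by (simp only: time_gf_add[OF T] time_gf_add[OF S] time_test_shift time_test_gf_shift[OF T] that)
  show "gf_conv S T (\<lambda>t. a * \<phi> t) = a * gf_conv S T \<phi>" if "time_test \<phi>" for a \<phi>
    unfolding gf_conv_def
    by (simp only: time_gf_cmult[OF T] time_gf_cmult[OF S] time_test_shift time_test_gf_shift[OF T] that)
next
  fix c :: real assume c: "c > 0"
  obtain C N where C: "C \<ge> 0" and SC:
    "\<And>\<phi>. time_test_rate c \<phi> \<Longrightarrow> norm (S \<phi>) \<le> C * (\<Sum>n\<le>N. test_norm c n \<phi>)"
    by (rule time_gf_bound[OF S c]) blast
  obtain C' N' where C': "C' \<ge> 0"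
    and rate: "\<And>\<phi>. time_test_rate c \<phi> \<Longrightarrow> time_test_rate c (\<lambda>\<tau>. T (\<lambda>t. \<phi> (\<tau> + t)))"
    and TC: "\<And>\<phi> n. time_test_rate c \<phi> \<Longrightarrow>
       test_norm c n (\<lambda>\<tau>. T (\<lambda>t. \<phi> (\<tau> + t))) \<le> C' * (\<Sum>m\<le>N'. test_norm c (n + m) \<phi>)"
    by (rule gf_shift_test_bound[OF T c]) blast
  have "norm (gf_conv S T \<phi>) \<le> (C * (C' * (real N + 1))) * (\<Sum>k\<le>N + N'. test_norm c k \<phi>)"
    if \<phi>: "time_test_rate c \<phi>" for \<phi>
  proof -
    have "norm (gf_conv S T \<phi>) \<le> C * (\<Sum>n\<le>N. test_norm c n (\<lambda>\<tau>. T (\<lambda>t. \<phi> (\<tau> + t))))"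
      unfolding gf_conv_def by (rule SC[OF rate[OF \<phi>]])
    also have "\<dots> \<le> C * (\<Sum>n\<le>N. C' * (\<Sum>k\<le>N + N'. test_norm c k \<phi>))"
    proof (intro mult_left_mono sum_mono C)
      fix n assume n: "n \<in> {..N}"
      have "(\<Sum>m\<le>N'. test_norm c (n + m) \<phi>) = sum (\<lambda>k. test_norm c k \<phi>) ((+) n ` {..N'})"
        by (subst sum.reindex) auto
      also have "\<dots> \<le> (\<Sum>k\<le>N + N'. test_norm c k \<phi>)"
        using n by (intro sum_mono2) (auto simp: test_norm_nonneg[OF \<phi>])
      finally show "test_norm c n (\<lambda>\<tau>. T (\<lambda>t. \<phi> (\<tau> + t))) \<le> C' * (\<Sum>k\<le>N + N'. test_norm c k \<phi>)"
        using TC[OF \<phi>, of n] C' by (meson mult_left_mono order_trans)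
    qed
    finally show ?thesis by (simp add: algebra_simps)
  qed
  then show "\<exists>C N. \<forall>\<phi>. time_test_rate c \<phi> \<longrightarrow> norm (gf_conv S T \<phi>) \<le> C * (\<Sum>n\<le>N. test_norm c n \<phi>)"
    by blast
qed

lemma gf_laplace_conv:
  assumes "time_gf S" "time_gf T" "s > 0"
  shows "gf_laplace (gf_conv S T) s = gf_laplace S s * gf_laplace T s"
proof -
  have "T (\<lambda>t. complex_of_real (exp (- s * (\<tau> + t)))) = gf_laplace T s * of_real (exp (- s * \<tau>))" for \<tau>
  proof -
    have "T (\<lambda>t. complex_of_real (exp (- s * (\<tau> + t)))) =
        T (\<lambda>t. of_real (exp (- s * \<tau>)) * of_real (exp (- s * t)))"
      by (rule arg_cong[of _ _ T]) (simp add: fun_eq_iff exp_add[symmetric] algebra_simps flip: of_real_mult)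
    then show ?thesis
      using time_gf_cmult[OF assms(2) time_test_exp[OF assms(3)]] by (simp add: gf_laplace_def)
  qed
  then show ?thesis
    using time_gf_cmult[OF assms(1) time_test_exp[OF assms(3)], of "gf_laplace T s"]
    by (simp add: gf_conv_def gf_laplace_def)
qed

section \<open>A generalized function is determined by its Laplace transform\<close>

text \<open>In the variable \<open>x = exp (- t)\<close> a continuous function that vanishes at infinity becomes a
  continuous function on \<open>{0..1}\<close>, and polynomials become sums of exponentials.\<close>

lemma exp_sum_approx_real:
  fixes f :: "real \<Rightarrow> real"
  assumes cont: "continuous_on {0..} f" and lim: "(f \<longlongrightarrow> 0) at_top" and "e > 0"
  shows "\<exists>a m. \<forall>t\<ge>0. \<bar>f t - (\<Sum>k\<le>m::nat. a k * exp (- real k * t))\<bar> < e"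
proof -
  define F where "F = (\<lambda>x. if x = 0 then 0 else f (- ln x))"
  have "continuous_on {0..1} F"
  proof (rule continuous_on_eq_continuous_within[THEN iffD2], rule ballI)
    fix x :: real assume x: "x \<in> {0..1}"
    show "continuous (at x within {0..1}) F"
    proof (cases "x = 0")
      case True
      have "filterlim (\<lambda>x::real. - ln x) at_top (at 0 within {0..1})"
        using ln_at_0 by (simp add: filterlim_uminus_at_top)
          (rule filterlim_mono, auto simp: at_within_def intro!: inf_mono)
      then have "((\<lambda>x. f (- ln x)) \<longlongrightarrow> 0) (at 0 within {0..1})"
        using filterlim_compose[OF lim] by blast
      moreover have "\<forall>\<^sub>F x in at 0 within {0..1}. f (- ln x) = F x"
        unfolding eventually_at_filter F_def by simp
      ultimately have "(F \<longlongrightarrow> 0) (at 0 within {0..1})"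
        using Lim_transform_eventually by blast
      then show ?thesis using True by (simp add: continuous_within F_def)
    next
      case False
      then have x0: "x > 0" using x by auto
      have "continuous_on {0<..1} (\<lambda>x. f (- ln x))"
        by (rule continuous_on_compose2[OF cont]) (auto intro!: continuous_intros)
      then have "continuous_on {0<..1} F"
        by (rule continuous_on_eq) (auto simp: F_def)
      then have "continuous (at x within {0<..1}) F"
        using x x0 by (simp add: continuous_on_eq_continuous_within)
      moreover have "at x within {0<..1} = at x within {0..1}"
        using x0 by (intro at_within_nhd[of _ "{0<..}"]) auto
      ultimately show ?thesis by simp
    qed
  qed
  then obtain g where g: "real_polynomial_function g" "\<And>x. x \<in> {0..1} \<Longrightarrow> \<bar>F x - g x\<bar> < e"
    using Stone_Weierstrass_real_polynomial_function[OF compact_Icc _ \<open>e > 0\<close>] by blast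
  then obtain a m where am: "g = (\<lambda>x. \<Sum>i\<le>m. a i * x ^ i)"
    by (auto simp: real_polynomial_function_iff_sum)
  have "\<bar>f t - (\<Sum>k\<le>m::nat. a k * exp (- real k * t))\<bar> < e" if "t \<ge> 0" for t
    using g(2)[of "exp (- t)"] that by (simp add: F_def am exp_of_nat_mult[symmetric])
  then show ?thesis by blast
qed

lemma exp_sum_approx:
  fixes f :: "real \<Rightarrow> complex"
  assumes cont: "continuous_on {0..} f" and lim: "(f \<longlongrightarrow> 0) at_top" and "e > 0"
  shows "\<exists>a m. \<forall>t\<ge>0. norm (f t - (\<Sum>k\<le>m::nat. a k * of_real (exp (- real k * t)))) < e"
proof -
  have e2: "e / 2 > 0" using \<open>e > 0\<close> by simp
  have R: "continuous_on {0..} (\<lambda>t. Re (f t))" "((\<lambda>t. Re (f t)) \<longlongrightarrow> 0) at_top"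
    and I: "continuous_on {0..} (\<lambda>t. Im (f t))" "((\<lambda>t. Im (f t)) \<longlongrightarrow> 0) at_top"
    using tendsto_Re[OF lim] tendsto_Im[OF lim] by (auto intro!: continuous_intros cont)
  obtain a m where am: "\<And>t. t \<ge> 0 \<Longrightarrow> \<bar>Re (f t) - (\<Sum>k\<le>m::nat. a k * exp (- real k * t))\<bar> < e / 2"
    using exp_sum_approx_real[OF R e2] by blast
  obtain b n where bn: "\<And>t. t \<ge> 0 \<Longrightarrow> \<bar>Im (f t) - (\<Sum>k\<le>n::nat. b k * exp (- real k * t))\<bar> < e / 2"
    using exp_sum_approx_real[OF I e2] by blast
  define c where "c k = Complex (if k \<le> m then a k else 0) (if k \<le> n then b k else 0)" for k
  have "norm (f t - (\<Sum>k\<le>max m n. c k * of_real (exp (- real k * t)))) < e" if t: "t \<ge> 0" for t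
  proof -
    let ?z = "f t - (\<Sum>k\<le>max m n. c k * of_real (exp (- real k * t)))"
    have "(\<Sum>k\<le>max m n. (if k \<le> m then a k else 0) * exp (- real k * t)) =
        (\<Sum>k\<le>m. a k * exp (- real k * t))"
      by (intro sum.mono_neutral_cong_right) auto
    then have "\<bar>Re ?z\<bar> < e / 2" using am[OF t] by (simp add: c_def)
    moreover have "(\<Sum>k\<le>max m n. (if k \<le> n then b k else 0) * exp (- real k * t)) =
        (\<Sum>k\<le>n. b k * exp (- real k * t))"
      by (intro sum.mono_neutral_cong_right) auto
    then have "\<bar>Im ?z\<bar> < e / 2" using bn[OF t] by (simp add: c_def)
    ultimately show ?thesis using cmod_le[of ?z] by linarith
  qed
  then show ?thesis by blast
qed

lemma test_deriv_tendsto_0: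
  assumes "time_test_rate c \<phi>" "c > 0"
  shows "(nth_deriv n \<phi> \<longlongrightarrow> 0) at_top"
proof (rule Lim_null_comparison)
  show "\<forall>\<^sub>F t in at_top. norm (nth_deriv n \<phi> t) \<le> test_norm c n \<phi> * exp (- c * t)"
    using eventually_ge_at_top[of 0] by eventually_elim (rule test_norm_bound[OF assms(1)])
  have "((\<lambda>t. exp (- c * t)) \<longlongrightarrow> 0) at_top"
    using assms(2)
    by (intro filterlim_compose[OF exp_at_bot] filterlim_tendsto_neg_mult_at_bot[OF tendsto_const])
       (auto simp: filterlim_ident)
  then show "((\<lambda>t. test_norm c n \<phi> * exp (- c * t)) \<longlongrightarrow> 0) at_top"
    by (rule tendsto_mult_right_zero)
qed

text \<open>Integration from \<open>t\<close> to infinity, where all derivatives vanish: exponential bounds descend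
  to lower derivatives.\<close>

lemma deriv_bound_from_next:
  assumes \<phi>: "time_test_rate c \<phi>" and c: "c > 0"
    and next_bound: "\<And>t. t \<ge> 0 \<Longrightarrow> norm (nth_deriv (Suc n) \<phi> t) \<le> e * exp (- c * t)"
    and t: "t \<ge> 0"
  shows "norm (nth_deriv n \<phi> t) \<le> e / c * exp (- c * t)"
proof (rule tendsto_upperbound)
  have e: "e \<ge> 0" using next_bound[of 0] by (simp add: order_trans[OF norm_ge_zero])
  show "((\<lambda>T. norm (nth_deriv n \<phi> T - nth_deriv n \<phi> t)) \<longlongrightarrow> norm (nth_deriv n \<phi> t)) at_top"
    using tendsto_norm[OF tendsto_diff[OF test_deriv_tendsto_0[OF \<phi> c, of n] tendsto_const[of "nth_deriv n \<phi> t"]]]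
    by simp
  show "\<forall>\<^sub>F T in at_top. norm (nth_deriv n \<phi> T - nth_deriv n \<phi> t) \<le> e / c * exp (- c * t)"
    using eventually_gt_at_top[of t]
  proof eventually_elim
    case (elim T)
    have "norm (nth_deriv n \<phi> T - nth_deriv n \<phi> t) \<le> (- (e / c) * exp (- c * T)) - (- (e / c) * exp (- c * t))"
    proof (rule differentiable_bound_general[OF elim])
      show "continuous_on {t..T} (nth_deriv n \<phi>)"
        by (rule smooth_continuous_on[OF time_test_rate_smooth[OF \<phi>]])
      show "(nth_deriv n \<phi> has_vector_derivative nth_deriv (Suc n) \<phi> x) (at x)" for x
        by (rule smooth_has_vector_derivative[OF time_test_rate_smooth[OF \<phi>]])
      show "((\<lambda>T. - (e / c) * exp (- c * T)) has_vector_derivative e * exp (- c * x)) (at x)" for x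
        using c by (auto intro!: derivative_eq_intros simp: has_real_derivative_iff_has_vector_derivative[symmetric])
      show "norm (nth_deriv (Suc n) \<phi> x) \<le> e * exp (- c * x)" if "t < x" "x < T" for x
        using next_bound that t by simp
    qed (intro continuous_intros)
    also have "\<dots> \<le> e / c * exp (- c * t)" using e c by simp
    finally show ?case .
  qed
qed simp

lemma
  assumes T: "time_gf T" and f: "\<And>k. k \<le> m \<Longrightarrow> time_test (f k)"
  shows time_gf_sum: "T (\<lambda>t. \<Sum>k\<le>m::nat. f k t) = (\<Sum>k\<le>m. T (f k))"
    and time_test_sum: "time_test (\<lambda>t. \<Sum>k\<le>m. f k t)"
  using f
proof (induction m)
  case 0
  { case 1 then show ?case by simp }
  { case 2 then show ?case by simp }
next
  case (Suc m)
  { case 1 then show ?case using Suc.IH by (simp add: time_gf_add[OF T]) }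
  { case 2 then show ?case using Suc.IH by (simp add: time_test_add) }
qed

lemma time_test_rate_sum:
  assumes "\<And>k. k \<le> m \<Longrightarrow> time_test_rate c (f k)"
  shows "time_test_rate c (\<lambda>t. \<Sum>k\<le>m::nat. f k t)"
  using assms by (induction m) (auto intro!: time_test_rate_add)

lemma nth_deriv_exp_sum:
  "nth_deriv n (\<lambda>t. \<Sum>k\<le>m::nat. b k * of_real (exp (- l k * t))) =
    (\<lambda>t. \<Sum>k\<le>m. b k * of_real ((- l k) ^ n * exp (- l k * t)))"
proof -
  have "((\<lambda>t. \<Sum>k\<le>m. b k * complex_of_real ((- l k) ^ n * exp (- l k * t))) has_vector_derivative
        (\<Sum>k\<le>m. b k * complex_of_real ((- l k) ^ Suc n * exp (- l k * t)))) (at t)" for n t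
    using smooth_has_vector_derivative[OF smooth_exp]
    by (intro has_vector_derivative_sum has_vector_derivative_mult_right) (simp only: nth_deriv_exp)
  from nth_deriv_by_derivs[where F = "\<lambda>n t. \<Sum>k\<le>m. b k * complex_of_real ((- l k) ^ n * exp (- l k * t))", OF _ this]
  show ?thesis by simp
qed

text \<open>Only the highest derivative is approximated, uniformly and with weight \<open>exp (c' * t)\<close>; the sum of
  exponentials is then integrated \<open>N\<close> times from infinity, which divides its coefficients by
  powers of the exponents, and \<open>deriv_bound_from_next\<close> carries the error bound down to the function
  itself.  A rate \<open>c'\<close> below \<open>c\<close> is needed so that the weighted derivative vanishes at infinity.
  The negative of the approximating sum is what appears in the statement.\<close>

lemma exponentials_dense:
  assumes \<phi>: "time_test_rate c \<phi>" and c': "0 < c'" "c' < c" and e: "e > 0"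
  obtains b :: "nat \<Rightarrow> complex" and m where
    "\<And>n. n \<le> N \<Longrightarrow> test_norm c' n (\<lambda>t. \<phi> t + (\<Sum>k\<le>m. b k * of_real (exp (- (c' + real k) * t)))) \<le> e"
proof -
  \<comment> \<open>Each of the at most \<open>N\<close> integrations divides the error by \<open>c'\<close>.\<close>
  define \<epsilon> where "\<epsilon> = e * min 1 c' ^ N"
  have "\<epsilon> > 0" using e c' by (simp add: \<epsilon>_def)
  have cont: "continuous_on {0..} (\<lambda>t. exp (c' * t) *\<^sub>R nth_deriv N \<phi> t)"
    by (intro continuous_intros smooth_continuous_on time_test_rate_smooth[OF \<phi>])
  have lim: "((\<lambda>t. exp (c' * t) *\<^sub>R nth_deriv N \<phi> t) \<longlongrightarrow> 0) at_top"
  proof (rule Lim_null_comparison)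
    show "\<forall>\<^sub>F t in at_top. norm (exp (c' * t) *\<^sub>R nth_deriv N \<phi> t) \<le> test_norm c N \<phi> * exp (- (c - c') * t)"
      using eventually_ge_at_top[of 0]
    proof eventually_elim
      case (elim t)
      have "exp (c' * t) * norm (nth_deriv N \<phi> t) \<le> exp (c' * t) * (test_norm c N \<phi> * exp (- c * t))"
        by (intro mult_left_mono test_norm_bound[OF \<phi> elim]) simp
      also have "\<dots> = test_norm c N \<phi> * (exp (c' * t) * exp (- c * t))" by simp
      also have "exp (c' * t) * exp (- c * t) = exp (- (c - c') * t)"
        by (simp add: exp_add[symmetric] algebra_simps)
      finally show ?case by simp
    qed
    have "((\<lambda>t. exp (- (c - c') * t)) \<longlongrightarrow> 0) at_top"
      using c'
      by (intro filterlim_compose[OF exp_at_bot] filterlim_tendsto_neg_mult_at_bot[OF tendsto_const])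
         (auto simp: filterlim_ident)
    then show "((\<lambda>t. test_norm c N \<phi> * exp (- (c - c') * t)) \<longlongrightarrow> 0) at_top"
      by (rule tendsto_mult_right_zero)
  qed
  obtain a m where am: "\<And>t. t \<ge> 0 \<Longrightarrow>
      norm (exp (c' * t) *\<^sub>R nth_deriv N \<phi> t - (\<Sum>k\<le>m::nat. a k * of_real (exp (- real k * t)))) < \<epsilon>"
    using exp_sum_approx[OF cont lim \<open>\<epsilon> > 0\<close>] by blast
  define b where "b k = - a k / of_real ((- (c' + real k)) ^ N)" for k
  define P where "P = (\<lambda>t. \<Sum>k\<le>m. b k * complex_of_real (exp (- (c' + real k) * t)))"
  define R where "R = (\<lambda>t. \<phi> t + P t)"
  have P: "time_test_rate c' P"
    unfolding P_def using c' by (intro time_test_rate_sum time_test_rate_cmult time_test_rate_exp) auto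
  have R: "time_test_rate c' R"
    unfolding R_def using c' by (intro time_test_rate_add time_test_rate_mono[OF \<phi>] P) auto
  have top: "norm (nth_deriv N R t) \<le> \<epsilon> * exp (- c' * t)" if t: "t \<ge> 0" for t
  proof -
    have "nth_deriv N P t = (\<Sum>k\<le>m. b k * of_real ((- (c' + real k)) ^ N * exp (- (c' + real k) * t)))"
      unfolding P_def nth_deriv_exp_sum ..
    also have "\<dots> = (\<Sum>k\<le>m. - (a k * of_real (exp (- (c' + real k) * t))))"
    proof (rule sum.cong[OF refl])
      fix k
      have "- (c' + real k) \<noteq> 0" using c' by linarith
      then have "complex_of_real ((- (c' + real k)) ^ N) \<noteq> 0"
        by (simp only: of_real_eq_0_iff power_eq_0_iff) simp
      then have "- a k / z * (z * E) = - (a k * E)"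
        if "z \<noteq> 0" for z E using that by simp
      from this[OF \<open>complex_of_real ((- (c' + real k)) ^ N) \<noteq> 0\<close>] show "b k * of_real ((- (c' + real k)) ^ N * exp (- (c' + real k) * t)) =
            - (a k * of_real (exp (- (c' + real k) * t)))"
        unfolding b_def of_real_mult .
    qed
    finally have PN: "nth_deriv N P t = - (\<Sum>k\<le>m. a k * of_real (exp (- (c' + real k) * t)))"
      by (simp add: sum_negf)
    have "exp (c' * t) *\<^sub>R nth_deriv N R t =
        exp (c' * t) *\<^sub>R nth_deriv N \<phi> t - (\<Sum>k\<le>m. exp (c' * t) *\<^sub>R (a k * of_real (exp (- (c' + real k) * t))))"
      unfolding R_def
      by (simp add: nth_deriv_add time_test_rate_smooth[OF \<phi>] time_test_rate_smooth[OF P] PN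
          scaleR_diff_right scaleR_sum_right scaleR_add_right)
    also have "(\<Sum>k\<le>m. exp (c' * t) *\<^sub>R (a k * complex_of_real (exp (- (c' + real k) * t)))) =
        (\<Sum>k\<le>m. a k * of_real (exp (- real k * t)))"
    proof (rule sum.cong[OF refl])
      fix k
      have "exp (c' * t) * exp (- (c' + real k) * t) = exp (- real k * t)"
        by (simp add: exp_add[symmetric] algebra_simps)
      then show "exp (c' * t) *\<^sub>R (a k * complex_of_real (exp (- (c' + real k) * t))) =
          a k * of_real (exp (- real k * t))"
        by (metis mult.left_commute of_real_mult scaleR_conv_of_real)
    qed
    finally have "norm (exp (c' * t) *\<^sub>R nth_deriv N R t) \<le> \<epsilon>" using am[OF t] by simp
    then show ?thesis by (simp only: norm_exp_scale_le)
  qed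
  have down: "\<forall>t\<ge>0. norm (nth_deriv (N - j) R t) \<le> \<epsilon> / c' ^ j * exp (- c' * t)" if "j \<le> N" for j
    using that
  proof (induction j)
    case 0 then show ?case using top by simp
  next
    case (Suc j)
    then have "\<And>t. t \<ge> 0 \<Longrightarrow> norm (nth_deriv (Suc (N - Suc j)) R t) \<le> \<epsilon> / c' ^ j * exp (- c' * t)"
      by (simp add: Suc_diff_Suc)
    from deriv_bound_from_next[OF R c'(1) this]
    show ?case by (simp add: mult.commute)
  qed
  show thesis
  proof (rule that)
    fix n assume n: "n \<le> N"
    have "min 1 c' ^ N \<le> min 1 c' ^ (N - n)"
      using c' by (intro power_decreasing) auto
    also have "\<dots> \<le> c' ^ (N - n)"
      using c' by (intro power_mono) auto
    finally have "\<epsilon> / c' ^ (N - n) \<le> e"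
      using e c' by (simp add: \<epsilon>_def divide_le_eq)
    moreover have "test_norm c' n R \<le> \<epsilon> / c' ^ (N - n)"
      using down[of "N - n"] n by (intro test_norm_le) auto
    ultimately show "test_norm c' n (\<lambda>t. \<phi> t + (\<Sum>k\<le>m. b k * of_real (exp (- (c' + real k) * t)))) \<le> e"
      unfolding R_def P_def by linarith
  qed
qed

lemma gf_laplace_zero_imp_zero:
  assumes T: "time_gf T" and zero: "\<And>s. s > 0 \<Longrightarrow> gf_laplace T s = 0" and "time_test \<phi>"
  shows "T \<phi> = 0"
proof -
  obtain c where c: "c > 0" and \<phi>: "time_test_rate c \<phi>"
    using assms(3) by (auto simp: time_test_def)
  \<comment> \<open>Any rate strictly between \<open>0\<close> and \<open>c\<close> would do.\<close>
  define c' where "c' = c / 2"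
  have c': "0 < c'" "c' < c" using c by (auto simp: c'_def)
  obtain C N where C: "C \<ge> 0" and CN:
    "\<And>\<phi>. time_test_rate c' \<phi> \<Longrightarrow> norm (T \<phi>) \<le> C * (\<Sum>n\<le>N. test_norm c' n \<phi>)"
    by (rule time_gf_bound[OF T c'(1)]) blast
  have small: "norm (T \<phi>) \<le> C * (real N + 1) * e" if e: "e > 0" for e
  proof -
    obtain b m where b: "\<And>n. n \<le> N \<Longrightarrow>
        test_norm c' n (\<lambda>t. \<phi> t + (\<Sum>k\<le>m. b k * of_real (exp (- (c' + real k) * t)))) \<le> e"
      using exponentials_dense[OF \<phi> c' e, of N] by blast
    define P where "P = (\<lambda>t. \<Sum>k\<le>m. b k * complex_of_real (exp (- (c' + real k) * t)))"
    have exps: "time_test (\<lambda>t. b k * complex_of_real (exp (- (c' + real k) * t)))" for k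
      using c' by (intro time_test_cmult time_test_exp) auto
    have P: "time_test_rate c' P"
      unfolding P_def using c' by (intro time_test_rate_sum time_test_rate_cmult time_test_rate_exp) auto
    then have P_test: "time_test P" using c'(1) unfolding time_test_def by blast
    have R: "time_test_rate c' (\<lambda>t. \<phi> t + P t)"
      using c' by (intro time_test_rate_add time_test_rate_mono[OF \<phi>] P) auto
    have "T (\<lambda>t. b k * complex_of_real (exp (- (c' + real k) * t))) = 0" for k
      using zero[of "c' + real k"] c' time_gf_cmult[OF T time_test_exp[of "c' + real k"], of "b k"]
      by (simp add: gf_laplace_def)
    then have "T P = 0"
      unfolding P_def using time_gf_sum[OF T exps] by simp
    then have "T \<phi> = T (\<lambda>t. \<phi> t + P t)"
      using time_gf_add[OF T assms(3) P_test] by simp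
    then have "norm (T \<phi>) \<le> C * (\<Sum>n\<le>N. test_norm c' n (\<lambda>t. \<phi> t + P t))"
      using CN[OF R] by simp
    also have "\<dots> \<le> C * (\<Sum>n\<le>N. e)"
      using b by (intro mult_left_mono sum_mono C) (auto simp: P_def)
    finally show ?thesis by (simp add: algebra_simps)
  qed
  have "norm (T \<phi>) \<le> 0"
  proof (rule field_le_epsilon)
    fix e :: real assume "e > 0"
    then have "norm (T \<phi>) \<le> C * (real N + 1) * (e / (C * (real N + 1) + 1))"
      using C by (intro small divide_pos_pos add_nonneg_pos mult_nonneg_nonneg) auto
    also have "\<dots> \<le> e"
    proof -
      have "C * (real N + 1) \<ge> 0" using C by simp
      then show ?thesis using \<open>e > 0\<close> by (simp add: field_simps)
    qed
    finally show "norm (T \<phi>) \<le> 0 + e" by simp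
  qed
  then show ?thesis by simp
qed

lemma time_gf_diff:
  assumes S: "time_gf S" and T: "time_gf T"
  shows "time_gf (\<lambda>\<phi>. S \<phi> - T \<phi>)"
proof (rule time_gfI)
  fix c :: real assume c: "c > 0"
  obtain C N where C: "C \<ge> 0" and CN:
    "\<And>\<phi>. time_test_rate c \<phi> \<Longrightarrow> norm (S \<phi>) \<le> C * (\<Sum>n\<le>N. test_norm c n \<phi>)"
    by (rule time_gf_bound[OF S c]) blast
  obtain C' N' where C': "C' \<ge> 0" and CN':
    "\<And>\<phi>. time_test_rate c \<phi> \<Longrightarrow> norm (T \<phi>) \<le> C' * (\<Sum>n\<le>N'. test_norm c n \<phi>)"
    by (rule time_gf_bound[OF T c]) blast
  have "norm (S \<phi> - T \<phi>) \<le> (C + C') * (\<Sum>n\<le>max N N'. test_norm c n \<phi>)"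
    if \<phi>: "time_test_rate c \<phi>" for \<phi>
  proof -
    have "(\<Sum>n\<le>M. test_norm c n \<phi>) \<le> (\<Sum>n\<le>max N N'. test_norm c n \<phi>)" if "M \<le> max N N'" for M
      using that by (intro sum_mono2) (auto simp: test_norm_nonneg[OF \<phi>])
    then have "norm (S \<phi>) \<le> C * (\<Sum>n\<le>max N N'. test_norm c n \<phi>)"
        "norm (T \<phi>) \<le> C' * (\<Sum>n\<le>max N N'. test_norm c n \<phi>)"
      using CN[OF \<phi>] CN'[OF \<phi>] C C' by (meson max.cobounded1 max.cobounded2 mult_left_mono order_trans)+
    then show ?thesis
      using norm_triangle_ineq4[of "S \<phi>" "T \<phi>"] by (simp add: distrib_right)
  qed
  then show "\<exists>C N. \<forall>\<phi>. time_test_rate c \<phi> \<longrightarrow> norm (S \<phi> - T \<phi>) \<le> C * (\<Sum>n\<le>N. test_norm c n \<phi>)"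
    by blast
qed (simp_all only: time_gf_add[OF S] time_gf_add[OF T] time_gf_cmult[OF S] time_gf_cmult[OF T]
      right_diff_distrib add_diff_add)

text \<open>Uniqueness for Laplace transforms of generalized functions, by density of the exponentials.\<close>

theorem time_gf_eq_iff_laplace:
  assumes S: "time_gf S" and T: "time_gf T"
  shows "(\<forall>\<phi>. time_test \<phi> \<longrightarrow> S \<phi> = T \<phi>) \<longleftrightarrow> (\<forall>s>0. gf_laplace S s = gf_laplace T s)"
proof
  assume "\<forall>\<phi>. time_test \<phi> \<longrightarrow> S \<phi> = T \<phi>"
  then show "\<forall>s>0. gf_laplace S s = gf_laplace T s"
    using time_test_exp by (simp add: gf_laplace_def)
next
  assume "\<forall>s>0. gf_laplace S s = gf_laplace T s"
  then show "\<forall>\<phi>. time_test \<phi> \<longrightarrow> S \<phi> = T \<phi>"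
    using gf_laplace_zero_imp_zero[OF time_gf_diff[OF S T]] by (simp add: gf_laplace_def)
qed

section \<open>Laplace transforms of positive waiting times\<close>

lemma (in prob_space) integral_pos_of_AE_pos:
  fixes f :: "'a \<Rightarrow> real"
  assumes "integrable M f" "AE x in M. 0 < f x"
  shows "0 < (LINT x|M. f x)"
proof -
  have nonneg: "AE x in M. 0 \<le> f x" using assms(2) by eventually_elim simp
  have "(LINT x|M. f x) \<noteq> 0"
  proof
    assume "(LINT x|M. f x) = 0"
    then have "AE x in M. f x = 0"
      using integral_nonneg_eq_0_iff_AE[OF assms(1) nonneg] by simp
    with assms(2) have "AE x in M. False" by eventually_elim simp
    then show False using AE_False by simp
  qed
  with integral_nonneg_AE[OF nonneg] show ?thesis by simp
qed

context
  fixes \<Phi> :: "real measure"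
  assumes \<Phi>: "real_distribution \<Phi>" and pos: "AE t in \<Phi>. 0 < t"
begin

interpretation real_distribution \<Phi> by (rule \<Phi>)

lemma waiting_integrand_integrable:
  assumes "s \<ge> 0" shows "integrable \<Phi> (\<lambda>t. indicator {0..} t * exp (- s * t))"
proof (rule integrable_const_bound[where B = 1])
  show "AE t in \<Phi>. norm (indicator {0..} t * exp (- s * t)) \<le> 1"
    using assms by (auto simp: indicator_def)
qed simp

lemma waiting_laplace_bounds:
  assumes "s > 0" shows "0 < waiting_laplace \<Phi> s" "waiting_laplace \<Phi> s < 1"
proof -
  note int = waiting_integrand_integrable[of s]
  have eq: "waiting_laplace \<Phi> s = (LINT t|\<Phi>. indicator {0..} t * exp (- s * t))"
    by (simp add: waiting_laplace_def set_lebesgue_integral_def)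
  show "0 < waiting_laplace \<Phi> s"
    unfolding eq
  proof (intro integral_pos_of_AE_pos int)
    show "AE t in \<Phi>. 0 < indicator {0..} t * exp (- s * t)"
      using pos by eventually_elim simp
  qed (use assms in simp)
  have "0 < (LINT t|\<Phi>. 1 - indicator {0..} t * exp (- s * t))"
  proof (intro integral_pos_of_AE_pos Bochner_Integration.integrable_diff int)
    show "AE t in \<Phi>. 0 < 1 - indicator {0..} t * exp (- s * t)"
      using pos by eventually_elim (use assms in simp)
  qed (use assms in simp_all)
  also have "\<dots> = 1 - waiting_laplace \<Phi> s"
    unfolding eq using int assms prob_space by (subst Bochner_Integration.integral_diff) auto
  finally show "waiting_laplace \<Phi> s < 1" by simp
qed

lemma memory_laplace_pos: "s > 0 \<Longrightarrow> memory_laplace \<Phi> s > 0"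
  using waiting_laplace_bounds by (simp add: memory_laplace_def)

lemma waiting_laplace_tendsto_0: "(waiting_laplace \<Phi> \<longlongrightarrow> 0) at_top"
proof -
  have "((\<lambda>s. LINT t|\<Phi>. indicator {0..} t * exp (- s * t)) \<longlongrightarrow> (LINT t|\<Phi>. 0)) at_top"
  proof (rule integral_dominated_convergence_at_top[where w = "\<lambda>_. 1"])
    show "\<forall>\<^sub>F s in at_top. AE t in \<Phi>. norm (indicator {0..} t * exp (- s * t)) \<le> 1"
      using eventually_ge_at_top[of 0] by eventually_elim (auto simp: indicator_def)
    show "AE t in \<Phi>. ((\<lambda>s. indicator {0..} t * exp (- s * t)) \<longlongrightarrow> 0) at_top"
      using pos
    proof eventually_elim
      case (elim t)
      have "((\<lambda>s. exp (- s * t)) \<longlongrightarrow> 0) at_top"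
        using elim
        filterlim_compose[OF exp_at_bot, of "\<lambda>s. - s * t" at_top]
          filterlim_tendsto_pos_mult_at_top[OF tendsto_const[of t] _ filterlim_ident]
        by (simp add: filterlim_uminus_at_bot mult.commute)
      then show ?case by (rule tendsto_mult_right_zero)
    qed
  qed simp_all
  then show ?thesis by (simp add: waiting_laplace_def[abs_def] set_lebesgue_integral_def)
qed

text \<open>\<open>s * H s = 1 / \<phi> s - 1\<close>, and the transform \<open>\<phi>\<close> of a law without atom at \<open>0\<close> vanishes at infinity.
  This is what makes solutions of the limit equation start at the unit mass.\<close>

lemma memory_laplace_at_top: "filterlim (\<lambda>s. s * memory_laplace \<Phi> s) at_top at_top"
proof -
  have pos: "\<forall>\<^sub>F s in at_top. 0 < waiting_laplace \<Phi> s"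
    using eventually_gt_at_top[of 0] by eventually_elim (rule waiting_laplace_bounds)
  have "filterlim (\<lambda>s. -1 + inverse (waiting_laplace \<Phi> s)) at_top at_top"
    by (rule filterlim_tendsto_add_at_top[OF tendsto_const
          filterlim_inverse_at_top[OF waiting_laplace_tendsto_0 pos]])
  moreover have "\<forall>\<^sub>F s in at_top. -1 + inverse (waiting_laplace \<Phi> s) = s * memory_laplace \<Phi> s"
    using eventually_gt_at_top[of 0]
  proof eventually_elim
    case (elim s)
    then show ?case using waiting_laplace_bounds(1)[OF elim]
      by (simp add: memory_laplace_def field_simps)
  qed
  ultimately show ?thesis by (rule iffD1[OF filterlim_cong[OF refl refl], rotated])
qed

end

section \<open>Symmetric jump laws\<close>

text \<open>The hypothesis concerns continuity points only.  Off the countable set of atoms and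
  their reflections it says that the law and its reflection have the same distribution function, and
  right continuity extends this to all points.\<close>

lemma symmetric_law_distr_uminus:
  assumes W: "real_distribution W" and sym: "symmetric_law W"
  shows "distr W borel uminus = W"
proof -
  interpret real_distribution W by (rule W)
  define W' where "W' = distr W borel (uminus :: real \<Rightarrow> real)"
  have W': "real_distribution W'"
    unfolding W'_def by (rule real_distribution_distr) simp
  interpret W': real_distribution W' by (rule W')
  define D where "D = {x. measure W {x} > 0} \<union> uminus ` {x. measure W {x} > 0}"
  have D: "countable D" unfolding D_def using countable_atoms by simp
  have agree: "cdf W' x = cdf W x" if x: "x \<notin> D" for x
  proof -
    have "\<not> measure W {x} > 0" "\<not> measure W {- x} > 0"
      using x image_eqI[of x uminus "- x" "{x. measure W {x} > 0}"] by (auto simp: D_def)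
    then have "measure W {x} = 0" "measure W {- x} = 0"
      by (simp_all add: zero_less_measure_iff)
    then have "cdf W (- x) + cdf W x = 1"
      using sym by (simp add: symmetric_law_def isCont_cdf)
    moreover have "cdf W' x = measure W {- x..}"
    proof -
      have "uminus -` {..x} = {- x..}" by auto
      then show ?thesis by (simp add: cdf_def2 cdf_def W'_def measure_distr)
    qed
    moreover have "measure W {- x..} = 1 - measure W {..< - x}"
    proof -
      have "{- x..} = space W - {..< - x}" by auto
      then show ?thesis using prob_compl[of "{..< - x}"] by simp
    qed
    moreover have "cdf W (- x) = measure W {..< - x} + measure W {- x}"
    proof -
      have "{..- x} = {..< - x} \<union> {- x}" by auto
      then show ?thesis by (simp only: cdf_def2) (rule finite_measure_Union, auto)
    qed
    ultimately show ?thesis using \<open>measure W {- x} = 0\<close> by simp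
  qed
  \<comment> \<open>Every right neighbourhood of \<open>x\<close> contains points outside the countable set \<open>D\<close>.\<close>
  have "cdf W' x = cdf W x" for x
  proof -
    have "\<forall>n. \<exists>y. y > x \<and> y < x + 1 / real (Suc n) \<and> y \<notin> D"
    proof
      fix n
      have "\<exists>y\<in>{x<..<x + 1 / real (Suc n)}. y \<notin> D"
        by (intro open_minus_countable[OF D]) auto
      then show "\<exists>y. y > x \<and> y < x + 1 / real (Suc n) \<and> y \<notin> D" by auto
    qed
    from choice[OF this]
    obtain y where y: "\<And>n. y n > x" "\<And>n. y n < x + 1 / real (Suc n)" "\<And>n. y n \<notin> D"
      by auto
    have lim: "filterlim y (at_right x) sequentially"
      unfolding filterlim_at
    proof
      show "y \<longlonglongrightarrow> x"
      proof (rule tendsto_sandwich[where f = "\<lambda>_. x" and h = "\<lambda>n. x + 1 / real (Suc n)"])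
        show "\<forall>\<^sub>F n in sequentially. x \<le> y n"
          by (intro always_eventually allI less_imp_le y(1))
        show "\<forall>\<^sub>F n in sequentially. y n \<le> x + 1 / real (Suc n)"
          by (intro always_eventually allI less_imp_le y(2))
        show "(\<lambda>n. x + 1 / real (Suc n)) \<longlonglongrightarrow> x"
          using tendsto_add[OF tendsto_const LIMSEQ_inverse_real_of_nat, of x] by (simp add: inverse_eq_divide)
      qed simp
    qed (use y(1) in \<open>auto intro!: always_eventually simp: less_imp_neq[symmetric] less_le\<close>)
    have "(\<lambda>n. cdf W' (y n)) \<longlonglongrightarrow> cdf W' x" "(\<lambda>n. cdf W (y n)) \<longlonglongrightarrow> cdf W x"
      using W'.cdf_is_right_cont[of x] cdf_is_right_cont[of x] lim
      by (auto simp: continuous_within intro: filterlim_compose)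
    then show ?thesis using agree[OF y(3)] LIMSEQ_unique by simp
  qed
  then have "cdf W' = cdf W" by auto
  then show ?thesis using cdf_unique[OF W' W] by (simp add: W'_def)
qed

lemma char_symmetric:
  assumes W: "real_distribution W" and sym: "distr W borel uminus = W"
  shows "char W \<kappa> = of_real (LINT x|W. cos (\<kappa> * x))"
proof -
  interpret real_distribution W by (rule W)
  have int: "integrable W (\<lambda>x. cos (\<kappa> * x))" "integrable W (\<lambda>x. sin (\<kappa> * x))"
    by (rule integrable_const_bound[where B = 1]; simp)+
  have "(LINT x|W. sin (\<kappa> * x)) = (LINT x|distr W borel uminus. sin (\<kappa> * x))"
    by (simp add: sym)
  also have "\<dots> = - (LINT x|W. sin (\<kappa> * x))"
    by (subst integral_distr) auto
  finally have sin0: "(LINT x|W. sin (\<kappa> * x)) = 0" by simp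
  have "char W \<kappa> = (CLINT x|W. of_real (cos (\<kappa> * x)) + \<i> * of_real (sin (\<kappa> * x)))"
    by (simp add: char_def exp_Euler cos_of_real sin_of_real flip: of_real_mult)
  also have "\<dots> = of_real (LINT x|W. cos (\<kappa> * x)) + \<i> * of_real (LINT x|W. sin (\<kappa> * x))"
    using int by (subst Bochner_Integration.integral_add) auto
  finally show ?thesis by (simp add: sin0)
qed

lemma one_minus_cos_bounds: "0 \<le> 1 - cos (z::real)" "1 - cos z \<le> 2" "1 - cos z \<le> z\<^sup>2 / 2"
  using cos_le_one[of z] cos_ge_minus_one[of z]
proof -
  have "(sin (z / 2))\<^sup>2 \<le> (z / 2)\<^sup>2"
    using abs_sin_x_le_abs_x[of "z / 2"] by (simp only: abs_le_square_iff)
  then show "1 - cos z \<le> z\<^sup>2 / 2"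
    using cos_double_sin[of "z / 2"] by (simp add: power_divide)
qed (use cos_le_one[of z] cos_ge_minus_one[of z] in linarith)+

lemma second_moment_symbol_limit:
  assumes W: "real_distribution W" and int: "integrable W (\<lambda>x. x\<^sup>2)"
  shows "((\<lambda>h. (LINT x|W. 1 - cos (\<kappa> * h * x)) / h\<^sup>2) \<longlongrightarrow> \<kappa>\<^sup>2 * (LINT x|W. x\<^sup>2) / 2) (at_right 0)"
  unfolding filterlim_at_right_to_top
proof -
  interpret real_distribution W by (rule W)
  have "((\<lambda>T. LINT x|W. (1 - cos (\<kappa> * inverse T * x)) / (inverse T)\<^sup>2) \<longlongrightarrow>
        (LINT x|W. (\<kappa> * x)\<^sup>2 / 2)) at_top"
  proof (rule integral_dominated_convergence_at_top[where w = "\<lambda>x. (\<kappa> * x)\<^sup>2 / 2"])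
    show "integrable W (\<lambda>x. (\<kappa> * x)\<^sup>2 / 2)" using int by (simp add: power_mult_distrib)
    show "\<forall>\<^sub>F T in at_top. AE x in W. norm ((1 - cos (\<kappa> * inverse T * x)) / (inverse T)\<^sup>2) \<le> (\<kappa> * x)\<^sup>2 / 2"
      using eventually_gt_at_top[of 0]
    proof eventually_elim
      case (elim T)
      then show ?case
        using one_minus_cos_bounds(1,3)[of "\<kappa> * inverse T * x" for x]
        by (intro AE_I2) (simp add: field_simps power2_eq_square)
    qed
    show "AE x in W. ((\<lambda>T. (1 - cos (\<kappa> * inverse T * x)) / (inverse T)\<^sup>2) \<longlongrightarrow> (\<kappa> * x)\<^sup>2 / 2) at_top"
    proof (rule AE_I2)
      fix x
      have "((\<lambda>h. (1 - cos (\<kappa> * h * x)) / h\<^sup>2) \<longlongrightarrow> (\<kappa> * x)\<^sup>2 / 2) (at_right 0)"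
      proof -
        have s: "((\<lambda>h. (sin (h * c)) / h) \<longlongrightarrow> c) (at_right 0)" for c :: real
        proof -
          have "((\<lambda>h. sin (h * c)) has_real_derivative c) (at 0)"
            by (auto intro!: derivative_eq_intros)
          from DERIV_D[OF this] have "((\<lambda>h. sin (h * c) / h) \<longlongrightarrow> c) (at 0)" by simp
          then show ?thesis by (rule tendsto_mono[rotated]) (simp add: at_le)
        qed
        have "((\<lambda>h. 2 * (sin (h * (\<kappa> * x / 2)) / h)\<^sup>2) \<longlongrightarrow> 2 * (\<kappa> * x / 2)\<^sup>2) (at_right 0)"
          by (intro tendsto_intros s)
        then show ?thesis
          using cos_double_sin[of "h * (\<kappa> * x / 2)" for h]
          by (simp add: power_divide mult_ac)
      qed
      then show "((\<lambda>T. (1 - cos (\<kappa> * inverse T * x)) / (inverse T)\<^sup>2) \<longlongrightarrow> (\<kappa> * x)\<^sup>2 / 2) at_top"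
        unfolding filterlim_at_right_to_top .
    qed
  qed simp_all
  then show "((\<lambda>T. (LINT x|W. 1 - cos (\<kappa> * inverse T * x)) / (inverse T)\<^sup>2) \<longlongrightarrow> \<kappa>\<^sup>2 * (LINT x|W. x\<^sup>2) / 2) at_top"
    by (simp add: power_mult_distrib)
qed

section \<open>Power laws and the Gamma function\<close>

lemma has_bochner_integral_Gamma:
  fixes p s :: real
  assumes "p > 0" "s > 0"
  shows "has_bochner_integral lborel (\<lambda>t. indicator {0..} t * (t powr (p - 1) * exp (- (s * t)))) (Gamma p / s powr p)"
proof (rule has_bochner_integral_nn_integral)
  have "ennreal (Gamma p) = (\<integral>\<^sup>+t. ennreal (indicator {0..} t * t powr (p - 1) / exp t) \<partial>lborel)"
    by (rule Gamma_conv_nn_integral_real) fact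
  also have "\<dots> = ennreal \<bar>s\<bar> * (\<integral>\<^sup>+t. ennreal (indicator {0..} (0 + s * t) * (0 + s * t) powr (p - 1) / exp (0 + s * t)) \<partial>lborel)"
    using assms by (intro nn_integral_real_affine) auto
  also have "(\<integral>\<^sup>+t. ennreal (indicator {0..} (0 + s * t) * (0 + s * t) powr (p - 1) / exp (0 + s * t)) \<partial>lborel)
      = (\<integral>\<^sup>+t. ennreal (s powr (p - 1)) * ennreal (indicator {0..} t * (t powr (p - 1) * exp (- (s * t)))) \<partial>lborel)"
    using assms
    by (intro nn_integral_cong)
       (auto simp: indicator_def powr_mult exp_minus field_simps zero_le_mult_iff simp flip: ennreal_mult)
  also have "\<dots> = ennreal (s powr (p - 1)) * (\<integral>\<^sup>+t. ennreal (indicator {0..} t * (t powr (p - 1) * exp (- (s * t)))) \<partial>lborel)"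
    by (rule nn_integral_cmult) simp
  finally have *: "ennreal (Gamma p) = ennreal (s powr p) * (\<integral>\<^sup>+t. ennreal (indicator {0..} t * (t powr (p - 1) * exp (- (s * t)))) \<partial>lborel)"
    using assms powr_add[of s 1 "p - 1"] by (simp add: mult.assoc[symmetric] ennreal_mult[symmetric])
  have "ennreal (Gamma p / s powr p) = ennreal (1 / s powr p) * ennreal (Gamma p)"
    using assms by (simp flip: ennreal_mult)
  also have "\<dots> = (\<integral>\<^sup>+t. ennreal (indicator {0..} t * (t powr (p - 1) * exp (- (s * t)))) \<partial>lborel)"
    unfolding * using assms by (simp add: mult.assoc[symmetric] flip: ennreal_mult)
  finally show "(\<integral>\<^sup>+t. ennreal (indicator {0..} t * (t powr (p - 1) * exp (- (s * t)))) \<partial>lborel) = ennreal (Gamma p / s powr p)" ..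
qed (use assms in \<open>auto intro!: Gamma_real_nonneg\<close>)

lemma set_integrable_powr_Icc:
  fixes p :: real
  assumes "p > 0"
  shows "set_integrable lborel {0..A} (\<lambda>t. t powr (p - 1))"
  unfolding set_integrable_def
proof (rule Bochner_Integration.integrable_bound)
  show "integrable lborel (\<lambda>t. exp A * (indicator {0..} t * (t powr (p - 1) * exp (- (1 * t)))))"
    using has_bochner_integral_Gamma[OF assms zero_less_one] by (intro integrable_mult_right) (simp add: has_bochner_integral_iff)
  have "t powr (p - 1) \<le> exp A * (t powr (p - 1) * exp (- t))" if "0 \<le> t" "t \<le> A" for t
  proof -
    have "1 \<le> exp A * exp (- t)" using that by (simp flip: exp_add)
    then show ?thesis using mult_left_mono[of 1 "exp A * exp (- t)" "t powr (p - 1)"] by (simp add: mult_ac)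
  qed
  then show "AE t in lborel. norm (indicat_real {0..A} t *\<^sub>R t powr (p - 1)) \<le>
      norm (exp A * (indicator {0..} t * (t powr (p - 1) * exp (- (1 * t)))))"
    by (auto simp: indicator_def)
qed simp

text \<open>The substitution \<open>t = y\<^sup>2 / (1 + y\<^sup>2)\<close> turns this into the Beta integral with parameters \<open>a / 2\<close> and
  \<open>1 - a / 2\<close>, evaluated by the reflection formula.\<close>

lemma has_bochner_integral_powr_over_quadratic:
  fixes a :: real
  assumes "0 < a" "a < 2"
  shows "has_bochner_integral lborel (\<lambda>y. indicator {0<..} y * (y powr (a - 1) / (1 + y\<^sup>2)))
           (pi / (2 * sin (pi * a / 2)))"
proof -
  define p where "p = a / 2"
  have p: "0 < p" "p < 1" using assms by (auto simp: p_def)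
  define f where "f = (\<lambda>t::real. t powr (p - 1) * (1 - t) powr (- p))"
  define g where "g = (\<lambda>y::real. y\<^sup>2 / (1 + y\<^sup>2))"
  define g' where "g' = (\<lambda>y::real. 2 * y / (1 + y\<^sup>2)\<^sup>2)"
  have q: "1 + y\<^sup>2 > 0" for y :: real by (simp add: add_pos_nonneg)
  have g_deriv: "(g has_field_derivative g' y) (at y within {0<..})" for y
    unfolding g_def g'_def using q[of y]
    by (auto intro!: derivative_eq_intros simp: power2_eq_square field_simps)
  have g_inj: "inj_on g {0<..}"
  proof (rule inj_onI)
    fix x y :: real assume "x \<in> {0<..}" "y \<in> {0<..}" "g x = g y"
    then have "x\<^sup>2 = y\<^sup>2" using q[of x] q[of y] by (simp add: g_def field_simps)
    then show "x = y" using \<open>x \<in> _\<close> \<open>y \<in> _\<close> by (simp add: power2_eq_iff_nonneg)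
  qed
  have g_image: "g ` {0<..} = {0<..<1}"
  proof (intro equalityI subsetI)
    fix t assume "t \<in> g ` {0<..}"
    then show "t \<in> {0<..<1}" using q by (auto simp: g_def)
  next
    fix t :: real assume t: "t \<in> {0<..<1}"
    then have "t = g (sqrt (t / (1 - t)))" by (simp add: g_def field_simps)
    moreover have "sqrt (t / (1 - t)) \<in> {0<..}" using t by simp
    ultimately show "t \<in> g ` {0<..}" by blast
  qed
  have "(f has_integral Beta p (1 - p)) {0<..<1}"
    using has_integral_Beta_real[of p "1 - p"] p by (simp add: f_def has_integral_Icc_iff_Ioo)
  moreover have "f t \<ge> 0" for t by (simp add: f_def)
  ultimately have f: "f absolutely_integrable_on g ` {0<..}" "integral (g ` {0<..}) f = Beta p (1 - p)"
    unfolding g_image by (auto intro!: nonnegative_absolutely_integrable_1 dest: has_integral_integrable integral_unique)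
  have 1: "(\<lambda>y. \<bar>g' y\<bar> * f (g y)) absolutely_integrable_on {0<..} \<and>
      integral {0<..} (\<lambda>y. \<bar>g' y\<bar> * f (g y)) = Beta p (1 - p)"
    using has_absolute_integral_change_of_variables_1'[of "{0<..}" g g' f "Beta p (1 - p)"] g_deriv g_inj f
    by simp
  have integrand: "\<bar>g' y\<bar> * f (g y) = 2 * (y powr (a - 1) / (1 + y\<^sup>2))" if "y > 0" for y
  proof -
    define r where "r = 1 + y\<^sup>2"
    have r: "r > 0" using q by (simp add: r_def)
    have "1 - g y = 1 / r" using r by (simp add: g_def r_def field_simps)
    then have "f (g y) = (y\<^sup>2 / r) powr (p - 1) * (1 / r) powr (- p)"
      by (simp add: f_def g_def r_def)
    also have "\<dots> = (y\<^sup>2) powr (p - 1) * (r powr (1 - p) * r powr p)"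
      using that r by (simp add: powr_divide powr_minus powr_diff field_simps)
    also have "r powr (1 - p) * r powr p = r"
      using r by (simp flip: powr_add)
    also have "(y\<^sup>2) powr (p - 1) = y powr (a - 1) / y"
    proof -
      have "(y\<^sup>2) powr (p - 1) = y powr (2 * (p - 1))"
        using that by (simp add: powr_powr flip: powr_numeral)
      also have "2 * (p - 1) = (a - 1) - 1" by (simp add: p_def)
      finally show ?thesis using that by (simp add: powr_diff power2_eq_square)
    qed
    finally have fg: "f (g y) = y powr (a - 1) / y * r" .
    have gp: "g' y = 2 * y / r\<^sup>2" by (simp add: g'_def r_def)
    show ?thesis
      unfolding gp fg r_def[symmetric] using that r by (simp add: field_simps power2_eq_square)
  qed
  have "(\<lambda>y. 2 * (y powr (a - 1) / (1 + y\<^sup>2))) absolutely_integrable_on {0<..}"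
    using conjunct1[OF 1]
    by (subst set_integrable_cong[OF refl refl, of "{0<..}" _ "\<lambda>y. \<bar>g' y\<bar> * f (g y)"]) (use integrand in auto)
  then have int: "set_integrable lborel {0<..} (\<lambda>y. 2 * (y powr (a - 1) / (1 + y\<^sup>2)))"
    unfolding set_integrable_def by (subst (asm) integrable_completion) auto
  have "(LINT y:{0<..}|lborel. 2 * (y powr (a - 1) / (1 + y\<^sup>2))) = integral {0<..} (\<lambda>y. \<bar>g' y\<bar> * f (g y))"
    unfolding set_borel_integral_eq_integral(2)[OF int]
    by (rule integral_cong) (use integrand in simp)
  also have "\<dots> = Beta p (1 - p)" using 1 by simp
  also have "\<dots> = pi / sin (pi * p)"
  proof -
    have "Gamma p * Gamma (1 - p) = pi / sin (pi * p)"
    proof -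
      have "complex_of_real (Gamma p * Gamma (1 - p)) = complex_of_real (pi / sin (pi * p))"
        using Gamma_reflection_complex[of "complex_of_real p"]
        by (simp flip: Gamma_complex_of_real sin_of_real)
      then show ?thesis by (simp only: of_real_eq_iff)
    qed
    then show ?thesis by (simp add: Beta_def)
  qed
  finally have "(LINT y|lborel. 2 * (indicator {0<..} y * (y powr (a - 1) / (1 + y\<^sup>2)))) = pi / sin (pi * p)"
    by (simp add: set_lebesgue_integral_def mult_ac)
  then have "(LINT y|lborel. indicator {0<..} y * (y powr (a - 1) / (1 + y\<^sup>2))) = pi / (2 * sin (pi * a / 2))"
    by (subst (asm) integral_mult_right_zero) (simp add: p_def)
  moreover have "integrable lborel (\<lambda>y. indicator {0<..} y * (y powr (a - 1) / (1 + y\<^sup>2)))"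
    using integrable_mult_right[of "1/2", OF int[unfolded set_integrable_def]] by (simp add: mult_ac)
  ultimately show ?thesis by (simp add: has_bochner_integral_iff)
qed

text \<open>Writing \<open>u powr (- a)\<close> as a Laplace transform and integrating over \<open>u\<close> first gives an
  absolutely convergent integral over the whole half-line, in which the limit \<open>A \<rightarrow> \<infinity>\<close>
  is harmless.  The integral on the left is in general only conditionally convergent
  as \<open>A \<rightarrow> \<infinity>\<close>.\<close>

lemma sin_powr_integral_eq:
  fixes a A :: real
  assumes a: "0 < a" "a < 2" and A: "A \<ge> 0"
  shows "(LINT u|lborel. indicator {0..A} u * (sin u * u powr (- a))) =
    (LINT y|lborel. indicator {0<..} y * (y powr (a - 1) / (1 + y\<^sup>2)) *
       (1 - exp (- (y * A)) * (y * sin A + cos A))) / Gamma a"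
proof -
  define F where "F = (\<lambda>u y::real. indicator {0..A} u * (sin u * (indicator {0..} y * (y powr (a - 1) * exp (- (u * y))))))"
  have inner: "has_bochner_integral lborel (\<lambda>y. F u y) (indicator {0..A} u * (sin u * (Gamma a / u powr a)))"
    if "u \<noteq> 0" for u
  proof (cases "u > 0")
    case True
    then show ?thesis unfolding F_def
      by (intro has_bochner_integral_mult_right has_bochner_integral_Gamma a)
  next
    case False
    then have "F u = (\<lambda>y. 0)" "indicator {0..A} u = (0::real)" using that by (auto simp: F_def)
    then show ?thesis by (simp add: has_bochner_integral_zero)
  qed
  have ne: "AE u in lborel. u \<noteq> (0::real)" by (rule AE_lborel_singleton)
  have F_norm: "has_bochner_integral lborel (\<lambda>y. norm (F u y)) (indicator {0..A} u * (\<bar>sin u\<bar> * (Gamma a / u powr a)))"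
    if "u \<noteq> 0" for u
  proof -
    have norm_F: "norm (F u y) = indicator {0..A} u * (\<bar>sin u\<bar> * (indicator {0..} y * (y powr (a - 1) * exp (- (u * y)))))" for y
      by (simp add: F_def abs_mult)
    show ?thesis
    proof (cases "u > 0")
      case True
      then show ?thesis unfolding norm_F
        by (intro has_bochner_integral_mult_right has_bochner_integral_Gamma a)
    next
      case False
      then have "indicator {0..A} u = (0::real)" using that by auto
      then show ?thesis unfolding norm_F by (simp add: has_bochner_integral_zero)
    qed
  qed
  have F_meas: "(\<lambda>(u, y). F u y) \<in> borel_measurable (lborel \<Otimes>\<^sub>M lborel)"
    unfolding F_def by measurable
  have int: "integrable (lborel \<Otimes>\<^sub>M lborel) (\<lambda>(u, y). F u y)"
  proof (rule lborel_pair.Fubini_integrable[OF F_meas])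
    have "integrable lborel (\<lambda>u. indicator {0..A} u * (\<bar>sin u\<bar> * (Gamma a / u powr a)))"
    proof (rule Bochner_Integration.integrable_bound)
      show "integrable lborel (\<lambda>u. Gamma a * (indicator {0..A} u *\<^sub>R u powr ((2 - a) - 1)))"
        using set_integrable_powr_Icc[of "2 - a" A] a by (intro integrable_mult_right) (simp add: set_integrable_def)
      have sb: "\<bar>sin u\<bar> * (Gamma a / u powr a) \<le> Gamma a * u powr (1 - a)" if "u > 0" for u
      proof -
        have "\<bar>sin u\<bar> * (Gamma a / u powr a) \<le> u * (Gamma a / u powr a)"
          using that abs_sin_x_le_abs_x[of u] a by (intro mult_right_mono) (auto intro!: Gamma_real_nonneg divide_nonneg_nonneg)
        also have "\<dots> = Gamma a * u powr (1 - a)" using that by (simp add: powr_diff)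
        finally show ?thesis .
      qed
      show "AE u in lborel. norm (indicator {0..A} u * (\<bar>sin u\<bar> * (Gamma a / u powr a))) \<le>
          norm (Gamma a * (indicator {0..A} u *\<^sub>R u powr ((2 - a) - 1)))"
        using ne by eventually_elim (use sb a Gamma_real_pos[of a] in \<open>auto simp: indicator_def abs_mult less_le\<close>)
    qed simp
    then show "integrable lborel (\<lambda>u. LINT y|lborel. norm (case (u, y) of (u, y) \<Rightarrow> F u y))"
      by (rule integrable_cong_AE_imp)
         (use F_meas ne F_norm in \<open>auto simp: has_bochner_integral_iff elim!: eventually_mono\<close>)
    show "AE u in lborel. integrable lborel (\<lambda>y. case (u, y) of (u, y) \<Rightarrow> F u y)"
      using ne by eventually_elim (use inner in \<open>auto simp: has_bochner_integral_iff\<close>)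
  qed
  have "(LINT u|lborel. indicator {0..A} u * (sin u * u powr (- a))) * Gamma a =
      (LINT u|lborel. (indicator {0..A} u * (sin u * (Gamma a / u powr a))))"
    by (subst integral_mult_left_zero[symmetric]) (simp add: powr_minus field_simps)
  also have "\<dots> = (LINT u|lborel. LINT y|lborel. F u y)"
    by (rule integral_cong_AE) (use F_meas ne inner in \<open>auto simp: has_bochner_integral_iff elim!: eventually_mono\<close>)
  also have "\<dots> = (LINT y|lborel. LINT u|lborel. F u y)"
    by (rule lborel_pair.Fubini_integral[symmetric]) (use int in simp)
  also have "\<dots> = (LINT y|lborel. indicator {0<..} y * (y powr (a - 1) / (1 + y\<^sup>2)) *
       (1 - exp (- (y * A)) * (y * sin A + cos A)))"
  proof (rule integral_cong_AE)
    show "AE y in lborel. (LINT u|lborel. F u y) = indicator {0<..} y * (y powr (a - 1) / (1 + y\<^sup>2)) *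
       (1 - exp (- (y * A)) * (y * sin A + cos A))"
      using ne
    proof eventually_elim
      case (elim y)
      have "(LINT u|lborel. F u y) = indicator {0..} y * y powr (a - 1) * (LINT u|lborel. indicator {0..A} u * (exp (- (y * u)) * sin u))"
        unfolding F_def by (subst integral_mult_right_zero[symmetric]) (simp add: mult_ac)
      also have "(LINT u|lborel. indicator {0..A} u * (exp (- (y * u)) * sin u)) = (LBINT u=0..A. exp (- (y * u)) * sin u)"
        using A by (simp add: zero_ereal_def interval_integral_Icc set_lebesgue_integral_def)
      also have "\<dots> = (1 / (1 + y^2)) * (1 - exp (- (y * A)) * (y * sin A + cos A))"
        by (rule LBINT_I0c_exp_mscale_sin)
      finally show ?case using elim by (auto simp: indicator_def)
    qed
  qed (use F_meas in auto)
  finally show ?thesis by (rule eq_divide_imp[rotated]) (use Gamma_real_pos[OF a(1)] in simp)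
qed

lemma sin_powr_integral_limit:
  fixes a :: real
  assumes a: "0 < a" "a < 2"
  shows "((\<lambda>A. LINT u|lborel. indicator {0..A} u * (sin u * u powr (- a))) \<longlongrightarrow>
    pi / (2 * Gamma a * sin (pi * a / 2))) at_top"
proof -
  let ?w = "\<lambda>y. indicator {0<..} y * (y powr (a - 1) / (1 + y\<^sup>2))"
  note w = has_bochner_integral_powr_over_quadratic[OF a]
  have "((\<lambda>A. LINT y|lborel. ?w y * (1 - exp (- (y * A)) * (y * sin A + cos A))) \<longlongrightarrow> (LINT y|lborel. ?w y * (1 - 0))) at_top"
  proof (rule integral_dominated_convergence_at_top[where w = "\<lambda>y. 2 * ?w y"])
    show "\<forall>\<^sub>F A in at_top. AE y in lborel. norm (?w y * (1 - exp (- (y * A)) * (y * sin A + cos A))) \<le> 2 * ?w y"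
      using eventually_ge_at_top[of 1]
    proof eventually_elim
      case (elim A)
      show ?case
      proof (rule AE_I2)
        fix y :: real
        show "norm (?w y * (1 - exp (- (y * A)) * (y * sin A + cos A))) \<le> 2 * ?w y"
        proof (cases "y > 0")
          case True
          have "\<bar>y * sin A + cos A\<bar> \<le> y + 1"
          proof -
            have "\<bar>y * sin A\<bar> \<le> y * 1" using True by (simp add: abs_mult)
            then show ?thesis using abs_cos_le_one[of A] by linarith
          qed
          also have "\<dots> \<le> exp y" using exp_ge_add_one_self[of y] by linarith
          also have "\<dots> \<le> exp (y * A)" using True elim by simp
          finally have "exp (- (y * A)) * \<bar>y * sin A + cos A\<bar> \<le> 1"
            by (simp add: exp_minus field_simps)
          then have "\<bar>exp (- (y * A)) * (y * sin A + cos A)\<bar> \<le> 1" by (simp add: abs_mult)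
          then have "\<bar>1 - exp (- (y * A)) * (y * sin A + cos A)\<bar> \<le> 2" by linarith
          moreover have w0: "?w y \<ge> 0" by simp
          ultimately have "?w y * \<bar>1 - exp (- (y * A)) * (y * sin A + cos A)\<bar> \<le> ?w y * 2"
            by (rule mult_left_mono)
          then show ?thesis
            unfolding real_norm_def abs_mult[of "?w y"] abs_of_nonneg[OF w0] by (simp only: mult.commute[of 2])
        qed simp
      qed
    qed
    show "AE y in lborel. ((\<lambda>A. ?w y * (1 - exp (- (y * A)) * (y * sin A + cos A))) \<longlongrightarrow> ?w y * (1 - 0)) at_top"
    proof (rule AE_I2)
      fix y :: real
      show "((\<lambda>A. ?w y * (1 - exp (- (y * A)) * (y * sin A + cos A))) \<longlongrightarrow> ?w y * (1 - 0)) at_top"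
      proof (cases "y > 0")
        case True
        have "((\<lambda>A. exp (- (y * A))) \<longlongrightarrow> 0) at_top"
          using filterlim_compose[OF exp_at_bot, of "\<lambda>A. - (y * A)" at_top]
            filterlim_tendsto_pos_mult_at_top[OF tendsto_const True filterlim_ident]
          by (simp add: filterlim_uminus_at_bot)
        then have lim: "((\<lambda>A. exp (- (y * A)) * (y + 1)) \<longlongrightarrow> 0) at_top" by (rule tendsto_mult_left_zero)
        have "((\<lambda>A. exp (- (y * A)) * (y * sin A + cos A)) \<longlongrightarrow> 0) at_top"
        proof (rule Lim_null_comparison[OF always_eventually lim], rule allI)
          fix A
          have "\<bar>y * sin A\<bar> \<le> y * 1" using True by (simp add: abs_mult)
          then have "\<bar>y * sin A + cos A\<bar> \<le> y + 1" using abs_cos_le_one[of A] by linarith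
          then show "norm (exp (- (y * A)) * (y * sin A + cos A)) \<le> exp (- (y * A)) * (y + 1)"
            by (simp add: abs_mult)
        qed
        then show ?thesis by (rule tendsto_mult[OF tendsto_const tendsto_diff[OF tendsto_const]])
      qed simp
    qed
    show "integrable lborel (\<lambda>y. 2 * ?w y)"
      using w by (intro integrable_mult_right) (simp only: has_bochner_integral_iff)
  qed simp_all
  then have lim: "((\<lambda>A. (LINT y|lborel. ?w y * (1 - exp (- (y * A)) * (y * sin A + cos A))) / Gamma a) \<longlongrightarrow> (LINT y|lborel. ?w y * (1 - 0)) / Gamma a) at_top"
    using a by (intro tendsto_divide tendsto_const) (auto simp: Gamma_real_pos less_imp_neq[symmetric])
  have val: "(LINT y|lborel. ?w y * (1 - 0)) / Gamma a = pi / (2 * Gamma a * sin (pi * a / 2))"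
    using w by (simp add: has_bochner_integral_iff mult_ac)
  have ev: "\<forall>\<^sub>F A in at_top. (LINT y|lborel. ?w y * (1 - exp (- (y * A)) * (y * sin A + cos A))) / Gamma a
       = (LINT u|lborel. indicator {0..A} u * (sin u * u powr (- a)))"
    using eventually_ge_at_top[of 0] by eventually_elim (rule sin_powr_integral_eq[OF a, symmetric])
  show ?thesis using Lim_transform_eventually[OF lim ev] unfolding val .
qed

section \<open>The symbol of a heavy-tailed jump law\<close>

text \<open>The primitive of \<open>sin\<close>, stopped at whichever of \<open>m\<close> and \<open>A\<close> comes first: this is how the
  tail of the law enters after exchanging expectation and integral.\<close>

lemma one_minus_cos_min_eq:
  fixes m A :: real
  assumes "m \<ge> 0" "A \<ge> 0"
  shows "(LINT u|lborel. indicator {0..A} u * (sin u * indicator {0..<m} u)) = 1 - cos (min m A)"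
proof -
  have "(LINT u|lborel. indicator {0..A} u * (sin u * indicator {0..<m} u)) =
      (LINT u|lborel. indicator {0..min m A} u *\<^sub>R sin u)"
    by (rule integral_cong_AE) (use AE_lborel_singleton[of m] in \<open>auto simp: indicator_def elim!: eventually_mono\<close>)
  also have "\<dots> = - cos (min m A) - - cos 0"
    using assms by (intro integral_FTC_atLeastAtMost)
      (auto intro!: derivative_eq_intros continuous_intros simp: has_real_derivative_iff_has_vector_derivative[symmetric])
  finally show ?thesis by simp
qed

context
  fixes W :: "real measure" and a c :: real
  assumes W: "real_distribution W" and a: "0 < a" "a < 2"
    and tail: "((\<lambda>y. measure W {x. y < \<bar>x\<bar>} * y powr a) \<longlongrightarrow> c) at_top"
begin

interpretation real_distribution W by (rule W)

lemma tail_sets [measurable]: "{x. y < \<bar>x\<bar>} \<in> sets W"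
  by simp

text \<open>The power law holds asymptotically, but a bound of the same form holds for all arguments because
  probabilities are at most one; it provides the dominating function.\<close>

lemma tail_bound: "\<exists>C. \<forall>y>0. measure W {x. y < \<bar>x\<bar>} * y powr a \<le> C"
proof -
  have "\<forall>\<^sub>F y in at_top. measure W {x. y < \<bar>x\<bar>} * y powr a < c + 1"
    using tail by (rule order_tendstoD) simp
  then obtain y0 where y0: "\<And>y. y \<ge> y0 \<Longrightarrow> measure W {x. y < \<bar>x\<bar>} * y powr a < c + 1"
    by (auto simp: eventually_at_top_linorder)
  have "measure W {x. y < \<bar>x\<bar>} * y powr a \<le> max (c + 1) (\<bar>y0\<bar> powr a)" if "y > 0" for y
  proof (cases "y \<ge> y0")
    case True
    then show ?thesis using y0[of y] by linarith
  next
    case False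
    have "measure W {x. y < \<bar>x\<bar>} * y powr a \<le> 1 * \<bar>y0\<bar> powr a"
      using False that a by (intro mult_mono powr_mono2) auto
    then show ?thesis by linarith
  qed
  then show ?thesis by blast
qed

lemma truncated_cos_integral:
  assumes T: "T > 0" and A: "A \<ge> 0"
  shows "(LINT x|W. 1 - cos (min (\<bar>x\<bar> / T) A)) =
    (LINT u|lborel. indicator {0..A} u * (sin u * measure W {x. u * T < \<bar>x\<bar>}))"
proof -
  interpret pair_sigma_finite W lborel ..
  define F where "F = (\<lambda>x u::real. indicator {0..A} u * (sin u * indicator {0..<\<bar>x\<bar> / T} u))"
  have F_eq: "F x u = indicator {0..A} u * (sin u * indicator {x. u * T < \<bar>x\<bar>} x)" for x u
    using T by (auto simp: F_def indicator_def field_simps)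
  have F_meas: "(\<lambda>(x, u). F x u) \<in> borel_measurable (W \<Otimes>\<^sub>M lborel)"
  proof -
    have "(\<lambda>(x, u). indicator {0..A} u * (sin u * (if u * T < \<bar>x\<bar> then 1 else 0))) \<in> borel_measurable (W \<Otimes>\<^sub>M lborel)"
      by measurable
    also have "(\<lambda>(x, u). indicator {0..A} u * (sin u * (if u * T < \<bar>x\<bar> then 1 else 0))) = (\<lambda>(x, u). F x u)"
      by (auto simp: F_eq fun_eq_iff)
    finally show ?thesis .
  qed
  have bound: "norm (F x u) \<le> indicator {0..A} u" for x u
    by (auto simp: F_def indicator_def)
  have indA: "integrable lborel (\<lambda>u. indicator {0..A} u :: real)" by (rule integrable_real_indicator) (simp_all add: emeasure_lborel_Icc_eq)
  have F_int: "integrable lborel (F x)" for x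
    by (rule Bochner_Integration.integrable_bound[OF indA]) (use bound F_meas in \<open>auto simp: F_def\<close>)
  have int: "integrable (W \<Otimes>\<^sub>M lborel) (\<lambda>(x, u). F x u)"
  proof (rule Fubini_integrable[OF F_meas])
    show "integrable W (\<lambda>x. LINT u|lborel. norm (case (x, u) of (x, u) \<Rightarrow> F x u))"
    proof (rule integrable_const_bound[where B = A])
      show "AE x in W. norm (LINT u|lborel. norm (case (x, u) of (x, u) \<Rightarrow> F x u)) \<le> A"
      proof (rule AE_I2)
        fix x
        have "(LINT u|lborel. norm (F x u)) \<le> (LINT u|lborel. indicator {0..A} u)"
          by (intro integral_mono F_int integrable_norm indA bound)
        then show "norm (LINT u|lborel. norm (case (x, u) of (x, u) \<Rightarrow> F x u)) \<le> A" using A by simp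
      qed
    qed (use F_meas in measurable)
  qed (use F_int in simp)
  have "(LINT x|W. 1 - cos (min (\<bar>x\<bar> / T) A)) = (LINT x|W. LINT u|lborel. F x u)"
    unfolding F_def using T A by (subst one_minus_cos_min_eq) auto
  also have "\<dots> = (LINT u|lborel. LINT x|W. F x u)"
    by (rule Fubini_integral[symmetric, OF int])
  also have "\<dots> = (LINT u|lborel. indicator {0..A} u * (sin u * measure W {x. u * T < \<bar>x\<bar>}))"
    unfolding F_eq by (simp add: measure_def)
  finally show ?thesis .
qed

lemma truncated_symbol_limit:
  assumes A: "A \<ge> 0"
  shows "((\<lambda>T. T powr a * (LINT x|W. 1 - cos (min (\<bar>x\<bar> / T) A))) \<longlongrightarrow>
      c * (LINT u|lborel. indicator {0..A} u * (sin u * u powr (- a)))) at_top"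
proof -
  let ?r = "\<lambda>y. measure W {x. y < \<bar>x\<bar>} * y powr a"
  obtain C where C: "\<And>y. y > 0 \<Longrightarrow> ?r y \<le> C" using tail_bound by blast
  have ne: "AE u in lborel. u \<noteq> (0::real)" by (rule AE_lborel_singleton)
  have eq: "measure W {x. u * T < \<bar>x\<bar>} * T powr a = ?r (u * T) * u powr (- a)" if "u > 0" "T > 0" for u T
    using that by (simp add: powr_mult powr_minus field_simps)
  have lim: "((\<lambda>T. LINT u|lborel. indicator {0..A} u * (sin u * (measure W {x. u * T < \<bar>x\<bar>} * T powr a))) \<longlongrightarrow>
     (LINT u|lborel. indicator {0..A} u * (sin u * (c * u powr (- a))))) at_top"
  proof (rule integral_dominated_convergence_at_top[where w = "\<lambda>u. C * (indicator {0..A} u *\<^sub>R u powr ((2 - a) - 1))"])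
    show "integrable lborel (\<lambda>u. C * (indicator {0..A} u *\<^sub>R u powr ((2 - a) - 1)))"
      using set_integrable_powr_Icc[of "2 - a" A] a by (intro integrable_mult_right) (simp add: set_integrable_def)
    show "\<forall>\<^sub>F T in at_top. AE u in lborel. norm (indicator {0..A} u * (sin u * (measure W {x. u * T < \<bar>x\<bar>} * T powr a)))
       \<le> C * (indicator {0..A} u *\<^sub>R u powr ((2 - a) - 1))"
      using eventually_gt_at_top[of 0]
    proof eventually_elim
      case (elim T)
      show ?case using ne
      proof eventually_elim
        case (elim u)
        show ?case
        proof (cases "u \<in> {0..A}")
          case True
          then have u: "u > 0" using elim by auto
          have "\<bar>sin u\<bar> * (?r (u * T) * u powr (- a)) \<le> u * (C * u powr (- a))"
            using abs_sin_x_le_abs_x[of u] u C[of "u * T"] \<open>T > 0\<close>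
            by (intro mult_mono mult_right_mono) auto
          also have "u * (C * u powr (- a)) = C * u powr (1 - a)"
            using u by (simp add: powr_diff powr_minus field_simps)
          finally show ?thesis using True u \<open>T > 0\<close> by (simp add: eq abs_mult)
        qed simp
      qed
    qed
    show "AE u in lborel. ((\<lambda>T. indicator {0..A} u * (sin u * (measure W {x. u * T < \<bar>x\<bar>} * T powr a))) \<longlongrightarrow>
       indicator {0..A} u * (sin u * (c * u powr (- a)))) at_top"
      using ne
    proof eventually_elim
      case (elim u)
      show ?case
      proof (cases "u \<in> {0..A}")
        case True
        then have u: "u > 0" using elim by auto
        have "filterlim (\<lambda>T. u * T) at_top at_top"
          by (rule filterlim_tendsto_pos_mult_at_top[OF tendsto_const u filterlim_ident])
        from filterlim_compose[OF tail this]
        have "((\<lambda>T. ?r (u * T) * u powr (- a)) \<longlongrightarrow> c * u powr (- a)) at_top"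
          by (rule tendsto_mult[OF _ tendsto_const])
        moreover have "\<forall>\<^sub>F T in at_top. ?r (u * T) * u powr (- a) = measure W {x. u * T < \<bar>x\<bar>} * T powr a"
          using eventually_gt_at_top[of 0] by eventually_elim (simp only: eq u)
        ultimately have "((\<lambda>T. measure W {x. u * T < \<bar>x\<bar>} * T powr a) \<longlongrightarrow> c * u powr (- a)) at_top"
          by (rule Lim_transform_eventually)
        then show ?thesis by (rule tendsto_mult[OF tendsto_const tendsto_mult[OF tendsto_const]])
      qed simp
    qed
    have "(\<lambda>y. measure W {x. y < \<bar>x\<bar>}) \<in> borel_measurable borel"
    proof -
      have "antimono (\<lambda>y. measure W {x. y < \<bar>x\<bar>})"
        by (intro antimonoI finite_measure_mono) auto
      then have "mono (\<lambda>y. - measure W {x. y < \<bar>x\<bar>})"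
        by (auto simp: mono_def antimono_def)
      then have "(\<lambda>y. - measure W {x. y < \<bar>x\<bar>}) \<in> borel_measurable borel" by (rule borel_measurable_mono)
      then show ?thesis by (subst (asm) borel_measurable_uminus_eq)
    qed
    then have [measurable]: "(\<lambda>u. measure W {x. u * T < \<bar>x\<bar>}) \<in> borel_measurable borel" for T
      by (rule measurable_compose[rotated]) simp
    show "(\<lambda>u. indicator {0..A} u * (sin u * (measure W {x. u * T < \<bar>x\<bar>} * T powr a))) \<in> borel_measurable lborel" for T
      by measurable
  qed simp
  have val: "(LINT u|lborel. indicator {0..A} u * (sin u * (c * u powr (- a)))) =
      c * (LINT u|lborel. indicator {0..A} u * (sin u * u powr (- a)))"
    by (subst integral_mult_right_zero[symmetric]) (simp add: mult_ac)
  have ev: "\<forall>\<^sub>F T in at_top. (LINT u|lborel. indicator {0..A} u * (sin u * (measure W {x. u * T < \<bar>x\<bar>} * T powr a))) =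
     T powr a * (LINT x|W. 1 - cos (min (\<bar>x\<bar> / T) A))"
    using eventually_gt_at_top[of 0]
  proof eventually_elim
    case (elim T)
    show ?case unfolding truncated_cos_integral[OF elim A]
      by (subst integral_mult_right_zero[symmetric]) (simp add: mult_ac)
  qed
  show ?thesis using Lim_transform_eventually[OF lim ev] unfolding val .
qed

text \<open>Stopping the argument of \<open>1 - cos\<close> at \<open>A\<close> changes the expectation by at most twice the tail beyond
  \<open>A * T\<close>, which after scaling is of order \<open>A powr (- a)\<close> uniformly in \<open>T\<close>.  So the limits
  \<open>T \<rightarrow> \<infinity>\<close> and \<open>A \<rightarrow> \<infinity>\<close> may be taken one after the other.\<close>

lemma heavy_tail_symbol_limit:
  "((\<lambda>T. T powr a * (LINT x|W. 1 - cos (\<bar>x\<bar> / T))) \<longlongrightarrow> c * pi / (2 * Gamma a * sin (pi * a / 2))) at_top"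
proof -
  let ?S = "\<lambda>A. LINT u|lborel. indicator {0..A} u * (sin u * u powr (- a))"
  let ?E = "\<lambda>T. T powr a * (LINT x|W. 1 - cos (\<bar>x\<bar> / T))"
  let ?EA = "\<lambda>A T. T powr a * (LINT x|W. 1 - cos (min (\<bar>x\<bar> / T) A))"
  let ?L = "c * pi / (2 * Gamma a * sin (pi * a / 2))"
  obtain C where C: "\<And>y. y > 0 \<Longrightarrow> measure W {x. y < \<bar>x\<bar>} * y powr a \<le> C" using tail_bound by blast
  have trunc: "\<bar>?E T - ?EA A T\<bar> \<le> 2 * C * A powr (- a)" if T: "T > 0" and A: "A > 0" for T A
  proof -
    have int: "integrable W (\<lambda>x. 1 - cos (\<bar>x\<bar> / T))" "integrable W (\<lambda>x. 1 - cos (min (\<bar>x\<bar> / T) A))"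
      by (intro Bochner_Integration.integrable_diff integrable_const integrable_const_bound[where B = 1]; simp)+
    have "\<bar>(LINT x|W. 1 - cos (\<bar>x\<bar> / T)) - (LINT x|W. 1 - cos (min (\<bar>x\<bar> / T) A))\<bar> =
        \<bar>LINT x|W. (1 - cos (\<bar>x\<bar> / T)) - (1 - cos (min (\<bar>x\<bar> / T) A))\<bar>"
      using int by (subst Bochner_Integration.integral_diff) auto
    also have "\<dots> \<le> (LINT x|W. \<bar>(1 - cos (\<bar>x\<bar> / T)) - (1 - cos (min (\<bar>x\<bar> / T) A))\<bar>)"
      by (rule integral_abs_bound)
    also have "\<dots> \<le> (LINT x|W. 2 * indicator {x. A * T < \<bar>x\<bar>} x)"
    proof (rule integral_mono)
      show "\<bar>(1 - cos (\<bar>x\<bar> / T)) - (1 - cos (min (\<bar>x\<bar> / T) A))\<bar> \<le> 2 * indicator {x. A * T < \<bar>x\<bar>} x" for x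
      proof (cases "A * T < \<bar>x\<bar>")
        case True
        have "\<bar>(1 - cos (\<bar>x\<bar> / T)) - (1 - cos (min (\<bar>x\<bar> / T) A))\<bar> \<le> 2"
          using one_minus_cos_bounds(1,2)[of "\<bar>x\<bar> / T"] one_minus_cos_bounds(1,2)[of "min (\<bar>x\<bar> / T) A"]
          by linarith
        then show ?thesis using True by simp
      next
        case False
        then have "min (\<bar>x\<bar> / T) A = \<bar>x\<bar> / T" using T by (simp add: field_simps min_def)
        then show ?thesis by simp
      qed
      show "integrable W (\<lambda>x. \<bar>(1 - cos (\<bar>x\<bar> / T)) - (1 - cos (min (\<bar>x\<bar> / T) A))\<bar>)"
        by (rule integrable_abs[OF Bochner_Integration.integrable_diff[OF int]])
      show "integrable W (\<lambda>x. 2 * indicator {x. A * T < \<bar>x\<bar>} x :: real)"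
        by (intro integrable_mult_right integrable_const_bound[where B = 1]) auto
    qed
    also have "\<dots> = 2 * measure W {x. A * T < \<bar>x\<bar>}" by (simp add: measure_def)
    finally have *: "\<bar>(LINT x|W. 1 - cos (\<bar>x\<bar> / T)) - (LINT x|W. 1 - cos (min (\<bar>x\<bar> / T) A))\<bar> \<le> 2 * measure W {x. A * T < \<bar>x\<bar>}" .
    have "\<bar>?E T - ?EA A T\<bar> = T powr a * \<bar>(LINT x|W. 1 - cos (\<bar>x\<bar> / T)) - (LINT x|W. 1 - cos (min (\<bar>x\<bar> / T) A))\<bar>"
      by (simp add: abs_mult flip: right_diff_distrib)
    also have "\<dots> \<le> T powr a * (2 * measure W {x. A * T < \<bar>x\<bar>})"
      using * by (intro mult_left_mono) auto
    also have "\<dots> = 2 * (measure W {x. A * T < \<bar>x\<bar>} * (A * T) powr a) * A powr (- a)"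
      using T A by (simp add: powr_mult powr_minus field_simps)
    also have "\<dots> \<le> 2 * C * A powr (- a)"
      using C[of "A * T"] T A by (intro mult_right_mono mult_left_mono) auto
    finally show ?thesis .
  qed
  have "((\<lambda>A. c * ?S A) \<longlongrightarrow> c * (pi / (2 * Gamma a * sin (pi * a / 2)))) at_top"
    by (intro tendsto_mult tendsto_const sin_powr_integral_limit a)
  then have S: "((\<lambda>A. c * ?S A) \<longlongrightarrow> ?L) at_top" by simp
  have "((\<lambda>A::real. A powr (- a)) \<longlongrightarrow> 0) at_top"
    using a by (intro tendsto_neg_powr filterlim_ident) auto
  then have C0: "((\<lambda>A. 2 * C * A powr (- a)) \<longlongrightarrow> 0) at_top" by (rule tendsto_mult_right_zero)
  show ?thesis
  proof (rule tendstoI)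
    fix e :: real assume "e > 0"
    then have e: "e / 3 > 0" by simp
    have "\<forall>\<^sub>F A in at_top. A > 0 \<and> dist (c * ?S A) ?L < e / 3 \<and> dist (2 * C * A powr (- a)) 0 < e / 3"
      using tendstoD[OF S e] tendstoD[OF C0 e] eventually_gt_at_top[of 0] by (intro eventually_conj)
    then obtain A where A: "A > 0" "dist (c * ?S A) ?L < e / 3" "2 * C * A powr (- a) < e / 3"
      by (auto simp: eventually_at_top_linorder)
    have "\<forall>\<^sub>F T in at_top. dist (?EA A T) (c * ?S A) < e / 3"
      using A(1) by (intro tendstoD[OF truncated_symbol_limit e]) simp
    then show "\<forall>\<^sub>F T in at_top. dist (?E T) ?L < e"
      using eventually_gt_at_top[of 0]
    proof eventually_elim
      case (elim T)
      then show ?case using trunc[of T A] A unfolding dist_real_def by linarith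
    qed
  qed
qed

end

text \<open>The leading behaviour of the characteristic function at small frequencies, in both cases of the
  scaling hypothesis: the law is in the domain of attraction of a symmetric stable law of index \<open>\<alpha>\<close>.\<close>

lemma jump_symbol_limit:
  assumes W: "real_distribution W" and sym: "symmetric_law W" and J: "jump_scaling W \<alpha> \<mu>" and "\<mu> > 0"
  shows "((\<lambda>h. (char W (\<kappa> * h) - 1) / of_real (\<mu> * h powr \<alpha>)) \<longlongrightarrow> - of_real (\<bar>\<kappa>\<bar> powr \<alpha>)) (at_right 0)"
proof -
  interpret real_distribution W by (rule W)
  note distr = symmetric_law_distr_uminus[OF W sym]
  define E where "E = (\<lambda>h. LINT x|W. 1 - cos (\<kappa> * h * x))"
  have char_eq: "char W (\<kappa> * h) - 1 = - of_real (E h)" for h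
  proof -
    have "integrable W (\<lambda>x. cos (\<kappa> * h * x))" by (rule integrable_const_bound[where B = 1]; simp)
    then have "E h = 1 - (LINT x|W. cos (\<kappa> * h * x))"
      unfolding E_def using prob_space by (subst Bochner_Integration.integral_diff) auto
    then show ?thesis by (simp add: char_symmetric[OF W distr])
  qed
  have E_lim: "((\<lambda>h. E h / h powr \<alpha>) \<longlongrightarrow> \<mu> * \<bar>\<kappa>\<bar> powr \<alpha>) (at_right 0)"
    using J unfolding jump_scaling_def
  proof (elim disjE conjE exE)
    assume A: "integrable W (\<lambda>x. x\<^sup>2)" "\<alpha> = 2" "\<mu> = (LINT x|W. x\<^sup>2) / 2"
    have "((\<lambda>h. E h / h\<^sup>2) \<longlongrightarrow> \<mu> * \<bar>\<kappa>\<bar> powr \<alpha>) (at_right 0)"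
      using second_moment_symbol_limit[OF W A(1), of \<kappa>] by (cases "\<kappa> = 0") (simp_all add: A E_def mult_ac)
    moreover have "\<forall>\<^sub>F h in at_right 0. E h / h\<^sup>2 = E h / h powr \<alpha>"
      using eventually_at_right_less[of 0] by eventually_elim (simp add: A)
    ultimately show ?thesis by (rule Lim_transform_eventually)
  next
    fix b assume \<alpha>: "0 < \<alpha>" "\<alpha> < 2" and b: "0 < b"
      "(\<lambda>x. measure W {x<..}) \<sim>[at_top] (\<lambda>x. b / \<alpha> * x powr - \<alpha>)"
      "\<mu> = b * pi / (Gamma (\<alpha> + 1) * sin (\<alpha> * pi / 2))"
    show ?thesis
    proof (cases "\<kappa> = 0")
      case True
      then show ?thesis by (simp add: E_def)
    next
      case \<kappa>: False
      have two_sided: "measure W {x. y < \<bar>x\<bar>} = 2 * measure W {y<..}" if "y > 0" for y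
      proof -
        have "measure W {..<- y} = measure (distr W borel uminus) {..<- y}" by (simp add: distr)
        also have "\<dots> = measure W {y<..}"
          by (subst measure_distr) (auto intro!: arg_cong[of _ _ prob])
        finally have "measure W {..<- y} = measure W {y<..}" .
        moreover have "{x. y < \<bar>x\<bar>} = {y<..} \<union> {..<- y}" using that by auto
        then have "measure W {x. y < \<bar>x\<bar>} = measure W {y<..} + measure W {..<- y}"
          using that by (simp only:) (rule finite_measure_Union, auto)
        ultimately show ?thesis by simp
      qed
      have "((\<lambda>y. measure W {y<..} / (b / \<alpha> * y powr - \<alpha>)) \<longlongrightarrow> 1) at_top"
      proof (rule asymp_equivD_strong[OF b(2)])
        show "\<forall>\<^sub>F y in at_top. measure W {y<..} \<noteq> 0 \<or> b / \<alpha> * y powr - \<alpha> \<noteq> 0"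
          using eventually_gt_at_top[of 0] by eventually_elim (use b(1) \<alpha> in simp)
      qed
      then have "((\<lambda>y. 2 * b / \<alpha> * (measure W {y<..} / (b / \<alpha> * y powr - \<alpha>))) \<longlongrightarrow> 2 * b / \<alpha> * 1) at_top"
        by (rule tendsto_mult[OF tendsto_const])
      moreover have "\<forall>\<^sub>F y in at_top. 2 * b / \<alpha> * (measure W {y<..} / (b / \<alpha> * y powr - \<alpha>)) =
          measure W {x. y < \<bar>x\<bar>} * y powr \<alpha>"
        using eventually_gt_at_top[of 0]
        by eventually_elim (use b(1) \<alpha> in \<open>simp add: two_sided powr_minus field_simps\<close>)
      ultimately have tail: "((\<lambda>y. measure W {x. y < \<bar>x\<bar>} * y powr \<alpha>) \<longlongrightarrow> 2 * b / \<alpha>) at_top"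
        unfolding mult_1_right by (rule Lim_transform_eventually)
      have const: "2 * b / \<alpha> * pi / (2 * Gamma \<alpha> * sin (pi * \<alpha> / 2)) = \<mu>"
      proof -
        have "\<alpha> \<notin> \<int>\<^sub>\<le>\<^sub>0" using \<alpha> by (auto elim!: nonpos_Ints_cases)
        then show ?thesis by (simp add: b Gamma_plus1 mult_ac)
      qed
      have "filterlim (\<lambda>h. inverse h / \<bar>\<kappa>\<bar>) at_top (at_right 0)"
        using filterlim_tendsto_pos_mult_at_top[OF tendsto_const, of "inverse \<bar>\<kappa>\<bar>" inverse "at_right 0"] \<kappa>
          filterlim_inverse_at_top_right by (simp add: field_simps)
      from filterlim_compose[OF heavy_tail_symbol_limit[OF W \<alpha> tail, unfolded const] this]
      have "((\<lambda>h. \<bar>\<kappa>\<bar> powr \<alpha> * ((inverse h / \<bar>\<kappa>\<bar>) powr \<alpha> * (LINT x|W. 1 - cos (\<bar>x\<bar> / (inverse h / \<bar>\<kappa>\<bar>))))) \<longlongrightarrow> \<bar>\<kappa>\<bar> powr \<alpha> * \<mu>) (at_right 0)"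
        by (rule tendsto_mult[OF tendsto_const])
      moreover have "\<forall>\<^sub>F h in at_right 0. \<bar>\<kappa>\<bar> powr \<alpha> * ((inverse h / \<bar>\<kappa>\<bar>) powr \<alpha> * (LINT x|W. 1 - cos (\<bar>x\<bar> / (inverse h / \<bar>\<kappa>\<bar>)))) = E h / h powr \<alpha>"
        using eventually_at_right_less[of 0]
      proof eventually_elim
        case (elim h)
        have "cos (\<bar>x\<bar> / (inverse h / \<bar>\<kappa>\<bar>)) = cos (\<kappa> * h * x)" for x
        proof -
          have "\<bar>x\<bar> / (inverse h / \<bar>\<kappa>\<bar>) = \<bar>\<kappa> * h * x\<bar>" using elim by (simp add: abs_mult field_simps)
          then show ?thesis by simp
        qed
        moreover have "\<bar>\<kappa>\<bar> powr \<alpha> * (inverse h / \<bar>\<kappa>\<bar>) powr \<alpha> = 1 / h powr \<alpha>"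
          using elim \<kappa> by (simp add: powr_divide powr_mult inverse_eq_divide)
        ultimately show ?case by (simp add: E_def mult.assoc[symmetric])
      qed
      ultimately show ?thesis
        unfolding mult.commute[of \<mu>] by (rule Lim_transform_eventually)
    qed
  qed
  have "((\<lambda>h. - complex_of_real (E h / h powr \<alpha> / \<mu>)) \<longlongrightarrow> - of_real (\<mu> * \<bar>\<kappa>\<bar> powr \<alpha> / \<mu>)) (at_right 0)"
    using \<open>\<mu> > 0\<close> by (intro tendsto_intros E_lim) auto
  then show ?thesis unfolding char_eq using \<open>\<mu> > 0\<close> by (simp add: divide_divide_eq_left mult.commute)
qed

section \<open>Functions as generalized functions\<close>

text \<open>An integrability condition rather than a growth condition, so that powers of \<open>t\<close> with a
  singularity at \<open>0\<close> are included.\<close>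

definition laplace_integrable :: "(real \<Rightarrow> complex) \<Rightarrow> bool" where
  "laplace_integrable g \<longleftrightarrow> (\<forall>c>0. set_integrable lborel {0..} (\<lambda>t. exp (- c * t) *\<^sub>R g t))"

lemma laplace_integrable_mult_test:
  assumes g: "laplace_integrable g" and c: "c > 0" and \<phi>: "time_test_rate c \<phi>"
  shows "set_integrable lborel {0..} (\<lambda>t. g t * \<phi> t)"
    and "norm (gf_of_fun g \<phi>) \<le> (LINT t:{0..}|lborel. norm (exp (- c * t) *\<^sub>R g t)) * test_norm c 0 \<phi>"
proof -
  let ?e = "\<lambda>t. exp (- c * t) *\<^sub>R g t"
  have e: "set_integrable lborel {0..} ?e" using g c by (simp add: laplace_integrable_def)
  have \<phi>_meas: "\<phi> \<in> borel_measurable borel"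
    using smooth_continuous_on[OF time_test_rate_smooth[OF \<phi>], of UNIV 0]
    by (simp add: borel_measurable_continuous_onI)
  have eq: "indicator {0..} t *\<^sub>R (g t * \<phi> t) = (indicator {0..} t *\<^sub>R ?e t) * (exp (c * t) *\<^sub>R \<phi> t)" for t :: real
    by (simp add: exp_minus scaleR_conv_of_real of_real_inverse)
  have le: "norm (indicator {0..} t *\<^sub>R (g t * \<phi> t)) \<le> norm ((indicator {0..} t *\<^sub>R norm (?e t)) * test_norm c 0 \<phi>)" for t :: real
  proof (cases "t \<ge> 0")
    case True
    have "norm (exp (c * t) *\<^sub>R \<phi> t) \<le> test_norm c 0 \<phi>"
      unfolding norm_exp_scale_le using test_norm_bound[OF \<phi> True, of 0] by simp
    then have "norm (?e t) * norm (exp (c * t) *\<^sub>R \<phi> t) \<le> norm (?e t) * test_norm c 0 \<phi>"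
      by (rule mult_left_mono) simp
    then show ?thesis unfolding eq using True test_norm_nonneg[OF \<phi>, of 0]
      by (simp only: norm_mult) (simp add: abs_mult)
  qed simp
  have dom: "integrable lborel (\<lambda>t. (indicator {0..} t *\<^sub>R norm (?e t)) * test_norm c 0 \<phi>)"
    using set_integrable_norm[OF e] by (intro integrable_mult_left) (simp add: set_integrable_def)
  have meas: "(\<lambda>t. indicator {0..} t *\<^sub>R (g t * \<phi> t)) \<in> borel_measurable lborel"
    unfolding eq using e \<phi>_meas
    by (intro borel_measurable_times) (auto simp: set_integrable_def dest: borel_measurable_integrable)
  show int: "set_integrable lborel {0..} (\<lambda>t. g t * \<phi> t)"
    unfolding set_integrable_def
    by (rule Bochner_Integration.integrable_bound[OF dom meas]) (use le in auto)
  have "norm (gf_of_fun g \<phi>) \<le> (LINT t|lborel. norm (indicator {0..} t *\<^sub>R (g t * \<phi> t)))"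
    unfolding gf_of_fun_def set_lebesgue_integral_def by (rule integral_norm_bound)
  also have "\<dots> \<le> (LINT t|lborel. (indicator {0..} t *\<^sub>R norm (?e t)) * test_norm c 0 \<phi>)"
  proof (rule integral_mono)
    show "integrable lborel (\<lambda>t. norm (indicator {0..} t *\<^sub>R (g t * \<phi> t)))"
      using int by (intro integrable_norm) (simp add: set_integrable_def)
    show "norm (indicator {0..} t *\<^sub>R (g t * \<phi> t)) \<le> (indicator {0..} t *\<^sub>R norm (?e t)) * test_norm c 0 \<phi>" for t :: real
      using le[of t] test_norm_nonneg[OF \<phi>, of 0] by (simp add: abs_mult)
  qed (rule dom)
  also have "\<dots> = (LINT t:{0..}|lborel. norm (?e t)) * test_norm c 0 \<phi>"
    by (simp add: set_lebesgue_integral_def)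
  finally show "norm (gf_of_fun g \<phi>) \<le> (LINT t:{0..}|lborel. norm (?e t)) * test_norm c 0 \<phi>" .
qed

lemma time_gf_of_fun:
  assumes g: "laplace_integrable g"
  shows "time_gf (gf_of_fun g)"
proof (rule time_gfI)
  have int: "set_integrable lborel {0..} (\<lambda>t. g t * \<phi> t)" if "time_test \<phi>" for \<phi>
    using that laplace_integrable_mult_test(1)[OF g] unfolding time_test_def by blast
  show "gf_of_fun g (\<lambda>t. \<phi> t + \<phi>' t) = gf_of_fun g \<phi> + gf_of_fun g \<phi>'"
    if "time_test \<phi>" "time_test \<phi>'" for \<phi> \<phi>'
    unfolding gf_of_fun_def by (simp add: distrib_left set_integral_add(2) int that)
  show "gf_of_fun g (\<lambda>t. a * \<phi> t) = a * gf_of_fun g \<phi>" for a \<phi>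
    unfolding gf_of_fun_def by (simp only: mult.left_commute[of _ a] set_integral_mult_right)
  fix c :: real assume c: "c > 0"
  show "\<exists>C N. \<forall>\<phi>. time_test_rate c \<phi> \<longrightarrow> norm (gf_of_fun g \<phi>) \<le> C * (\<Sum>n\<le>N. test_norm c n \<phi>)"
    using laplace_integrable_mult_test(2)[OF g c]
    by (intro exI[of _ "LINT t:{0..}|lborel. norm (exp (- c * t) *\<^sub>R g t)"] exI[of _ 0] allI impI) simp
qed

lemma gf_deriv_eq: "gf_deriv g \<phi> = - gf_of_fun g (nth_deriv 1 \<phi>) - g 0 * \<phi> 0"
  by (simp add: gf_deriv_def gf_of_fun_def)

text \<open>One derivative moves to the test function, so the order increases by one; the boundary value
  is the point evaluation, which has order zero.\<close>

lemma time_gf_deriv: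
  assumes g: "laplace_integrable g"
  shows "time_gf (gf_deriv g)"
proof (rule time_gfI)
  have smooth: "smooth \<phi>" if "time_test \<phi>" for \<phi>
    using that by (auto simp: time_test_def time_test_rate_smooth)
  have test': "time_test (nth_deriv 1 \<phi>)" if "time_test \<phi>" for \<phi>
    using that time_test_rate_nth_deriv unfolding time_test_def by blast
  show "gf_deriv g (\<lambda>t. \<phi> t + \<phi>' t) = gf_deriv g \<phi> + gf_deriv g \<phi>'"
    if "time_test \<phi>" "time_test \<phi>'" for \<phi> \<phi>'
    unfolding gf_deriv_eq nth_deriv_add[OF that[THEN smooth]]
      time_gf_add[OF time_gf_of_fun[OF g] that[THEN test']] by (simp add: algebra_simps)
  show "gf_deriv g (\<lambda>t. a * \<phi> t) = a * gf_deriv g \<phi>" if "time_test \<phi>" for a \<phi>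
    unfolding gf_deriv_eq nth_deriv_cmult[OF that[THEN smooth]]
      time_gf_cmult[OF time_gf_of_fun[OF g] that[THEN test']] by (simp add: algebra_simps)
  fix c :: real assume c: "c > 0"
  let ?I = "LINT t:{0..}|lborel. norm (exp (- c * t) *\<^sub>R g t)"
  have "norm (gf_deriv g \<phi>) \<le> (?I + norm (g 0)) * (\<Sum>n\<le>1. test_norm c n \<phi>)"
    if \<phi>: "time_test_rate c \<phi>" for \<phi>
  proof -
    have I: "?I \<ge> 0" unfolding set_lebesgue_integral_def by (rule Bochner_Integration.integral_nonneg) simp
    have "norm (gf_of_fun g (nth_deriv 1 \<phi>)) \<le> ?I * test_norm c 1 \<phi>"
      using laplace_integrable_mult_test(2)[OF g c time_test_rate_nth_deriv[OF \<phi>, of 1]]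
      by (simp only: test_norm_nth_deriv) simp
    moreover have "norm (g 0 * \<phi> 0) \<le> norm (g 0) * test_norm c 0 \<phi>"
      using test_norm_bound[OF \<phi>, of 0 0] by (simp add: norm_mult mult_left_mono)
    moreover have "?I * test_norm c 0 \<phi> \<ge> 0" "norm (g 0) * test_norm c 1 \<phi> \<ge> 0"
      using I test_norm_nonneg[OF \<phi>] by (simp_all add: mult_nonneg_nonneg)
    moreover have "norm (gf_deriv g \<phi>) \<le> norm (gf_of_fun g (nth_deriv 1 \<phi>)) + norm (g 0 * \<phi> 0)"
      unfolding gf_deriv_eq by (metis norm_minus_cancel norm_triangle_ineq4)
    ultimately show ?thesis by (simp add: distrib_left distrib_right)
  qed
  then show "\<exists>C N. \<forall>\<phi>. time_test_rate c \<phi> \<longrightarrow> norm (gf_deriv g \<phi>) \<le> C * (\<Sum>n\<le>N. test_norm c n \<phi>)"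
    by blast
qed

lemma gf_laplace_deriv:
  assumes g: "laplace_integrable g" and s: "s > 0"
  shows "gf_laplace (gf_deriv g) s = of_real s * gf_laplace (gf_of_fun g) s - g 0"
proof -
  have "nth_deriv 1 (\<lambda>t. complex_of_real (exp (- s * t))) = (\<lambda>t. - of_real s * of_real (exp (- s * t)))"
    by (simp only: nth_deriv_exp) (simp add: fun_eq_iff)
  then show ?thesis
    unfolding gf_laplace_def gf_deriv_eq
    by (simp only: time_gf_cmult[OF time_gf_of_fun[OF g] time_test_exp[OF s]]) simp
qed

section \<open>Gaussians\<close>

text \<open>A polynomial is at most exponential, and completing the square bounds every exponential
  by a multiple of the reciprocal Gaussian.  The complex parameter \<open>a\<close> covers both modulated
  Gaussians in space (\<open>a\<close> imaginary) and translated Gaussians in time (\<open>a\<close> real).\<close>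

lemma gaussian_poly_bound:
  fixes q :: "complex poly"
  assumes e: "e > 0"
  shows "\<exists>B. \<forall>x::real. exp (c * \<bar>x\<bar>) * norm (poly q (of_real x) * exp (a * of_real x - of_real (e * x\<^sup>2 / 2))) \<le> B"
proof -
  have "\<exists>C\<ge>0. \<exists>k. \<forall>x::real. norm (poly q (of_real x)) \<le> C * exp (real k * \<bar>x\<bar>)"
  proof (induction q)
    case 0
    then show ?case by (intro exI[of _ 0]) simp
  next
    case (pCons b q)
    then obtain C k where C: "C \<ge> 0" "\<And>x::real. norm (poly q (of_real x)) \<le> C * exp (real k * \<bar>x\<bar>)" by blast
    have "norm (poly (pCons b q) (of_real x)) \<le> (norm b + C) * exp (real (Suc k) * \<bar>x\<bar>)" for x :: real
    proof -
      have "norm (poly (pCons b q) (of_real x)) \<le> norm b + \<bar>x\<bar> * norm (poly q (of_real x))"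
        using norm_triangle_ineq[of b "of_real x * poly q (of_real x)"] by (simp add: norm_mult)
      also have "\<dots> \<le> norm b * exp (real (Suc k) * \<bar>x\<bar>) + exp \<bar>x\<bar> * (C * exp (real k * \<bar>x\<bar>))"
      proof (intro add_mono mult_mono)
        show "norm b \<le> norm b * exp (real (Suc k) * \<bar>x\<bar>)"
          using mult_left_mono[of 1 "exp (real (Suc k) * \<bar>x\<bar>)" "norm b"] by simp
        show "\<bar>x\<bar> \<le> exp \<bar>x\<bar>" using exp_ge_add_one_self[of "\<bar>x\<bar>"] by linarith
      qed (use C in auto)
      also have "exp \<bar>x\<bar> * (C * exp (real k * \<bar>x\<bar>)) = C * exp (real (Suc k) * \<bar>x\<bar>)"
      proof -
        have "exp \<bar>x\<bar> * exp (real k * \<bar>x\<bar>) = exp (real (Suc k) * \<bar>x\<bar>)"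
          by (simp add: exp_add[symmetric] algebra_simps)
        then show ?thesis by (simp only: mult.left_commute[of _ C])
      qed
      finally show ?thesis by (simp add: distrib_right)
    qed
    moreover have "norm b + C \<ge> 0" using C by simp
    ultimately show ?case by blast
  qed
  then obtain C k where C: "C \<ge> 0" "\<And>x::real. norm (poly q (of_real x)) \<le> C * exp (real k * \<bar>x\<bar>)" by blast
  define K where "K = c + real k + \<bar>Re a\<bar>"
  have "exp (c * \<bar>x\<bar>) * norm (poly q (of_real x) * exp (a * of_real x - of_real (e * x\<^sup>2 / 2))) \<le> C * exp (K\<^sup>2 / (2 * e))" for x
  proof -
    have "norm (exp (a * of_real x - of_real (e * x\<^sup>2 / 2))) = exp (Re a * x - e * x\<^sup>2 / 2)"
      by simp
    also have "\<dots> \<le> exp (\<bar>Re a\<bar> * \<bar>x\<bar> - e * x\<^sup>2 / 2)"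
      using abs_ge_self[of "Re a * x"] by (simp add: abs_mult)
    finally have "exp (c * \<bar>x\<bar>) * norm (poly q (of_real x) * exp (a * of_real x - of_real (e * x\<^sup>2 / 2)))
      \<le> exp (c * \<bar>x\<bar>) * ((C * exp (real k * \<bar>x\<bar>)) * exp (\<bar>Re a\<bar> * \<bar>x\<bar> - e * x\<^sup>2 / 2))"
      unfolding norm_mult using C by (intro mult_left_mono mult_mono) auto
    also have "\<dots> = C * exp (K * \<bar>x\<bar> - e * x\<^sup>2 / 2)"
    proof -
      have "exp (c * \<bar>x\<bar>) * (exp (real k * \<bar>x\<bar>) * exp (\<bar>Re a\<bar> * \<bar>x\<bar> - e * x\<^sup>2 / 2)) = exp (K * \<bar>x\<bar> - e * x\<^sup>2 / 2)"
        by (simp add: K_def exp_add[symmetric] algebra_simps)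
      then show ?thesis by (simp only: mult.assoc mult.left_commute[of _ C])
    qed
    also have "\<dots> \<le> C * exp (K\<^sup>2 / (2 * e))"
    proof -
      have "0 \<le> (e * \<bar>x\<bar> - K)\<^sup>2 / (2 * e)" using e by simp
      also have "\<dots> = e * x\<^sup>2 / 2 - K * \<bar>x\<bar> + K\<^sup>2 / (2 * e)"
        using e by (simp add: power2_eq_square field_simps)
      finally show ?thesis using C by (intro mult_left_mono) auto
    qed
    finally show ?thesis .
  qed
  then show ?thesis by blast
qed

fun gaussian_deriv_poly :: "complex \<Rightarrow> real \<Rightarrow> nat \<Rightarrow> complex poly" where
  "gaussian_deriv_poly a e 0 = 1"
| "gaussian_deriv_poly a e (Suc n) =
     pderiv (gaussian_deriv_poly a e n) + gaussian_deriv_poly a e n * [:a, - of_real e:]"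

lemma gaussian_derivs:
  fixes a :: complex and e :: real
  defines "G \<equiv> \<lambda>x::real. exp (a * of_real x - of_real (e * x\<^sup>2 / 2)) :: complex"
  shows nth_deriv_gaussian: "nth_deriv n G = (\<lambda>x. poly (gaussian_deriv_poly a e n) (of_real x) * G x)"
    and smooth_gaussian: "smooth G"
proof -
  define g where "g = (\<lambda>z::complex. exp (a * z - of_real e * z\<^sup>2 / 2))"
  have G: "G = (\<lambda>x. g (of_real x))" by (simp add: G_def g_def fun_eq_iff)
  have *: "((\<lambda>x. poly (gaussian_deriv_poly a e n) (of_real x) * G x) has_vector_derivative
      poly (gaussian_deriv_poly a e (Suc n)) (of_real x) * G x) (at x)" for n x
    unfolding G
  proof (rule has_vector_derivative_real_field)
    show "((\<lambda>z. poly (gaussian_deriv_poly a e n) z * g z) has_field_derivative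
        poly (gaussian_deriv_poly a e (Suc n)) (of_real x) * g (of_real x)) (at (of_real x))"
      unfolding g_def by (auto intro!: derivative_eq_intros poly_DERIV simp: algebra_simps)
  qed
  show "nth_deriv n G = (\<lambda>x. poly (gaussian_deriv_poly a e n) (of_real x) * G x)"
    by (rule smooth_by_derivs(1)[where F = "\<lambda>n x. poly (gaussian_deriv_poly a e n) (of_real x) * G x"]; use * in simp)
  show "smooth G"
    by (rule smooth_by_derivs(2)[where F = "\<lambda>n x. poly (gaussian_deriv_poly a e n) (of_real x) * G x"]; use * in simp)
qed

lemma schwartz_gaussian:
  assumes "e > 0"
  shows "schwartz (\<lambda>x. exp (a * of_real x - of_real (e * x\<^sup>2 / 2)))"
  unfolding schwartz_def
proof (intro conjI allI smooth_gaussian)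
  fix m n
  obtain B where B: "\<And>x::real. exp (0 * \<bar>x\<bar>) * norm (poly (monom 1 m * gaussian_deriv_poly a e n) (of_real x) * exp (a * of_real x - of_real (e * x\<^sup>2 / 2))) \<le> B"
    using gaussian_poly_bound[OF assms, of 0 "monom 1 m * gaussian_deriv_poly a e n" a] by blast
  show "bounded (range (\<lambda>x. x ^ m *\<^sub>R nth_deriv n (\<lambda>x. exp (a * of_real x - of_real (e * x\<^sup>2 / 2))) x))"
    unfolding bounded_iff nth_deriv_gaussian using B
    by (intro exI[of _ B]) (auto simp: poly_monom norm_mult norm_power power_abs mult.assoc)
qed

lemma time_test_rate_gaussian:
  assumes "e > 0"
  shows "time_test_rate c (\<lambda>t. exp (a * of_real t - of_real (e * t\<^sup>2 / 2)))"
  unfolding time_test_rate_def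
proof (intro conjI allI smooth_gaussian)
  fix n
  obtain B where B: "\<And>x::real. exp (c * \<bar>x\<bar>) * norm (poly (gaussian_deriv_poly a e n) (of_real x) * exp (a * of_real x - of_real (e * x\<^sup>2 / 2))) \<le> B"
    using gaussian_poly_bound[OF assms] by blast
  show "bounded ((\<lambda>t. exp (c * t) *\<^sub>R nth_deriv n (\<lambda>x. exp (a * of_real x - of_real (e * x\<^sup>2 / 2))) t) ` {0..})"
    unfolding bounded_iff nth_deriv_gaussian
  proof (intro exI[of _ B] ballI, elim imageE)
    fix y t assume "t \<in> {0::real..}" and y: "y = exp (c * t) *\<^sub>R (poly (gaussian_deriv_poly a e n) (of_real t) * exp (a * of_real t - of_real (e * t\<^sup>2 / 2)))"
    then show "norm y \<le> B" using B[of t] by simp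
  qed
qed

lemma normal_density_affine:
  assumes "\<sigma> > 0"
  shows "normal_density m \<sigma> (m + \<sigma> * y) = std_normal_density y / \<sigma>"
  using assms by (simp add: normal_density_def real_sqrt_mult power_mult_distrib)

lemma integral_normal_density_affine:
  fixes f :: "real \<Rightarrow> complex"
  assumes "\<sigma> > 0"
  shows "(LINT x|lborel. f x * of_real (normal_density m \<sigma> x)) =
    (LINT y|lborel. f (m + \<sigma> * y) * of_real (std_normal_density y))"
proof -
  have "(LINT x|lborel. f x * of_real (normal_density m \<sigma> x)) =
    \<bar>\<sigma>\<bar> *\<^sub>R (LINT y|lborel. f (m + \<sigma> * y) * of_real (normal_density m \<sigma> (m + \<sigma> * y)))"
    using assms by (intro lborel_integral_real_affine) simp
  also have "\<dots> = (LINT y|lborel. \<bar>\<sigma>\<bar> *\<^sub>R (f (m + \<sigma> * y) * of_real (normal_density m \<sigma> (m + \<sigma> * y))))"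
    by (rule integral_scaleR_right[symmetric])
  also have "\<dots> = (LINT y|lborel. f (m + \<sigma> * y) * of_real (std_normal_density y))"
    unfolding normal_density_affine[OF assms] using assms by (simp add: scaleR_conv_of_real)
  finally show ?thesis .
qed

text \<open>Exponential growth of \<open>h\<close> is harmless for Gaussian averages.  This lemma is used three times: for
  Fourier inversion, to localize at a frequency, and to localize at a time.\<close>

lemma normal_density_approx_identity:
  fixes h :: "real \<Rightarrow> complex"
  assumes meas: "h \<in> borel_measurable borel" and growth: "\<And>x. norm (h x) \<le> C * exp \<bar>x\<bar>"
    and cont: "isCont h m"
  shows "(\<lambda>n. LINT x|lborel. h x * of_real (normal_density m (1 / real (Suc n)) x)) \<longlonglongrightarrow> h m"
proof -
  have C: "C \<ge> 0" using growth[of 0] by (simp add: order_trans[OF norm_ge_zero])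
  have dens: "has_bochner_integral lborel std_normal_density 1"
    using integrable_normal_density[of 1 0] integral_normal_density[of 1 0] by (simp add: has_bochner_integral_iff)
  have "(\<lambda>n. LINT y|lborel. h (m + 1 / real (Suc n) * y) * of_real (std_normal_density y)) \<longlonglongrightarrow>
      (LINT y|lborel. h m * of_real (std_normal_density y))"
  proof (rule integral_dominated_convergence[where w = "\<lambda>y. (C * exp \<bar>m\<bar> * exp 1 * sqrt 2) * normal_density 0 (sqrt 2) y"])
    show "integrable lborel (\<lambda>y. (C * exp \<bar>m\<bar> * exp 1 * sqrt 2) * normal_density 0 (sqrt 2) y)"
      by (intro integrable_mult_right integrable_normal_density) simp
    show "AE y in lborel. norm (h (m + 1 / real (Suc n) * y) * of_real (std_normal_density y)) \<le> (C * exp \<bar>m\<bar> * exp 1 * sqrt 2) * normal_density 0 (sqrt 2) y" for n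
    proof (rule AE_I2)
      fix y :: real
      have "\<bar>m + 1 / real (Suc n) * y\<bar> \<le> \<bar>m\<bar> + \<bar>y\<bar>"
      proof -
        have "\<bar>1 / real (Suc n) * y\<bar> \<le> 1 * \<bar>y\<bar>" unfolding abs_mult by (intro mult_right_mono) auto
        then show ?thesis using abs_triangle_ineq[of m "1 / real (Suc n) * y"] by linarith
      qed
      also have "\<dots> \<le> \<bar>m\<bar> + (1 + y\<^sup>2 / 4)"
      proof -
        have "0 \<le> (\<bar>y\<bar> / 2 - 1)\<^sup>2" by simp
        also have "(\<bar>y\<bar> / 2 - 1)\<^sup>2 = y\<^sup>2 / 4 - \<bar>y\<bar> + 1" by (simp add: power2_eq_square field_simps)
        finally show ?thesis by simp
      qed
      finally have "C * exp \<bar>m + 1 / real (Suc n) * y\<bar> \<le> C * exp (\<bar>m\<bar> + (1 + y\<^sup>2 / 4))"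
        using C by (intro mult_left_mono) auto
      then have "norm (h (m + 1 / real (Suc n) * y)) \<le> C * exp (\<bar>m\<bar> + (1 + y\<^sup>2 / 4))"
        using growth[of "m + 1 / real (Suc n) * y"] by linarith
      then have "norm (h (m + 1 / real (Suc n) * y)) * std_normal_density y \<le> C * exp (\<bar>m\<bar> + (1 + y\<^sup>2 / 4)) * std_normal_density y"
        by (rule mult_right_mono) simp
      also have "\<dots> = C * exp \<bar>m\<bar> * exp 1 / sqrt (2 * pi) * (exp (y\<^sup>2 / 4) * exp (- y\<^sup>2 / 2))"
        by (simp add: std_normal_density_def exp_add)
      also have "exp (y\<^sup>2 / 4) * exp (- y\<^sup>2 / 2) = exp (- y\<^sup>2 / 4)"
        by (simp flip: exp_add)
      also have "C * exp \<bar>m\<bar> * exp 1 / sqrt (2 * pi) * exp (- y\<^sup>2 / 4) = (C * exp \<bar>m\<bar> * exp 1 * sqrt 2) * normal_density 0 (sqrt 2) y"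
      proof -
        have "1 / sqrt (2 * pi) = sqrt 2 * (1 / sqrt (2 * pi * (sqrt 2)\<^sup>2))"
          by (simp add: real_sqrt_mult divide_simps)
        then have "C * exp \<bar>m\<bar> * exp 1 * (1 / sqrt (2 * pi)) * exp (- y\<^sup>2 / 4) =
            C * exp \<bar>m\<bar> * exp 1 * (sqrt 2 * (1 / sqrt (2 * pi * (sqrt 2)\<^sup>2))) * exp (- y\<^sup>2 / 4)"
          by (simp only:)
        then show ?thesis by (simp add: normal_density_def)
      qed
      finally show "norm (h (m + 1 / real (Suc n) * y) * of_real (std_normal_density y)) \<le> (C * exp \<bar>m\<bar> * exp 1 * sqrt 2) * normal_density 0 (sqrt 2) y"
        by (simp add: norm_mult)
    qed
    show "AE y in lborel. (\<lambda>n. h (m + 1 / real (Suc n) * y) * of_real (std_normal_density y)) \<longlonglongrightarrow> h m * of_real (std_normal_density y)"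
    proof (rule AE_I2)
      fix y :: real
      have "(\<lambda>n. 1 / real (Suc n)) \<longlonglongrightarrow> 0"
        using LIMSEQ_inverse_real_of_nat by (simp add: inverse_eq_divide)
      then have "(\<lambda>n. 1 / real (Suc n) * y) \<longlonglongrightarrow> 0" by (rule tendsto_mult_left_zero)
      then have "(\<lambda>n. m + 1 / real (Suc n) * y) \<longlonglongrightarrow> m + 0" by (rule tendsto_add[OF tendsto_const])
      then have "(\<lambda>n. h (m + 1 / real (Suc n) * y)) \<longlonglongrightarrow> h m"
        using isCont_tendsto_compose[OF cont] by simp
      then show "(\<lambda>n. h (m + 1 / real (Suc n) * y) * of_real (std_normal_density y)) \<longlonglongrightarrow> h m * of_real (std_normal_density y)"
        by (rule tendsto_mult[OF _ tendsto_const])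
    qed
    show "(\<lambda>y. h (m + 1 / real (Suc n) * y) * of_real (std_normal_density y)) \<in> borel_measurable lborel" for n
      using meas by measurable
  qed (use meas in simp_all)
  moreover have "(LINT y|lborel. h m * of_real (std_normal_density y)) = h m"
    using dens by (simp add: has_bochner_integral_iff)
  ultimately show ?thesis by (simp only: integral_normal_density_affine[of "1 / real (Suc n)" for n] divide_pos_pos zero_less_one of_nat_0_less_iff zero_less_Suc)
qed

lemma fourier_normal_density:
  assumes "\<sigma> > 0"
  shows "(LINT x|lborel. iexp (z * x) * of_real (normal_density m \<sigma> x)) = iexp (z * m) * of_real (exp (- (\<sigma>\<^sup>2 * z\<^sup>2 / 2)))"
proof -
  have "(LINT x|lborel. iexp (z * x) * of_real (normal_density m \<sigma> x)) =
     (LINT y|lborel. iexp (z * (m + \<sigma> * y)) * of_real (std_normal_density y))"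
    by (rule integral_normal_density_affine[OF assms])
  also have "\<dots> = (LINT y|lborel. iexp (z * m) * (std_normal_density y *\<^sub>R iexp ((z * \<sigma>) * y)))"
    by (rule Bochner_Integration.integral_cong)
       (simp_all add: distrib_left exp_add[symmetric] scaleR_conv_of_real mult_ac mult_exp_exp)
  also have "\<dots> = iexp (z * m) * (LINT y|lborel. std_normal_density y *\<^sub>R iexp ((z * \<sigma>) * y))"
    by (rule integral_mult_right_zero)
  also have "(LINT y|lborel. std_normal_density y *\<^sub>R iexp ((z * \<sigma>) * y)) = char std_normal_distribution (z * \<sigma>)"
    unfolding char_def by (subst integral_density) auto
  also have "\<dots> = of_real (exp (- (\<sigma>\<^sup>2 * z\<^sup>2 / 2)))"
    by (simp add: char_std_normal_distribution power_mult_distrib mult.commute)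
  finally show ?thesis .
qed

section \<open>Fourier transforms of Schwartz functions\<close>

lemma integrable_inverse_1_plus_square_lborel: "integrable lborel (\<lambda>x::real. inverse (1 + x\<^sup>2))"
  using integrable_inverse_1_plus_square by (simp add: set_integrable_def einterval_def)

lemma schwartz_smooth: "schwartz \<psi> \<Longrightarrow> smooth \<psi>"
  by (simp add: schwartz_def)

lemma schwartz_nth_deriv: "schwartz \<psi> \<Longrightarrow> schwartz (nth_deriv m \<psi>)"
  by (simp add: schwartz_def smooth_nth_deriv nth_deriv_nth_deriv)

lemma schwartz_continuous: "schwartz \<psi> \<Longrightarrow> continuous_on S \<psi>"
  using smooth_continuous_on[of \<psi> S 0] by (simp add: schwartz_smooth)

lemma schwartz_measurable: "schwartz \<psi> \<Longrightarrow> \<psi> \<in> borel_measurable borel"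
  by (simp add: borel_measurable_continuous_onI schwartz_continuous)

lemma schwartz_quadratic_decay:
  assumes "schwartz \<psi>"
  shows "\<exists>B. \<forall>x. norm (\<psi> x) \<le> B * inverse (1 + x\<^sup>2)"
proof -
  have "bounded (range (\<lambda>x. x ^ m *\<^sub>R \<psi> x))" for m
    using assms unfolding schwartz_def by (metis nth_deriv_0)
  then obtain B where B: "\<And>m x. norm (x ^ m *\<^sub>R \<psi> x) \<le> B m"
    unfolding bounded_iff by (metis rangeI)
  have "norm (\<psi> x) \<le> (B 0 + B 2) * inverse (1 + x\<^sup>2)" for x
  proof -
    have "norm (\<psi> x) * (1 + x\<^sup>2) \<le> B 0 + B 2"
      using B[where m=0 and x=x] B[where m=2 and x=x] by (simp add: algebra_simps)
    moreover have "1 + x\<^sup>2 > 0" by (simp add: add_pos_nonneg)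
    ultimately show ?thesis by (simp add: field_simps)
  qed
  then show ?thesis by blast
qed

lemma schwartz_integrable: "schwartz \<psi> \<Longrightarrow> integrable lborel \<psi>"
proof -
  assume \<psi>: "schwartz \<psi>"
  then obtain B where B: "\<And>x. norm (\<psi> x) \<le> B * inverse (1 + x\<^sup>2)"
    using schwartz_quadratic_decay by blast
  have "norm (\<psi> x) \<le> norm (B * inverse (1 + x\<^sup>2))" for x
    using B[of x] by simp
  then show ?thesis
    by (intro Bochner_Integration.integrable_bound[OF integrable_mult_right[OF integrable_inverse_1_plus_square_lborel, of B]])
       (use schwartz_measurable[OF \<psi>] in auto)
qed

lemma schwartz_tendsto_0:
  assumes "schwartz \<psi>"
  shows "(\<psi> \<longlongrightarrow> 0) at_top" "(\<psi> \<longlongrightarrow> 0) at_bot"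
proof -
  obtain B where B: "\<And>x. norm (\<psi> x) \<le> B * inverse (1 + x\<^sup>2)"
    using schwartz_quadratic_decay[OF assms] by blast
  have *: "(\<psi> \<longlongrightarrow> 0) F" if F: "filterlim (\<lambda>x::real. x\<^sup>2) at_top F" for F
  proof (rule Lim_null_comparison[OF always_eventually])
    have "filterlim (\<lambda>x. 1 + x\<^sup>2) at_top F"
      by (rule filterlim_tendsto_add_at_top[OF tendsto_const F])
    then have "((\<lambda>x. inverse (1 + x\<^sup>2)) \<longlongrightarrow> 0) F"
      by (rule tendsto_inverse_0_at_top)
    then show "((\<lambda>x. B * inverse (1 + x\<^sup>2)) \<longlongrightarrow> 0) F" by (rule tendsto_mult_right_zero)
  qed (use B in blast)
  show "(\<psi> \<longlongrightarrow> 0) at_top"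
    by (rule *) (simp add: filterlim_pow_at_top filterlim_ident)
  show "(\<psi> \<longlongrightarrow> 0) at_bot"
    by (rule *) (simp add: filterlim_pow_at_bot_even filterlim_ident)
qed

lemma integrable_iexp_mult: "integrable lborel f \<Longrightarrow> integrable lborel (\<lambda>x. iexp (\<kappa> * x) * f x)"
  for f :: "real \<Rightarrow> complex"
  by (rule Bochner_Integration.integrable_bound) (auto simp: norm_mult)

lemma fourier_bound: "norm (fourier f \<kappa>) \<le> (LINT x|lborel. norm (f x))"
proof -
  have "norm (fourier f \<kappa>) \<le> (LINT x|lborel. norm (iexp (\<kappa> * x) * f x))"
    unfolding fourier_def by (rule integral_norm_bound)
  then show ?thesis by (simp add: norm_mult)
qed

lemma fourier_measurable:
  assumes [measurable]: "f \<in> borel_measurable borel"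
  shows "fourier f \<in> borel_measurable borel"
  unfolding fourier_def[abs_def] by measurable

lemma fourier_deriv:
  assumes "schwartz \<psi>"
  shows "fourier (nth_deriv 1 \<psi>) \<kappa> = - \<i> * of_real \<kappa> * fourier \<psi> \<kappa>"
proof -
  note \<psi>' = schwartz_nth_deriv[OF assms, of 1]
  let ?f = "\<lambda>x. \<i> * of_real \<kappa> * (iexp (\<kappa> * x) * \<psi> x) + iexp (\<kappa> * x) * nth_deriv 1 \<psi> x"
  have int: "integrable lborel (\<lambda>x. iexp (\<kappa> * x) * \<psi> x)" "integrable lborel (\<lambda>x. iexp (\<kappa> * x) * nth_deriv 1 \<psi> x)"
    by (intro integrable_iexp_mult schwartz_integrable assms \<psi>')+
  have int_f: "integrable lborel ?f"
    by (intro Bochner_Integration.integrable_add integrable_mult_right int)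
  have line: "einterval (-\<infinity>) \<infinity> = (UNIV :: real set)" by (auto simp: einterval_def)
  have "(LBINT x=-\<infinity>..\<infinity>. ?f x) = 0 - 0"
  proof (rule interval_integral_FTC_integrable[where F = "\<lambda>x. iexp (\<kappa> * x) * \<psi> x"])
    fix x :: real
    have e: "((\<lambda>x. iexp (\<kappa> * x)) has_vector_derivative \<i> * of_real \<kappa> * iexp (\<kappa> * x)) (at x)"
    proof -
      have "((\<lambda>z. exp (\<i> * (of_real \<kappa> * z))) has_field_derivative \<i> * of_real \<kappa> * iexp (\<kappa> * x)) (at (of_real x))"
        by (auto intro!: derivative_eq_intros simp: mult_ac)
      from has_vector_derivative_real_field[OF this] show ?thesis by simp
    qed
    have p: "(\<psi> has_vector_derivative nth_deriv 1 \<psi> x) (at x)"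
      using smooth_has_vector_derivative[OF schwartz_smooth[OF assms], of 0 x] by simp
    show "((\<lambda>x. iexp (\<kappa> * x) * \<psi> x) has_vector_derivative ?f x) (at x)"
      using has_vector_derivative_mult[OF e p] by (simp add: algebra_simps)
    have "isCont \<psi> x" "isCont (nth_deriv 1 \<psi>) x"
      using schwartz_continuous[OF assms, of UNIV] schwartz_continuous[OF \<psi>', of UNIV]
      by (simp_all add: continuous_on_eq_continuous_at)
    then show "isCont ?f x" by (intro continuous_intros)
  next
    show "set_integrable lborel (einterval (-\<infinity>) \<infinity>) ?f"
      using int_f by (simp only: set_integrable_def line indicator_UNIV scaleR_one)
    have *: "((\<lambda>x. iexp (\<kappa> * x) * \<psi> x) \<longlongrightarrow> 0) F" if "(\<psi> \<longlongrightarrow> 0) F" for F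
      using tendsto_norm_zero[OF that] by (subst tendsto_norm_zero_iff[symmetric]) (simp add: norm_mult)
    show "(((\<lambda>x. iexp (\<kappa> * x) * \<psi> x) \<circ> real_of_ereal) \<longlongrightarrow> 0) (at_right (-\<infinity>))"
      unfolding ereal_tendsto_simps by (rule *[OF schwartz_tendsto_0(2)[OF assms]])
    show "(((\<lambda>x. iexp (\<kappa> * x) * \<psi> x) \<circ> real_of_ereal) \<longlongrightarrow> 0) (at_left \<infinity>)"
      unfolding ereal_tendsto_simps by (rule *[OF schwartz_tendsto_0(1)[OF assms]])
  qed simp
  then have "(LINT x|lborel. ?f x) = 0"
    by (simp add: interval_lebesgue_integral_def set_lebesgue_integral_def line del: integral_mult_right_zero)
  also have "(LINT x|lborel. ?f x) = \<i> * of_real \<kappa> * fourier \<psi> \<kappa> + fourier (nth_deriv 1 \<psi>) \<kappa>"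
    unfolding fourier_def using int by (subst Bochner_Integration.integral_add) auto
  finally show ?thesis by (simp add: eq_neg_iff_add_eq_0 add.commute)
qed

lemma fourier_nth_deriv:
  assumes "schwartz \<psi>"
  shows "fourier (nth_deriv n \<psi>) \<kappa> = (- \<i> * of_real \<kappa>) ^ n * fourier \<psi> \<kappa>"
proof (induction n)
  case (Suc n)
  have "nth_deriv (Suc n) \<psi> = nth_deriv 1 (nth_deriv n \<psi>)" by (simp add: nth_deriv_nth_deriv)
  then show ?case using fourier_deriv[OF schwartz_nth_deriv[OF assms, of n]] Suc by simp
qed simp

text \<open>Four derivatives: the transform has to be integrable against \<open>\<bar>\<kappa>\<bar> powr \<alpha>\<close> with \<open>\<alpha> \<le> 2\<close>.\<close>

lemma fourier_quartic_decay:
  assumes "schwartz \<psi>"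
  shows "\<exists>C. \<forall>\<kappa>. norm (fourier \<psi> \<kappa>) * (1 + \<kappa> ^ 4) \<le> C"
proof -
  have "norm (fourier \<psi> \<kappa>) * (1 + \<kappa> ^ 4) \<le> (LINT x|lborel. norm (\<psi> x)) + (LINT x|lborel. norm (nth_deriv 4 \<psi> x))" for \<kappa>
  proof -
    have "norm (fourier (nth_deriv 4 \<psi>) \<kappa>) = norm (fourier \<psi> \<kappa>) * \<kappa> ^ 4"
      unfolding fourier_nth_deriv[OF assms] by (simp add: norm_mult norm_power)
    then show ?thesis
      using fourier_bound[of \<psi> \<kappa>] fourier_bound[of "nth_deriv 4 \<psi>" \<kappa>] by (simp add: distrib_left)
  qed
  then show ?thesis by blast
qed

lemma powr_le_1_plus_square:
  fixes x a :: real
  assumes "x \<ge> 0" "0 \<le> a" "a \<le> 2"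
  shows "x powr a \<le> 1 + x\<^sup>2"
proof (cases "x \<le> 1")
  case True
  then have "x powr a \<le> 1" using assms powr_mono2[of a x 1] by simp
  then show ?thesis by (simp add: add_increasing2)
next
  case False
  then have "x powr a \<le> x powr 2" using assms by (intro powr_mono) auto
  then show ?thesis using False by simp
qed

lemma integrable_powr_fourier:
  assumes \<psi>: "schwartz \<psi>" and a: "0 \<le> a" "a \<le> 2"
  shows "integrable lborel (\<lambda>\<kappa>. of_real (\<bar>\<kappa>\<bar> powr a) * fourier \<psi> \<kappa>)"
proof -
  obtain C where C: "\<And>\<kappa>. norm (fourier \<psi> \<kappa>) * (1 + \<kappa> ^ 4) \<le> C"
    using fourier_quartic_decay[OF \<psi>] by blast
  have [measurable]: "fourier \<psi> \<in> borel_measurable borel"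
    by (rule fourier_measurable[OF schwartz_measurable[OF \<psi>]])
  have bound: "norm (of_real (\<bar>\<kappa>\<bar> powr a) * fourier \<psi> \<kappa>) \<le> (2 * C) * inverse (1 + \<kappa>\<^sup>2)" for \<kappa> :: real
  proof -
    have "0 \<le> (\<kappa>\<^sup>2 - 1)\<^sup>2" by simp
    then have "(1 + \<kappa>\<^sup>2) * (1 + \<kappa>\<^sup>2) \<le> 2 * (1 + \<kappa> ^ 4)"
      by (simp add: power2_eq_square power4_eq_xxxx algebra_simps)
    then have "\<bar>\<kappa>\<bar> powr a * (1 + \<kappa>\<^sup>2) \<le> 2 * (1 + \<kappa> ^ 4)"
      using mult_right_mono[OF powr_le_1_plus_square[of "\<bar>\<kappa>\<bar>" a], of "1 + \<kappa>\<^sup>2"] a by simp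
    then have "norm (fourier \<psi> \<kappa>) * (\<bar>\<kappa>\<bar> powr a * (1 + \<kappa>\<^sup>2)) \<le> norm (fourier \<psi> \<kappa>) * (2 * (1 + \<kappa> ^ 4))"
      by (rule mult_left_mono) simp
    also have "\<dots> = 2 * (norm (fourier \<psi> \<kappa>) * (1 + \<kappa> ^ 4))" by simp
    also have "\<dots> \<le> 2 * C" using C[of \<kappa>] by (rule mult_left_mono) simp
    finally have "(\<bar>\<kappa>\<bar> powr a * norm (fourier \<psi> \<kappa>)) * (1 + \<kappa>\<^sup>2) \<le> 2 * C" by (simp add: mult_ac)
    moreover have "1 + \<kappa>\<^sup>2 > 0" by (simp add: add_pos_nonneg)
    ultimately show ?thesis by (simp add: norm_mult field_simps)
  qed
  have bound': "norm (of_real (\<bar>\<kappa>\<bar> powr a) * fourier \<psi> \<kappa>) \<le> norm ((2 * C) * inverse (1 + \<kappa>\<^sup>2))" for \<kappa> :: real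
    using order_trans[OF bound abs_ge_self] by (simp only: real_norm_def)
  show ?thesis
    by (rule Bochner_Integration.integrable_bound[OF integrable_mult_right[OF integrable_inverse_1_plus_square_lborel, of "2 * C"]])
       (use bound' in auto)
qed

lemma integrable_fourier:
  assumes "schwartz \<psi>" shows "integrable lborel (fourier \<psi>)"
proof -
  have "AE \<kappa> in lborel. of_real (\<bar>\<kappa>\<bar> powr 0) * fourier \<psi> \<kappa> = fourier \<psi> \<kappa>"
    using AE_lborel_singleton[of 0] by eventually_elim simp
  then show ?thesis
    by (rule integrable_cong_AE_imp[rotated 2])
       (use integrable_powr_fourier[OF assms, of 0] fourier_measurable[OF schwartz_measurable[OF assms]] in auto)
qed

lemma fourier_gaussian:
  assumes \<sigma>: "\<sigma> > 0"
  shows "(LINT x|lborel. iexp (z * x) * of_real (exp (- (\<sigma>\<^sup>2 * x\<^sup>2 / 2)))) = of_real (2 * pi * normal_density 0 \<sigma> z)"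
proof -
  have dens: "exp (- (\<sigma>\<^sup>2 * x\<^sup>2 / 2)) = sqrt (2 * pi) / \<sigma> * normal_density 0 (1 / \<sigma>) x" for x
    using \<sigma> by (simp add: normal_density_def real_sqrt_divide real_sqrt_mult power_divide mult.commute)
  have "(LINT x|lborel. iexp (z * x) * of_real (exp (- (\<sigma>\<^sup>2 * x\<^sup>2 / 2)))) =
      (LINT x|lborel. of_real (sqrt (2 * pi) / \<sigma>) * (iexp (z * x) * of_real (normal_density 0 (1 / \<sigma>) x)))"
    unfolding dens by (rule Bochner_Integration.integral_cong[OF refl]) (simp add: mult_ac)
  also have "\<dots> = of_real (sqrt (2 * pi) / \<sigma> * exp (- ((1 / \<sigma>)\<^sup>2 * z\<^sup>2 / 2)))"
    using \<sigma> by (subst integral_mult_right_zero, subst fourier_normal_density) auto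
  also have "sqrt (2 * pi) / \<sigma> * exp (- ((1 / \<sigma>)\<^sup>2 * z\<^sup>2 / 2)) = 2 * pi * normal_density 0 \<sigma> z"
  proof -
    have "sqrt (2 * pi) / \<sigma> = 2 * pi / sqrt (2 * pi * \<sigma>\<^sup>2)"
      using \<sigma> real_div_sqrt[of "2 * pi"] by (simp add: real_sqrt_mult divide_simps mult_ac)
    then show ?thesis by (simp add: normal_density_def power_divide)
  qed
  finally show ?thesis .
qed

text \<open>A Gaussian factor makes the order of integration exchangeable; the inner integral is then a
  normal density, an approximate identity at \<open>x\<close>.\<close>

theorem fourier_inversion:
  assumes \<psi>: "schwartz \<psi>"
  shows "(LINT \<kappa>|lborel. iexp (- (\<kappa> * x)) * fourier \<psi> \<kappa>) = of_real (2 * pi) * \<psi> x"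
proof -
  have [measurable]: "\<psi> \<in> borel_measurable borel" "fourier \<psi> \<in> borel_measurable borel"
    by (auto intro: fourier_measurable schwartz_measurable \<psi>)
  define \<epsilon> where "\<epsilon> n = 1 / real (Suc n)" for n
  define damp where "damp n \<kappa> = exp (- ((\<epsilon> n)\<^sup>2 * \<kappa>\<^sup>2 / 2))" for n and \<kappa> :: real
  have \<epsilon>: "\<epsilon> n > 0" for n by (simp add: \<epsilon>_def)
  have \<epsilon>_lim: "\<epsilon> \<longlonglongrightarrow> 0"
    unfolding \<epsilon>_def[abs_def] using LIMSEQ_inverse_real_of_nat by (simp add: inverse_eq_divide)
  have lim1: "(\<lambda>n. LINT \<kappa>|lborel. of_real (damp n \<kappa>) * (iexp (- (\<kappa> * x)) * fourier \<psi> \<kappa>)) \<longlonglongrightarrow>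
      (LINT \<kappa>|lborel. of_real 1 * (iexp (- (\<kappa> * x)) * fourier \<psi> \<kappa>))"
  proof (rule integral_dominated_convergence[where w = "\<lambda>\<kappa>. norm (fourier \<psi> \<kappa>)"])
    show "integrable lborel (\<lambda>\<kappa>. norm (fourier \<psi> \<kappa>))"
      by (rule integrable_norm[OF integrable_fourier[OF \<psi>]])
    show "AE \<kappa> in lborel. norm (of_real (damp n \<kappa>) * (iexp (- (\<kappa> * x)) * fourier \<psi> \<kappa>)) \<le> norm (fourier \<psi> \<kappa>)" for n
      by (auto simp: norm_mult damp_def intro!: AE_I2 mult_left_le_one_le)
    show "AE \<kappa> in lborel. (\<lambda>n. of_real (damp n \<kappa>) * (iexp (- (\<kappa> * x)) * fourier \<psi> \<kappa>)) \<longlonglongrightarrow> of_real 1 * (iexp (- (\<kappa> * x)) * fourier \<psi> \<kappa>)"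
    proof (rule AE_I2)
      fix \<kappa> :: real
      have "(\<lambda>n. exp (- ((\<epsilon> n)\<^sup>2 * \<kappa>\<^sup>2 / 2))) \<longlonglongrightarrow> exp (- (0\<^sup>2 * \<kappa>\<^sup>2 / 2))"
        by (intro tendsto_exp tendsto_minus tendsto_divide tendsto_mult tendsto_power \<epsilon>_lim tendsto_const) simp
      then have "(\<lambda>n. damp n \<kappa>) \<longlonglongrightarrow> 1" by (simp add: damp_def)
      then show "(\<lambda>n. of_real (damp n \<kappa>) * (iexp (- (\<kappa> * x)) * fourier \<psi> \<kappa>)) \<longlonglongrightarrow> of_real 1 * (iexp (- (\<kappa> * x)) * fourier \<psi> \<kappa>)"
        by (intro tendsto_mult tendsto_of_real tendsto_const)
    qed
  qed (auto simp: damp_def)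
  have swap: "(LINT \<kappa>|lborel. of_real (damp n \<kappa>) * (iexp (- (\<kappa> * x)) * fourier \<psi> \<kappa>)) =
      of_real (2 * pi) * (LINT y|lborel. \<psi> y * of_real (normal_density x (\<epsilon> n) y))" for n
  proof -
    define F where "F = (\<lambda>\<kappa> y. complex_of_real (damp n \<kappa>) * iexp (\<kappa> * (y - x)) * \<psi> y)"
    have damp_int: "integrable lborel (damp n)"
    proof -
      have "damp n = (\<lambda>\<kappa>. sqrt (2 * pi) / \<epsilon> n * normal_density 0 (1 / \<epsilon> n) \<kappa>)"
        using \<epsilon>[of n] by (simp add: damp_def normal_density_def real_sqrt_divide real_sqrt_mult power_divide mult.commute fun_eq_iff)
      then show ?thesis using \<epsilon>[of n] by (simp add: integrable_mult_right)
    qed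
    have F_meas: "(\<lambda>(\<kappa>, y). F \<kappa> y) \<in> borel_measurable (lborel \<Otimes>\<^sub>M lborel)"
      unfolding F_def damp_def by measurable
    have norm_F: "norm (F \<kappa> y) = damp n \<kappa> * norm (\<psi> y)" for \<kappa> y
      by (simp add: F_def norm_mult damp_def)
    have F_eq: "F \<kappa> y = of_real (damp n \<kappa>) * (iexp (- (\<kappa> * x)) * (iexp (\<kappa> * y) * \<psi> y))" for \<kappa> y
      by (simp add: F_def right_diff_distrib exp_diff exp_minus divide_inverse)
    have F_int: "integrable lborel (F \<kappa>)" for \<kappa>
      unfolding F_eq by (intro integrable_mult_right integrable_iexp_mult schwartz_integrable \<psi>)
    have int: "integrable (lborel \<Otimes>\<^sub>M lborel) (\<lambda>(\<kappa>, y). F \<kappa> y)"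
      by (rule lborel_pair.Fubini_integrable[OF F_meas])
         (simp_all add: norm_F F_int integrable_mult_left damp_int)
    have "(LINT \<kappa>|lborel. of_real (damp n \<kappa>) * (iexp (- (\<kappa> * x)) * fourier \<psi> \<kappa>)) = (LINT \<kappa>|lborel. LINT y|lborel. F \<kappa> y)"
    proof (rule Bochner_Integration.integral_cong[OF refl])
      fix \<kappa>
      have "of_real (damp n \<kappa>) * (iexp (- (\<kappa> * x)) * fourier \<psi> \<kappa>) =
          (LINT y|lborel. of_real (damp n \<kappa>) * (iexp (- (\<kappa> * x)) * (iexp (\<kappa> * y) * \<psi> y)))"
        unfolding fourier_def by simp
      also have "\<dots> = (LINT y|lborel. F \<kappa> y)"
        unfolding F_eq ..
      finally show "of_real (damp n \<kappa>) * (iexp (- (\<kappa> * x)) * fourier \<psi> \<kappa>) = (LINT y|lborel. F \<kappa> y)" .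
    qed
    also have "\<dots> = (LINT y|lborel. LINT \<kappa>|lborel. F \<kappa> y)"
      by (rule lborel_pair.Fubini_integral[symmetric]) (use int in simp)
    also have "\<dots> = (LINT y|lborel. of_real (2 * pi) * (\<psi> y * of_real (normal_density x (\<epsilon> n) y)))"
    proof (rule Bochner_Integration.integral_cong[OF refl])
      fix y
      have "(LINT \<kappa>|lborel. F \<kappa> y) = (LINT \<kappa>|lborel. \<psi> y * (iexp ((y - x) * \<kappa>) * of_real (exp (- ((\<epsilon> n)\<^sup>2 * \<kappa>\<^sup>2 / 2)))))"
        unfolding F_def damp_def by (rule Bochner_Integration.integral_cong[OF refl]) (simp add: mult_ac)
      also have "\<dots> = \<psi> y * of_real (2 * pi * normal_density 0 (\<epsilon> n) (y - x))"
        by (subst integral_mult_right_zero, subst fourier_gaussian[OF \<epsilon>]) (rule refl)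
      also have "normal_density 0 (\<epsilon> n) (y - x) = normal_density x (\<epsilon> n) y"
        by (simp add: normal_density_def)
      finally show "(LINT \<kappa>|lborel. F \<kappa> y) = of_real (2 * pi) * (\<psi> y * of_real (normal_density x (\<epsilon> n) y))" by simp
    qed
    also have "\<dots> = of_real (2 * pi) * (LINT y|lborel. \<psi> y * of_real (normal_density x (\<epsilon> n) y))"
      by (rule integral_mult_right_zero)
    finally show ?thesis .
  qed
  have lim2: "(\<lambda>n. of_real (2 * pi) * (LINT y|lborel. \<psi> y * of_real (normal_density x (\<epsilon> n) y))) \<longlonglongrightarrow> of_real (2 * pi) * \<psi> x"
    unfolding \<epsilon>_def
  proof (intro tendsto_mult tendsto_const)
    obtain B where B: "\<And>x. norm (\<psi> x) \<le> B * inverse (1 + x\<^sup>2)"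
      using schwartz_quadratic_decay[OF \<psi>] by blast
    have B0: "B \<ge> 0" using B[of 0] by (simp add: order_trans[OF norm_ge_zero])
    show "(\<lambda>n. LINT y|lborel. \<psi> y * of_real (normal_density x (1 / real (Suc n)) y)) \<longlonglongrightarrow> \<psi> x"
    proof (rule normal_density_approx_identity)
      show "isCont \<psi> x" using schwartz_continuous[OF \<psi>, of UNIV] by (simp add: continuous_on_eq_continuous_at)
      show "norm (\<psi> x) \<le> B * exp \<bar>x\<bar>" for x
      proof -
        have "inverse (1 + x\<^sup>2) \<le> 1" by (simp add: inverse_le_1_iff add_pos_nonneg)
        also have "1 \<le> exp \<bar>x\<bar>" by simp
        finally show ?thesis using B[of x] B0 by (meson mult_left_mono order_trans)
      qed
    qed simp
  qed
  show ?thesis using LIMSEQ_unique[OF lim1[unfolded swap] lim2] by simp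
qed

section \<open>Laplace transforms of continuous functions\<close>

definition laplace :: "(real \<Rightarrow> complex) \<Rightarrow> real \<Rightarrow> complex" where
  "laplace g s = gf_laplace (gf_of_fun g) s"

lemma laplace_eq: "laplace g s = (LINT t|lborel. indicator {0..} t *\<^sub>R (g t * of_real (exp (- s * t))))"
  by (simp add: laplace_def gf_laplace_def gf_of_fun_def set_lebesgue_integral_def)

definition subexponential :: "(real \<Rightarrow> complex) \<Rightarrow> bool" where
  "subexponential g \<longleftrightarrow> (\<forall>c>0. \<exists>C. \<forall>t\<ge>0. norm (g t) \<le> C * exp (c * t))"

lemma has_bochner_integral_exp_neg:
  assumes "c > 0"
  shows "has_bochner_integral lborel (\<lambda>t::real. indicator {0..} t *\<^sub>R exp (- (c * t))) (1 / c)"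
proof -
  have "has_bochner_integral lborel (\<lambda>t::real. indicator {0..} t * (t powr (1 - 1) * exp (- (c * t)))) (Gamma 1 / c powr 1)"
    by (rule has_bochner_integral_Gamma) (use assms in simp_all)
  moreover have "AE t::real in lborel. indicator {0..} t * (t powr (1 - 1) * exp (- (c * t))) = indicator {0..} t *\<^sub>R exp (- (c * t))"
    using AE_lborel_singleton[of 0] by eventually_elim simp
  then have "has_bochner_integral lborel (\<lambda>t::real. indicator {0..} t * (t powr (1 - 1) * exp (- (c * t)))) (Gamma 1 / c powr 1) \<longleftrightarrow>
      has_bochner_integral lborel (\<lambda>t::real. indicator {0..} t *\<^sub>R exp (- (c * t))) (Gamma 1 / c powr 1)"
    by (intro has_bochner_integral_cong_AE) simp_all
  ultimately show ?thesis using assms by simp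
qed

lemma set_integrable_exp_neg: "c > 0 \<Longrightarrow> set_integrable lborel {0..} (\<lambda>t::real. exp (- (c * t)))"
  using has_bochner_integral_exp_neg unfolding set_integrable_def has_bochner_integral_iff by blast

lemma continuous_on_indicator_measurable:
  fixes g :: "real \<Rightarrow> complex"
  assumes "continuous_on {0..} g"
  shows "(\<lambda>t. indicator {0..} t *\<^sub>R g t) \<in> borel_measurable borel"
  by (rule borel_measurable_continuous_on_indicator[OF _ assms]) simp

lemma laplace_integrand_bound:
  assumes "\<And>t. t \<ge> 0 \<Longrightarrow> norm (g t) \<le> C * exp (c / 2 * t)"
  shows "norm (indicator {0..} t *\<^sub>R (exp (- c * t) *\<^sub>R g t)) \<le> C * (indicator {0..} t *\<^sub>R exp (- (c / 2 * t)))"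
proof (cases "t \<ge> 0")
  case True
  have "exp (- c * t) * norm (g t) \<le> exp (- c * t) * (C * exp (c / 2 * t))"
    using assms[OF True] by (intro mult_left_mono) auto
  also have "\<dots> = C * exp (- (c / 2 * t))"
    by (simp add: mult.left_commute[of _ C] exp_add[symmetric])
  finally show ?thesis using True by simp
qed simp

lemma laplace_integrable_continuous:
  assumes cont: "continuous_on {0..} g" and growth: "subexponential g"
  shows "laplace_integrable g"
  unfolding laplace_integrable_def
proof (intro allI impI)
  fix c :: real assume c: "c > 0"
  obtain C where C: "\<And>t. t \<ge> 0 \<Longrightarrow> norm (g t) \<le> C * exp (c / 2 * t)"
    using growth c unfolding subexponential_def by (meson half_gt_zero)
  have dom: "integrable lborel (\<lambda>t. C * (indicator {0..} t *\<^sub>R exp (- (c / 2 * t))))"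
    using set_integrable_exp_neg[of "c / 2"] c by (intro integrable_mult_right) (simp add: set_integrable_def)
  have "continuous_on {0..} (\<lambda>t. exp (- c * t) *\<^sub>R g t)" by (intro continuous_intros cont)
  from continuous_on_indicator_measurable[OF this]
  have meas: "(\<lambda>t. indicator {0..} t *\<^sub>R (exp (- c * t) *\<^sub>R g t)) \<in> borel_measurable lborel" by simp
  show "set_integrable lborel {0..} (\<lambda>t. exp (- c * t) *\<^sub>R g t)"
    unfolding set_integrable_def
    by (rule Bochner_Integration.integrable_bound[OF dom meas])
       (use order_trans[OF laplace_integrand_bound[of g C c, OF C] abs_ge_self] in simp)
qed

lemma laplace_integrable_set_integrable:
  assumes "laplace_integrable g" "s > 0"
  shows "integrable lborel (\<lambda>t. indicator {0..} t *\<^sub>R (g t * of_real (exp (- s * t))))"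
  using laplace_integrable_mult_test(1)[OF assms time_test_rate_exp[OF order_refl]]
  by (simp add: set_integrable_def)

text \<open>After the substitution \<open>r = s * t\<close> the function is evaluated at \<open>r / s\<close>, which tends to \<open>0\<close>.\<close>

lemma laplace_initial_value:
  assumes cont: "continuous_on {0..} g" and growth: "subexponential g"
  shows "((\<lambda>s. of_real s * laplace g s) \<longlongrightarrow> g 0) at_top"
proof -
  obtain C where C: "\<And>t. t \<ge> 0 \<Longrightarrow> norm (g t) \<le> C * exp (1 / 2 * t)"
    using growth unfolding subexponential_def by (meson half_gt_zero zero_less_one)
  have C0: "C \<ge> 0" using C[of 0] by (simp add: order_trans[OF norm_ge_zero])
  have meas: "(\<lambda>t. indicator {0..} t *\<^sub>R g t) \<in> borel_measurable borel"
    by (rule continuous_on_indicator_measurable[OF cont])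
  have exp_int: "has_bochner_integral lborel (\<lambda>r::real. indicator {0..} r *\<^sub>R exp (- r)) 1"
    using has_bochner_integral_exp_neg[of 1] by simp
  have rescale: "of_real s * laplace g s = (LINT r|lborel. indicator {0..} r *\<^sub>R (g (r / s) * of_real (exp (- r))))" if s: "s > 0" for s
  proof -
    have "laplace g s = \<bar>1 / s\<bar> *\<^sub>R (LINT r|lborel. indicator {0..} (0 + 1 / s * r) *\<^sub>R (g (0 + 1 / s * r) * of_real (exp (- s * (0 + 1 / s * r)))))"
      unfolding laplace_eq using s by (intro lborel_integral_real_affine) simp
    also have "(LINT r|lborel. indicator {0..} (0 + 1 / s * r) *\<^sub>R (g (0 + 1 / s * r) * of_real (exp (- s * (0 + 1 / s * r))))) =
       (LINT r|lborel. indicator {0..} r *\<^sub>R (g (r / s) * of_real (exp (- r))))"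
      using s by (intro Bochner_Integration.integral_cong) (auto simp: indicator_def zero_le_divide_iff)
    finally show ?thesis using s by (simp add: scaleR_conv_of_real)
  qed
  have lim: "((\<lambda>s. LINT r|lborel. indicator {0..} r *\<^sub>R (g (r / s) * of_real (exp (- r)))) \<longlongrightarrow>
      (LINT r|lborel. indicator {0..} r *\<^sub>R (g 0 * of_real (exp (- r))))) at_top"
  proof (rule tendsto_at_topI_sequentially)
    fix X :: "nat \<Rightarrow> real" assume X: "filterlim X at_top sequentially"
    have Xinv: "(\<lambda>n. r / X n) \<longlonglongrightarrow> 0" for r
      by (rule real_tendsto_divide_at_top[OF tendsto_const X])
    \<comment> \<open>The dominating function works for \<open>s \<ge> 1\<close>; early members of the sequence are irrelevant.\<close>
    define Y where "Y n = max (X n) 1" for n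
    have ev: "\<forall>\<^sub>F n in sequentially. Y n = X n"
      using filterlim_at_top[THEN iffD1, OF X, rule_format, of 1] by eventually_elim (simp add: Y_def)
    have Yinv: "(\<lambda>n. r / Y n) \<longlonglongrightarrow> 0" for r
      by (rule Lim_transform_eventually[OF Xinv[of r]]) (use ev in eventually_elim, simp)
    have Y: "Y n \<ge> 1" for n by (simp add: Y_def)
    have "(\<lambda>n. LINT r|lborel. indicator {0..} r *\<^sub>R (g (r / Y n) * of_real (exp (- r)))) \<longlonglongrightarrow>
      (LINT r|lborel. indicator {0..} r *\<^sub>R (g 0 * of_real (exp (- r))))"
    proof (rule integral_dominated_convergence[where w = "\<lambda>r. C * (indicator {0..} r *\<^sub>R exp (- (1 / 2 * r)))"])
      show "integrable lborel (\<lambda>r. C * (indicator {0..} r *\<^sub>R exp (- (1 / 2 * r))))"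
        using set_integrable_exp_neg[of "1 / 2"] by (intro integrable_mult_right) (simp add: set_integrable_def)
      show "AE r in lborel. norm (indicator {0..} r *\<^sub>R (g (r / Y n) * of_real (exp (- r)))) \<le> C * (indicator {0..} r *\<^sub>R exp (- (1 / 2 * r)))" for n
      proof (rule AE_I2)
        fix r :: real
        show "norm (indicator {0..} r *\<^sub>R (g (r / Y n) * of_real (exp (- r)))) \<le> C * (indicator {0..} r *\<^sub>R exp (- (1 / 2 * r)))"
        proof (cases "r \<ge> 0")
          case True
          have Yp: "Y n > 0" using Y[of n] by linarith
          have "r / Y n \<le> r" using Y[of n] True Yp by (simp add: divide_le_eq mult_le_cancel_left1)
          then have "C * exp (1 / 2 * (r / Y n)) \<le> C * exp (1 / 2 * r)"
            using C0 by (intro mult_left_mono) auto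
          moreover have "norm (g (r / Y n)) \<le> C * exp (1 / 2 * (r / Y n))"
            using True Yp by (intro C) simp
          ultimately have "norm (g (r / Y n)) * exp (- r) \<le> (C * exp (1 / 2 * r)) * exp (- r)"
            by (intro mult_right_mono) auto
          also have "\<dots> = C * exp (- (1 / 2 * r))" by (simp add: mult.assoc exp_add[symmetric])
          finally show ?thesis using True by (simp add: norm_mult)
        qed simp
      qed
      show "AE r in lborel. (\<lambda>n. indicator {0..} r *\<^sub>R (g (r / Y n) * of_real (exp (- r)))) \<longlonglongrightarrow> indicator {0..} r *\<^sub>R (g 0 * of_real (exp (- r)))"
      proof (rule AE_I2)
        fix r :: real
        show "(\<lambda>n. indicator {0..} r *\<^sub>R (g (r / Y n) * of_real (exp (- r)))) \<longlonglongrightarrow> indicator {0..} r *\<^sub>R (g 0 * of_real (exp (- r)))"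
        proof (cases "r \<ge> 0")
          case True
          have "(\<lambda>n. g (r / Y n)) \<longlonglongrightarrow> g 0"
          proof (rule continuous_on_tendsto_compose[OF cont Yinv])
            show "\<forall>\<^sub>F n in sequentially. r / Y n \<in> {0..}"
              using True order_trans[OF zero_le_one Y] by (intro always_eventually) auto
          qed simp
          then show ?thesis by (intro tendsto_scaleR tendsto_mult tendsto_const)
        qed simp
      qed
      have eq: "indicator {0..} r *\<^sub>R (g (r / Y n) * of_real (exp (- r))) =
        (indicator {0..} (r / Y n) *\<^sub>R g (r / Y n)) * of_real (exp (- r))" for n and r :: real
        using Y[of n] by (auto simp: indicator_def zero_le_divide_iff)
      have [measurable]: "(\<lambda>r. indicator {0..} (r / Y n) *\<^sub>R g (r / Y n)) \<in> borel_measurable borel" for n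
        by (rule measurable_compose[OF _ meas]) simp
      show "(\<lambda>r. indicator {0..} r *\<^sub>R (g (r / Y n) * of_real (exp (- r)))) \<in> borel_measurable lborel" for n
        unfolding eq by measurable
    qed simp
    then show "(\<lambda>n. LINT r|lborel. indicator {0..} r *\<^sub>R (g (r / X n) * of_real (exp (- r)))) \<longlonglongrightarrow>
      (LINT r|lborel. indicator {0..} r *\<^sub>R (g 0 * of_real (exp (- r))))"
      by (rule Lim_transform_eventually) (use ev in eventually_elim, simp)
  qed
  have val: "(LINT r|lborel. indicator {0..} r *\<^sub>R (g 0 * of_real (exp (- r)))) = g 0"
  proof -
    have "(LINT r|lborel. indicator {0..} r *\<^sub>R (g 0 * of_real (exp (- r)))) =
      (LINT r|lborel. g 0 * of_real (indicator {0..} r *\<^sub>R exp (- r)))"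
      by (rule Bochner_Integration.integral_cong) (auto simp: indicator_def)
    also have "\<dots> = g 0 * of_real (LINT r|lborel. indicator {0..} r *\<^sub>R exp (- r))"
      by (simp only: integral_mult_right_zero integral_complex_of_real)
    finally show ?thesis using has_bochner_integral_integral_eq[OF exp_int] by simp
  qed
  have ev: "\<forall>\<^sub>F s in at_top. (LINT r|lborel. indicator {0..} r *\<^sub>R (g (r / s) * of_real (exp (- r)))) = of_real s * laplace g s"
    using eventually_gt_at_top[of 0] by eventually_elim (rule rescale[symmetric])
  show ?thesis using Lim_transform_eventually[OF lim ev] unfolding val .
qed

section \<open>Density evolutions in Fourier-Laplace variables\<close>

lemma continuous_on_fourier_integral:
  fixes F :: "real \<Rightarrow> complex"
  assumes F: "integrable lborel F"
  shows "continuous_on UNIV (\<lambda>x. LINT \<kappa>|lborel. iexp (- (\<kappa> * x)) * F \<kappa>)"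
  unfolding continuous_on_sequentially comp_def
proof (intro ballI allI impI, elim conjE)
  fix X and x :: real assume X: "X \<longlonglongrightarrow> x"
  show "(\<lambda>n. LINT \<kappa>|lborel. iexp (- (\<kappa> * X n)) * F \<kappa>) \<longlonglongrightarrow> (LINT \<kappa>|lborel. iexp (- (\<kappa> * x)) * F \<kappa>)"
  proof (rule integral_dominated_convergence[where w = "\<lambda>\<kappa>. norm (F \<kappa>)"])
    show "AE \<kappa> in lborel. (\<lambda>n. iexp (- (\<kappa> * X n)) * F \<kappa>) \<longlonglongrightarrow> iexp (- (\<kappa> * x)) * F \<kappa>"
      by (intro AE_I2 tendsto_mult tendsto_const isCont_tendsto_compose[OF isCont_iexp] tendsto_minus X)
  qed (use F in \<open>auto simp: norm_mult\<close>)
qed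

text \<open>The Parseval relation between a finite measure and an integrable function.\<close>

lemma integral_fourier_integral:
  fixes F :: "real \<Rightarrow> complex"
  assumes M: "finite_measure M" "sets M = sets borel" and F: "integrable lborel F"
  shows "(LINT x|M. LINT \<kappa>|lborel. iexp (- (\<kappa> * x)) * F \<kappa>) = (LINT \<kappa>|lborel. F \<kappa> * char M (- \<kappa>))"
proof -
  interpret M: finite_measure M by (rule M(1))
  interpret pair_sigma_finite M lborel ..
  have [measurable_cong]: "sets M = sets borel" by (rule M(2))
  have [measurable]: "F \<in> borel_measurable borel" using F by auto
  have int: "integrable (M \<Otimes>\<^sub>M lborel) (\<lambda>(x, \<kappa>). iexp (- (\<kappa> * x)) * F \<kappa>)"
  proof (rule Fubini_integrable)
    show "(\<lambda>(x, \<kappa>). iexp (- (\<kappa> * x)) * F \<kappa>) \<in> borel_measurable (M \<Otimes>\<^sub>M lborel)" by measurable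
    show "AE x in M. integrable lborel (\<lambda>\<kappa>. case (x, \<kappa>) of (x, \<kappa>) \<Rightarrow> iexp (- (\<kappa> * x)) * F \<kappa>)"
      using F by (intro AE_I2) (simp, rule Bochner_Integration.integrable_bound[OF F], auto simp: norm_mult)
  qed (simp add: norm_mult)
  have "(LINT x|M. LINT \<kappa>|lborel. iexp (- (\<kappa> * x)) * F \<kappa>) = (LINT \<kappa>|lborel. LINT x|M. iexp (- (\<kappa> * x)) * F \<kappa>)"
    by (rule Fubini_integral[symmetric, OF int])
  also have "\<dots> = (LINT \<kappa>|lborel. F \<kappa> * char M (- \<kappa>))"
    by (simp add: char_def mult.commute)
  finally show ?thesis .
qed

lemma schwartz_eq_fourier_integral:
  assumes "schwartz \<psi>"
  shows "\<psi> = (\<lambda>x. LINT \<kappa>|lborel. iexp (- (\<kappa> * x)) * (fourier \<psi> \<kappa> / of_real (2 * pi)))"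
proof
  fix x
  have "(LINT \<kappa>|lborel. iexp (- (\<kappa> * x)) * (fourier \<psi> \<kappa> / of_real (2 * pi))) = (LINT \<kappa>|lborel. iexp (- (\<kappa> * x)) * fourier \<psi> \<kappa>) / of_real (2 * pi)"
    by (simp only: times_divide_eq_right integral_divide_zero)
  then show "\<psi> x = (LINT \<kappa>|lborel. iexp (- (\<kappa> * x)) * (fourier \<psi> \<kappa> / of_real (2 * pi)))"
    using fourier_inversion[OF assms, of x] by simp
qed

lemma riesz_eq_fourier_integral:
  "riesz \<alpha> \<psi> = (\<lambda>x. LINT \<kappa>|lborel. iexp (- (\<kappa> * x)) * (- (of_real (\<bar>\<kappa>\<bar> powr \<alpha>) * fourier \<psi> \<kappa>) / of_real (2 * pi)))"
  unfolding riesz_def[abs_def] by (simp only: times_divide_eq_right integral_divide_zero mult_minus_left)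

context
  fixes u :: "real \<Rightarrow> real measure"
  assumes u: "density_evolution u"
begin

lemma evolution_measure: "t \<ge> 0 \<Longrightarrow> finite_measure (u t)" "t \<ge> 0 \<Longrightarrow> sets (u t) = sets borel"
  using u by (auto simp: density_evolution_def)

lemma evolution_mass: "c > 0 \<Longrightarrow> \<exists>C. \<forall>t\<ge>0. measure (u t) UNIV \<le> C * exp (c * t)"
  using u by (simp add: density_evolution_def)

lemma evolution_integral_bound:
  fixes f :: "real \<Rightarrow> complex"
  assumes t: "t \<ge> 0" and f: "f \<in> borel_measurable borel" and B: "\<And>x. norm (f x) \<le> B"
  shows "norm (LINT x|u t. f x) \<le> B * measure (u t) UNIV"
proof -
  interpret finite_measure "u t" by (rule evolution_measure[OF t])
  have sets: "sets (u t) = sets borel" by (rule evolution_measure[OF t])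
  have space: "space (u t) = UNIV" using sets_eq_imp_space_eq[OF sets] by simp
  have "norm (LINT x|u t. f x) \<le> (LINT x|u t. norm (f x))" by (rule integral_norm_bound)
  also have "\<dots> \<le> (LINT x|u t. B)"
    using f B by (intro integral_mono integrable_norm integrable_const integrable_const_bound[where B = B])
      (auto simp: measurable_cong_sets[OF sets refl])
  finally show ?thesis by (simp add: space mult.commute)
qed

lemma evolution_integral_continuous:
  fixes f :: "real \<Rightarrow> complex"
  assumes f: "continuous_on UNIV f" and B: "\<And>x. norm (f x) \<le> B"
  shows "continuous_on {0..} (\<lambda>t. LINT x|u t. f x)"
proof -
  have weak: "continuous_on {0..} (\<lambda>t. LINT x|u t. r x)" if "continuous_on UNIV r" "bounded (range r)" for r :: "real \<Rightarrow> real"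
    using u that by (simp add: density_evolution_def)
  have "bounded (range (\<lambda>x. Re (f x)))" "bounded (range (\<lambda>x. Im (f x)))"
    using order_trans[OF abs_Re_le_cmod B] order_trans[OF abs_Im_le_cmod B]
    by (auto simp: bounded_iff)
  then have "continuous_on {0..} (\<lambda>t. complex_of_real (LINT x|u t. Re (f x)) + \<i> * complex_of_real (LINT x|u t. Im (f x)))"
    using f by (intro continuous_intros weak)
  moreover have "(LINT x|u t. f x) = complex_of_real (LINT x|u t. Re (f x)) + \<i> * complex_of_real (LINT x|u t. Im (f x))" if t: "t \<ge> 0" for t
  proof -
    interpret finite_measure "u t" by (rule evolution_measure[OF t])
    have "integrable (u t) f"
      using f B by (intro integrable_const_bound[where B = B])
        (auto simp: measurable_cong_sets[OF evolution_measure(2)[OF t] refl] borel_measurable_continuous_onI)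
    then show ?thesis by (simp add: complex_eq_iff)
  qed
  ultimately show ?thesis by (subst continuous_on_cong[OF refl]) auto
qed

lemma evolution_integral_subexponential:
  fixes f :: "real \<Rightarrow> complex"
  assumes f: "f \<in> borel_measurable borel" and B: "\<And>x. norm (f x) \<le> B"
  shows "subexponential (\<lambda>t. LINT x|u t. f x)"
  unfolding subexponential_def
proof (intro allI impI)
  fix c :: real assume "c > 0"
  then obtain C where C: "\<And>t. t \<ge> 0 \<Longrightarrow> measure (u t) UNIV \<le> C * exp (c * t)" using evolution_mass by blast
  have B0: "B \<ge> 0" using B[of 0] by (simp add: order_trans[OF norm_ge_zero])
  have "norm (LINT x|u t. f x) \<le> (B * C) * exp (c * t)" if "t \<ge> 0" for t
    using evolution_integral_bound[OF that f B] mult_left_mono[OF C[OF that] B0] by (simp add: mult.assoc)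
  then show "\<exists>C. \<forall>t\<ge>0. norm (LINT x|u t. f x) \<le> C * exp (c * t)" by blast
qed

lemma char_evolution:
  shows char_evolution_continuous: "continuous_on {0..} (\<lambda>t. char (u t) \<kappa>)"
    and char_evolution_subexponential: "subexponential (\<lambda>t. char (u t) \<kappa>)"
  unfolding char_def
  by (intro evolution_integral_continuous[where B = 1] evolution_integral_subexponential[where B = 1] continuous_intros; simp)+

lemma char_evolution_bound: "t \<ge> 0 \<Longrightarrow> norm (char (u t) \<kappa>) \<le> measure (u t) UNIV"
  unfolding char_def using evolution_integral_bound[of t "\<lambda>x. iexp (\<kappa> * x)" 1] by simp

lemma char_evolution_regular:
  assumes t: "t \<ge> 0" shows "(\<lambda>\<kappa>. char (u t) \<kappa>) \<in> borel_measurable borel" "X \<longlonglongrightarrow> \<kappa> \<Longrightarrow> (\<lambda>n. char (u t) (X n)) \<longlonglongrightarrow> char (u t) \<kappa>"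
proof -
  interpret finite_measure "u t" by (rule evolution_measure[OF t])
  have [measurable_cong]: "sets (u t) = sets borel" by (rule evolution_measure[OF t])
  show lim: "(\<lambda>n. char (u t) (X n)) \<longlonglongrightarrow> char (u t) \<kappa>" if X: "X \<longlonglongrightarrow> \<kappa>" for X \<kappa>
    unfolding char_def
  proof (rule integral_dominated_convergence[where w = "\<lambda>_. 1"])
    show "AE x in u t. (\<lambda>n. iexp (X n * x)) \<longlonglongrightarrow> iexp (\<kappa> * x)"
      by (intro AE_I2 isCont_tendsto_compose[OF isCont_iexp] tendsto_mult tendsto_const X)
  qed auto
  show "(\<lambda>\<kappa>. char (u t) \<kappa>) \<in> borel_measurable borel"
    by (rule borel_measurable_continuous_onI) (auto simp: continuous_on_sequentially comp_def intro: lim)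
qed

text \<open>The characteristic function is continuous in each variable separately; rounding the frequency
  exhibits it as a pointwise limit of jointly measurable functions.\<close>

lemma char_evolution_measurable:
  "(\<lambda>(t, \<kappa>). indicator {0..} t *\<^sub>R char (u t) \<kappa>) \<in> borel_measurable (borel \<Otimes>\<^sub>M borel)"
proof (rule borel_measurable_LIMSEQ_metric)
  let ?k = "\<lambda>n (i::int). real_of_int i / real (Suc n)"
  show "(\<lambda>(t, \<kappa>). indicator {0..} t *\<^sub>R char (u t) (?k n \<lfloor>real (Suc n) * \<kappa>\<rfloor>)) \<in> borel_measurable (borel \<Otimes>\<^sub>M borel)" for n
  proof -
    have 1: "(\<lambda>p. indicator {0..} (fst p) *\<^sub>R char (u (fst p)) (?k n i)) \<in> borel_measurable (borel \<Otimes>\<^sub>M borel)" for i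
      by (rule measurable_compose[OF measurable_fst continuous_on_indicator_measurable[OF char_evolution_continuous]])
    have 2: "(\<lambda>p. \<lfloor>real (Suc n) * snd p\<rfloor>) \<in> (borel \<Otimes>\<^sub>M borel) \<rightarrow>\<^sub>M count_space UNIV"
      by measurable
    show ?thesis
      using measurable_compose_countable[OF 1 2] by (simp add: case_prod_unfold)
  qed
  fix p :: "real \<times> real"
  obtain t \<kappa> where p: "p = (t, \<kappa>)" by (cases p)
  have lim: "(\<lambda>n. ?k n \<lfloor>real (Suc n) * \<kappa>\<rfloor>) \<longlonglongrightarrow> \<kappa>"
  proof (rule LIMSEQ_I)
    fix r :: real assume "r > 0"
    then obtain N where N: "1 / real (Suc N) < r" using nat_approx_posE by blast
    show "\<exists>N. \<forall>n\<ge>N. norm (?k n \<lfloor>real (Suc n) * \<kappa>\<rfloor> - \<kappa>) < r"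
    proof (intro exI allI impI)
      fix n assume "n \<ge> N"
      then have "1 / real (Suc n) \<le> 1 / real (Suc N)" by (simp add: frac_le)
      moreover have "\<bar>?k n \<lfloor>real (Suc n) * \<kappa>\<rfloor> - \<kappa>\<bar> \<le> 1 / real (Suc n)"
      proof -
        have "\<bar>real_of_int \<lfloor>real (Suc n) * \<kappa>\<rfloor> - real (Suc n) * \<kappa>\<bar> \<le> 1" by linarith
        moreover have "?k n \<lfloor>real (Suc n) * \<kappa>\<rfloor> - \<kappa> = (real_of_int \<lfloor>real (Suc n) * \<kappa>\<rfloor> - real (Suc n) * \<kappa>) / real (Suc n)"
          by (simp add: diff_divide_distrib)
        ultimately show ?thesis by (simp only: abs_divide) (simp add: divide_right_mono)
      qed
      ultimately show "norm (?k n \<lfloor>real (Suc n) * \<kappa>\<rfloor> - \<kappa>) < r" using N by simp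
    qed
  qed
  show "(\<lambda>n. case p of (t, \<kappa>) \<Rightarrow> indicator {0..} t *\<^sub>R char (u t) (?k n \<lfloor>real (Suc n) * \<kappa>\<rfloor>)) \<longlonglongrightarrow> (case p of (t, \<kappa>) \<Rightarrow> indicator {0..} t *\<^sub>R char (u t) \<kappa>)"
    unfolding p prod.case
  proof (cases "t \<ge> 0")
    case True
    show "(\<lambda>n. indicator {0..} t *\<^sub>R char (u t) (?k n \<lfloor>real (Suc n) * \<kappa>\<rfloor>)) \<longlonglongrightarrow> indicator {0..} t *\<^sub>R char (u t) \<kappa>"
      by (rule tendsto_scaleR[OF tendsto_const char_evolution_regular(2)[OF True lim]])
  qed simp
qed

lemma fourier_laplace_eq_laplace: "fourier_laplace u \<kappa> s = laplace (\<lambda>t. char (u t) \<kappa>) s"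
  by (simp add: fourier_laplace_def laplace_def gf_laplace_def gf_of_fun_def mult.commute)

lemma mass_dominates:
  assumes "s > 0"
  shows "\<exists>w. integrable lborel w \<and> (\<forall>t::real. 0 \<le> w t) \<and> (\<forall>t \<kappa>. norm (indicator {0..} t *\<^sub>R (char (u t) \<kappa> * of_real (exp (- s * t)))) \<le> w t)"
proof -
  obtain C where C: "\<And>t. t \<ge> 0 \<Longrightarrow> measure (u t) UNIV \<le> C * exp (s / 2 * t)"
    using evolution_mass[of "s / 2"] assms by auto
  have C0: "C \<ge> 0" using order_trans[OF measure_nonneg C[of 0]] by simp
  let ?w = "\<lambda>t. C * (indicator {0..} t *\<^sub>R exp (- (s / 2 * t)))"
  have "integrable lborel ?w"
    using set_integrable_exp_neg[of "s / 2"] assms by (intro integrable_mult_right) (simp add: set_integrable_def)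
  moreover have "norm (indicator {0..} t *\<^sub>R (char (u t) \<kappa> * of_real (exp (- s * t)))) \<le> ?w t" for t \<kappa>
    using laplace_integrand_bound[of "\<lambda>t. char (u t) \<kappa>" C s t, OF order_trans[OF char_evolution_bound C]]
    by (simp add: scaleR_conv_of_real mult.commute)
  ultimately show ?thesis using C0 by (intro exI[of _ ?w]) simp
qed

lemma fourier_laplace_bounded:
  assumes "s > 0" shows "\<exists>K. \<forall>\<kappa>. norm (fourier_laplace u \<kappa> s) \<le> K"
proof -
  obtain w where w: "integrable lborel w" "\<And>t \<kappa>. norm (indicator {0..} t *\<^sub>R (char (u t) \<kappa> * of_real (exp (- s * t)))) \<le> w t"
    using mass_dominates[OF assms] by blast
  have "norm (fourier_laplace u \<kappa> s) \<le> (LINT t|lborel. w t)" for \<kappa>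
    unfolding fourier_laplace_eq_laplace laplace_eq
    by (rule Bochner_Integration.integral_norm_bound_integral[OF _ w(1)])
       (use w(2) laplace_integrable_set_integrable[OF laplace_integrable_continuous[OF char_evolution] assms] in auto)
  then show ?thesis by blast
qed

lemma fourier_laplace_continuous:
  assumes s: "s > 0" shows "continuous_on UNIV (\<lambda>\<kappa>. fourier_laplace u \<kappa> s)"
  unfolding continuous_on_sequentially comp_def
proof (intro ballI allI impI, elim conjE)
  fix X and \<kappa> :: real assume X: "X \<longlonglongrightarrow> \<kappa>"
  obtain w where w: "integrable lborel w" "\<And>t \<kappa>. norm (indicator {0..} t *\<^sub>R (char (u t) \<kappa> * of_real (exp (- s * t)))) \<le> w t"
    using mass_dominates[OF s] by blast
  show "(\<lambda>n. fourier_laplace u (X n) s) \<longlonglongrightarrow> fourier_laplace u \<kappa> s"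
    unfolding fourier_laplace_eq_laplace laplace_eq
  proof (rule integral_dominated_convergence[where w = w])
    show "AE t in lborel. (\<lambda>n. indicator {0..} t *\<^sub>R (char (u t) (X n) * of_real (exp (- s * t)))) \<longlonglongrightarrow> indicator {0..} t *\<^sub>R (char (u t) \<kappa> * of_real (exp (- s * t)))"
    proof (rule AE_I2)
      fix t :: real
      show "(\<lambda>n. indicator {0..} t *\<^sub>R (char (u t) (X n) * of_real (exp (- s * t)))) \<longlonglongrightarrow> indicator {0..} t *\<^sub>R (char (u t) \<kappa> * of_real (exp (- s * t)))"
      proof (cases "t \<ge> 0")
        case True
        show ?thesis
          by (intro tendsto_scaleR tendsto_mult tendsto_const char_evolution_regular(2)[OF True X])
      qed simp
    qed
    show "(\<lambda>t. indicator {0..} t *\<^sub>R (char (u t) \<kappa> * of_real (exp (- s * t)))) \<in> borel_measurable lborel" for \<kappa>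
      using laplace_integrable_set_integrable[OF laplace_integrable_continuous[OF char_evolution] s] by auto
    then show "(\<lambda>t. indicator {0..} t *\<^sub>R (char (u t) (X n) * of_real (exp (- s * t)))) \<in> borel_measurable lborel" for n .
  qed (use w in auto)
qed

text \<open>Schwartz functions and their Riesz transforms are superpositions of plane waves, so their
  pairings with \<open>u\<close> are mixtures of characteristic functions.\<close>

lemma laplace_char_mixture:
  fixes F :: "real \<Rightarrow> complex"
  assumes F: "integrable lborel F" and s: "s > 0"
  shows "laplace (\<lambda>t. LINT \<kappa>|lborel. F \<kappa> * char (u t) (- \<kappa>)) s = (LINT \<kappa>|lborel. F \<kappa> * fourier_laplace u (- \<kappa>) s)"
proof -
  define c where "c = (\<lambda>t \<kappa>. indicator {0..} t *\<^sub>R (char (u t) \<kappa> * of_real (exp (- s * t))))"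
  obtain w where w: "integrable lborel w" "\<And>t. 0 \<le> w t" "\<And>t \<kappa>. norm (c t \<kappa>) \<le> w t"
    using mass_dominates[OF s] unfolding c_def by blast
  have c_meas: "(\<lambda>(t, \<kappa>). c t \<kappa>) \<in> borel_measurable (borel \<Otimes>\<^sub>M borel)"
  proof -
    have "(\<lambda>(t, \<kappa>). c t \<kappa>) = (\<lambda>p. (case p of (t, \<kappa>) \<Rightarrow> indicator {0..} t *\<^sub>R char (u t) \<kappa>) * of_real (exp (- s * fst p)))"
      by (auto simp: c_def fun_eq_iff)
    then show ?thesis using char_evolution_measurable by simp
  qed
  have [measurable]: "F \<in> borel_measurable borel" using F by auto
  have c'_meas: "(\<lambda>p. c (fst p) (- snd p)) \<in> borel_measurable (borel \<Otimes>\<^sub>M borel)"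
    using measurable_compose[OF _ c_meas, of "\<lambda>p. (fst p, - snd p)" "borel \<Otimes>\<^sub>M borel"] by simp
  have meas: "(\<lambda>(t, \<kappa>). F \<kappa> * c t (- \<kappa>)) \<in> borel_measurable (lborel \<Otimes>\<^sub>M lborel)"
    using c'_meas by (simp add: case_prod_unfold)
  have norm_le: "norm (F \<kappa> * c t (- \<kappa>)) \<le> norm (F \<kappa>) * w t" for t \<kappa>
    unfolding norm_mult by (intro mult_left_mono w) simp
  have c_meas1: "(\<lambda>\<kappa>. c t (- \<kappa>)) \<in> borel_measurable borel" for t
    using measurable_compose[OF _ c'_meas, of "\<lambda>\<kappa>. (t, \<kappa>)" borel] by simp
  have int1: "integrable lborel (\<lambda>\<kappa>. F \<kappa> * c t (- \<kappa>))" for t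
    using norm_le[of _ t] c_meas1[of t] w(2)
    by (intro Bochner_Integration.integrable_bound[OF integrable_mult_left[OF integrable_norm[OF F], of "w t"]])
       (auto simp: abs_mult)
  have int: "integrable (lborel \<Otimes>\<^sub>M lborel) (\<lambda>(t, \<kappa>). F \<kappa> * c t (- \<kappa>))"
  proof (rule lborel_pair.Fubini_integrable[OF meas])
    show "integrable lborel (\<lambda>t. LINT \<kappa>|lborel. norm (case (t, \<kappa>) of (t, \<kappa>) \<Rightarrow> F \<kappa> * c t (- \<kappa>)))"
    proof (rule Bochner_Integration.integrable_bound[OF integrable_mult_right[OF w(1), of "LINT \<kappa>|lborel. norm (F \<kappa>)"]])
      show "(\<lambda>t. LINT \<kappa>|lborel. norm (case (t, \<kappa>) of (t, \<kappa>) \<Rightarrow> F \<kappa> * c t (- \<kappa>))) \<in> borel_measurable lborel"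
        using meas by measurable
      show "AE t in lborel. norm (LINT \<kappa>|lborel. norm (case (t, \<kappa>) of (t, \<kappa>) \<Rightarrow> F \<kappa> * c t (- \<kappa>))) \<le> norm ((LINT \<kappa>|lborel. norm (F \<kappa>)) * w t)"
      proof (rule AE_I2)
        fix t
        have "(LINT \<kappa>|lborel. norm (F \<kappa> * c t (- \<kappa>))) \<le> (LINT \<kappa>|lborel. norm (F \<kappa>) * w t)"
          by (intro integral_mono integrable_norm int1 integrable_mult_left F norm_le)
        also have "\<dots> = (LINT \<kappa>|lborel. norm (F \<kappa>)) * w t" by simp
        finally show "norm (LINT \<kappa>|lborel. norm (case (t, \<kappa>) of (t, \<kappa>) \<Rightarrow> F \<kappa> * c t (- \<kappa>))) \<le> norm ((LINT \<kappa>|lborel. norm (F \<kappa>)) * w t)"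
          using w(2)[of t] by (simp add: abs_mult)
      qed
    qed
    show "AE t in lborel. integrable lborel (\<lambda>\<kappa>. case (t, \<kappa>) of (t, \<kappa>) \<Rightarrow> F \<kappa> * c t (- \<kappa>))"
      using int1 by simp
  qed
  have "laplace (\<lambda>t. LINT \<kappa>|lborel. F \<kappa> * char (u t) (- \<kappa>)) s = (LINT t|lborel. LINT \<kappa>|lborel. F \<kappa> * c t (- \<kappa>))"
    unfolding laplace_eq
  proof (rule Bochner_Integration.integral_cong[OF refl])
    fix t :: real
    have "(LINT \<kappa>|lborel. F \<kappa> * c t (- \<kappa>)) = (LINT \<kappa>|lborel. (indicator {0..} t *\<^sub>R of_real (exp (- s * t))) * (F \<kappa> * char (u t) (- \<kappa>)))"
      by (rule Bochner_Integration.integral_cong[OF refl]) (simp add: c_def mult_ac)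
    also have "\<dots> = indicator {0..} t *\<^sub>R ((LINT \<kappa>|lborel. F \<kappa> * char (u t) (- \<kappa>)) * of_real (exp (- s * t)))"
      by (simp only: integral_mult_right_zero) (simp add: mult.commute)
    finally show "indicator {0..} t *\<^sub>R ((LINT \<kappa>|lborel. F \<kappa> * char (u t) (- \<kappa>)) * of_real (exp (- s * t))) = (LINT \<kappa>|lborel. F \<kappa> * c t (- \<kappa>))" ..
  qed
  also have "\<dots> = (LINT \<kappa>|lborel. LINT t|lborel. F \<kappa> * c t (- \<kappa>))"
    by (rule lborel_pair.Fubini_integral[symmetric, OF int])
  also have "\<dots> = (LINT \<kappa>|lborel. F \<kappa> * fourier_laplace u (- \<kappa>) s)"
    by (simp only: integral_mult_right_zero fourier_laplace_eq_laplace laplace_eq c_def)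
  finally show ?thesis .
qed

end

section \<open>The limit equation tested with Schwartz functions\<close>

lemma limit_equation_defect_growth:
  fixes U :: "real \<Rightarrow> complex"
  assumes K: "\<And>\<kappa>. norm (U \<kappa>) \<le> K" and a: "0 \<le> a" "a \<le> 2"
  shows "norm (A * (B * U \<kappa> - 1) + of_real (\<bar>\<kappa>\<bar> powr a) * U \<kappa>) \<le> (norm A * (norm B * K + 1) + 2 * K) * exp \<bar>\<kappa>\<bar>"
proof -
  have K0: "K \<ge> 0" using K[of 0] by (simp add: order_trans[OF norm_ge_zero])
  have e1: "1 \<le> exp \<bar>\<kappa>\<bar>" by simp
  have "\<bar>\<kappa>\<bar> powr a \<le> 1 + \<kappa>\<^sup>2"
    using powr_le_1_plus_square[of "\<bar>\<kappa>\<bar>" a] a by simp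
  also have "\<dots> \<le> 2 * exp \<bar>\<kappa>\<bar>"
    using exp_lower_Taylor_quadratic[of "\<bar>\<kappa>\<bar>"] abs_ge_zero[of \<kappa>] unfolding power2_abs by linarith
  finally have p: "\<bar>\<kappa>\<bar> powr a * norm (U \<kappa>) \<le> (2 * exp \<bar>\<kappa>\<bar>) * K"
    using K[of \<kappa>] by (intro mult_mono) auto
  have "norm (A * (B * U \<kappa> - 1)) \<le> norm A * (norm B * K + 1)"
  proof -
    have "norm (B * U \<kappa> - 1) \<le> norm B * norm (U \<kappa>) + 1"
      using norm_triangle_ineq4[of "B * U \<kappa>" 1] by (simp add: norm_mult)
    also have "\<dots> \<le> norm B * K + 1" using K[of \<kappa>] by (simp add: mult_left_mono)
    finally show ?thesis by (simp add: norm_mult mult_left_mono)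
  qed
  also have "\<dots> \<le> norm A * (norm B * K + 1) * exp \<bar>\<kappa>\<bar>"
    using mult_left_mono[OF e1, of "norm A * (norm B * K + 1)"] K0 by simp
  finally have "norm (A * (B * U \<kappa> - 1)) \<le> norm A * (norm B * K + 1) * exp \<bar>\<kappa>\<bar>" .
  moreover have "norm (of_real (\<bar>\<kappa>\<bar> powr a) * U \<kappa>) \<le> 2 * K * exp \<bar>\<kappa>\<bar>"
    using p by (simp add: norm_mult mult_ac)
  ultimately show ?thesis
    using norm_triangle_ineq[of "A * (B * U \<kappa> - 1)" "of_real (\<bar>\<kappa>\<bar> powr a) * U \<kappa>"]
    by (simp add: distrib_right)
qed

lemma schwartz_bounded:
  assumes "schwartz \<psi>" shows "\<exists>B. \<forall>x. norm (\<psi> x) \<le> B"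
  using assms unfolding schwartz_def bounded_iff
  by (metis (no_types, lifting) nth_deriv_0 power_0 rangeI scaleR_one)

lemma riesz_bounded_continuous:
  assumes \<psi>: "schwartz \<psi>" and a: "0 \<le> \<alpha>" "\<alpha> \<le> 2"
  shows "continuous_on UNIV (riesz \<alpha> \<psi>)" "\<exists>B. \<forall>x. norm (riesz \<alpha> \<psi> x) \<le> B"
proof -
  have F: "integrable lborel (\<lambda>\<kappa>. - (of_real (\<bar>\<kappa>\<bar> powr \<alpha>) * fourier \<psi> \<kappa>) / of_real (2 * pi))"
    using integrable_powr_fourier[OF assms] by (intro integrable_divide integrable_minus)
  show "continuous_on UNIV (riesz \<alpha> \<psi>)"
    unfolding riesz_eq_fourier_integral by (rule continuous_on_fourier_integral[OF F])
  have "norm (riesz \<alpha> \<psi> x) \<le> (LINT \<kappa>|lborel. norm (- (of_real (\<bar>\<kappa>\<bar> powr \<alpha>) * fourier \<psi> \<kappa>) / of_real (2 * pi)))" for x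
  proof -
    have "norm (riesz \<alpha> \<psi> x) \<le> (LINT \<kappa>|lborel. norm (iexp (- (\<kappa> * x)) * (- (of_real (\<bar>\<kappa>\<bar> powr \<alpha>) * fourier \<psi> \<kappa>) / of_real (2 * pi))))"
      unfolding riesz_eq_fourier_integral by (rule integral_norm_bound)
    then show ?thesis by (simp only: norm_mult norm_exp_i_times mult_1_left)
  qed
  then show "\<exists>B. \<forall>x. norm (riesz \<alpha> \<psi> x) \<le> B" by blast
qed

context
  fixes u :: "real \<Rightarrow> real measure" and \<alpha> :: real
  assumes u: "density_evolution u" and \<alpha>_pos: "0 < \<alpha>" and \<alpha>_le: "\<alpha> \<le> 2"
begin

lemmas \<alpha> = less_imp_le[OF \<alpha>_pos] \<alpha>_le

lemma pairing_regular:
  assumes "schwartz \<psi>"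
  shows "continuous_on {0..} (pairing u \<psi>)" "subexponential (pairing u \<psi>)"
    "continuous_on {0..} (pairing u (riesz \<alpha> \<psi>))" "subexponential (pairing u (riesz \<alpha> \<psi>))"
proof -
  obtain B where B: "\<And>x. norm (\<psi> x) \<le> B" using schwartz_bounded[OF assms] by blast
  obtain B' where B': "\<And>x. norm (riesz \<alpha> \<psi> x) \<le> B'" using riesz_bounded_continuous(2)[OF assms \<alpha>] by blast
  note c = schwartz_continuous[OF assms, of UNIV] and c' = riesz_bounded_continuous(1)[OF assms \<alpha>]
  show "continuous_on {0..} (pairing u \<psi>)" "continuous_on {0..} (pairing u (riesz \<alpha> \<psi>))"
    unfolding pairing_def[abs_def]
    by (rule evolution_integral_continuous[OF u c B] evolution_integral_continuous[OF u c' B'])+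
  show "subexponential (pairing u \<psi>)" "subexponential (pairing u (riesz \<alpha> \<psi>))"
    unfolding pairing_def[abs_def]
    by (rule evolution_integral_subexponential[OF u borel_measurable_continuous_onI[OF c] B]
        evolution_integral_subexponential[OF u borel_measurable_continuous_onI[OF c'] B'])+
qed

lemma pairing_laplace_integrable:
  assumes "schwartz \<psi>"
  shows "laplace_integrable (pairing u \<psi>)" "laplace_integrable (pairing u (riesz \<alpha> \<psi>))"
  using pairing_regular[OF assms] by (auto intro: laplace_integrable_continuous)

lemma laplace_cong_nonneg:
  assumes "\<And>t. t \<ge> 0 \<Longrightarrow> f t = g t" shows "laplace f s = laplace g s"
  unfolding laplace_eq by (rule Bochner_Integration.integral_cong) (use assms in \<open>auto simp: indicator_def\<close>)

lemma laplace_fourier_pairing: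
  assumes F: "integrable lborel F" and s: "s > 0"
  shows "laplace (pairing u (\<lambda>x. LINT \<kappa>|lborel. iexp (- (\<kappa> * x)) * F \<kappa>)) s = (LINT \<kappa>|lborel. F \<kappa> * fourier_laplace u (- \<kappa>) s)"
proof -
  have "laplace (pairing u (\<lambda>x. LINT \<kappa>|lborel. iexp (- (\<kappa> * x)) * F \<kappa>)) s = laplace (\<lambda>t. LINT \<kappa>|lborel. F \<kappa> * char (u t) (- \<kappa>)) s"
    unfolding pairing_def
    by (rule laplace_cong_nonneg) (rule integral_fourier_integral[OF evolution_measure[OF u] F])
  then show ?thesis by (simp only: laplace_char_mixture[OF u F s])
qed

text \<open>The coefficient \<open>A\<close> stands for the memory factor at \<open>s\<close>.  All three terms are plane wave
  expansions, of \<open>\<psi>\<close>, of \<open>\<psi> 0\<close> and of the Riesz transform; the factor \<open>2 * pi\<close> is the one of the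
  inversion formula.\<close>

lemma tested_equation_defect:
  assumes \<psi>: "schwartz \<psi>" and s: "s > 0"
  shows "of_real (2 * pi) * (A * (of_real s * laplace (pairing u \<psi>) s - \<psi> 0) - laplace (pairing u (riesz \<alpha> \<psi>)) s) =
    (LINT \<kappa>|lborel. fourier \<psi> \<kappa> * (A * (of_real s * fourier_laplace u (- \<kappa>) s - 1) + of_real (\<bar>\<kappa>\<bar> powr \<alpha>) * fourier_laplace u (- \<kappa>) s))"
proof -
  let ?U = "\<lambda>\<kappa>. fourier_laplace u (- \<kappa>) s"
  obtain K where K: "\<And>\<kappa>. norm (?U \<kappa>) \<le> K" using fourier_laplace_bounded[OF u s] by blast
  have U_meas: "?U \<in> borel_measurable borel"
    by (rule measurable_compose[OF _ borel_measurable_continuous_onI[OF fourier_laplace_continuous[OF u s]]]) simp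
  have times_U: "integrable lborel (\<lambda>\<kappa>. F \<kappa> * ?U \<kappa>)" if F: "integrable lborel F" for F
  proof (rule Bochner_Integration.integrable_bound[OF integrable_mult_right[OF F, of "of_real K"]])
    show "AE \<kappa> in lborel. norm (F \<kappa> * ?U \<kappa>) \<le> norm (of_real K * F \<kappa>)"
    proof (rule AE_I2)
      fix \<kappa>
      have "norm (F \<kappa>) * norm (?U \<kappa>) \<le> norm (F \<kappa>) * \<bar>K\<bar>"
        by (intro mult_left_mono order_trans[OF K abs_ge_self]) simp
      then show "norm (F \<kappa> * ?U \<kappa>) \<le> norm (of_real K * F \<kappa>)" by (simp add: norm_mult mult.commute)
    qed
  qed (use U_meas F in auto)
  note f = integrable_fourier[OF \<psi>] and pf = integrable_powr_fourier[OF \<psi> \<alpha>]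
  have fd: "integrable lborel (\<lambda>\<kappa>. fourier \<psi> \<kappa> / of_real (2 * pi))" by (intro integrable_divide f)
  have pd: "integrable lborel (\<lambda>\<kappa>. - (of_real (\<bar>\<kappa>\<bar> powr \<alpha>) * fourier \<psi> \<kappa>) / of_real (2 * pi))"
    by (intro integrable_divide integrable_minus pf)
  have "laplace (pairing u \<psi>) s = (LINT \<kappa>|lborel. fourier \<psi> \<kappa> / of_real (2 * pi) * ?U \<kappa>)"
    by (subst schwartz_eq_fourier_integral[OF \<psi>]) (rule laplace_fourier_pairing[OF fd s])
  then have L1: "of_real (2 * pi) * laplace (pairing u \<psi>) s = (LINT \<kappa>|lborel. fourier \<psi> \<kappa> * ?U \<kappa>)"
    by (simp only: times_divide_eq_left integral_divide_zero) simp
  have "laplace (pairing u (riesz \<alpha> \<psi>)) s = (LINT \<kappa>|lborel. - (of_real (\<bar>\<kappa>\<bar> powr \<alpha>) * fourier \<psi> \<kappa>) / of_real (2 * pi) * ?U \<kappa>)"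
    unfolding riesz_eq_fourier_integral by (rule laplace_fourier_pairing[OF pd s])
  then have L2: "of_real (2 * pi) * laplace (pairing u (riesz \<alpha> \<psi>)) s = - (LINT \<kappa>|lborel. of_real (\<bar>\<kappa>\<bar> powr \<alpha>) * fourier \<psi> \<kappa> * ?U \<kappa>)"
    by (simp only: times_divide_eq_left integral_divide_zero mult_minus_left integral_minus) simp
  have i1: "integrable lborel (\<lambda>\<kappa>. A * of_real s * (fourier \<psi> \<kappa> * ?U \<kappa>))"
    and i2: "integrable lborel (\<lambda>\<kappa>. A * fourier \<psi> \<kappa>)"
    by (intro integrable_mult_right times_U f)+
  have L0: "of_real (2 * pi) * \<psi> 0 = (LINT \<kappa>|lborel. fourier \<psi> \<kappa>)"
    using fourier_inversion[OF \<psi>, of 0] by simp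
  have "of_real (2 * pi) * (A * (of_real s * laplace (pairing u \<psi>) s - \<psi> 0) - laplace (pairing u (riesz \<alpha> \<psi>)) s) =
      A * of_real s * (of_real (2 * pi) * laplace (pairing u \<psi>) s) - A * (of_real (2 * pi) * \<psi> 0) - of_real (2 * pi) * laplace (pairing u (riesz \<alpha> \<psi>)) s"
    by (simp add: algebra_simps)
  also have "\<dots> = A * of_real s * (LINT \<kappa>|lborel. fourier \<psi> \<kappa> * ?U \<kappa>) - A * (LINT \<kappa>|lborel. fourier \<psi> \<kappa>)
      + (LINT \<kappa>|lborel. of_real (\<bar>\<kappa>\<bar> powr \<alpha>) * fourier \<psi> \<kappa> * ?U \<kappa>)"
    unfolding L0 L1 L2 by simp
  also have "\<dots> = (LINT \<kappa>|lborel. A * of_real s * (fourier \<psi> \<kappa> * ?U \<kappa>) - A * fourier \<psi> \<kappa> + of_real (\<bar>\<kappa>\<bar> powr \<alpha>) * fourier \<psi> \<kappa> * ?U \<kappa>)"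
    by (simp only: Bochner_Integration.integral_add[OF Bochner_Integration.integrable_diff[OF i1 i2] times_U[OF pf]]
        Bochner_Integration.integral_diff[OF i1 i2] integral_mult_right_zero)
  also have "\<dots> = (LINT \<kappa>|lborel. fourier \<psi> \<kappa> * (A * (of_real s * ?U \<kappa> - 1) + of_real (\<bar>\<kappa>\<bar> powr \<alpha>) * ?U \<kappa>))"
    by (rule Bochner_Integration.integral_cong[OF refl]) (simp add: algebra_simps)
  finally show ?thesis .
qed

text \<open>The defect \<open>D\<close> of the limit equation is continuous in the frequency and of at most exponential
  growth.  Gaussian test functions have normal densities as Fourier transforms, so the
  averages of \<open>D\<close> around any frequency vanish, and so does \<open>D\<close>.\<close>

lemma limit_equation_iff_tested:
  assumes s: "s > 0"
  shows "(\<forall>\<kappa>. limit_equation Hs \<alpha> \<kappa> s (fourier_laplace u \<kappa> s)) \<longleftrightarrow>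
    (\<forall>\<psi>. schwartz \<psi> \<longrightarrow> of_real (Hs s) * (of_real s * laplace (pairing u \<psi>) s - \<psi> 0) = laplace (pairing u (riesz \<alpha> \<psi>)) s)"
    (is "?L \<longleftrightarrow> ?R")
proof -
  define D where "D = (\<lambda>\<kappa>. of_real (Hs s) * (of_real s * fourier_laplace u (- \<kappa>) s - 1) + of_real (\<bar>\<kappa>\<bar> powr \<alpha>) * fourier_laplace u (- \<kappa>) s)"
  have L: "?L \<longleftrightarrow> (\<forall>\<kappa>. D \<kappa> = 0)"
  proof -
    have "limit_equation Hs \<alpha> \<kappa> s (fourier_laplace u \<kappa> s) \<longleftrightarrow> D (- \<kappa>) = 0" for \<kappa>
      by (simp add: limit_equation_def D_def eq_neg_iff_add_eq_0)
    then show ?thesis by (metis minus_minus)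
  qed
  have R: "?R \<longleftrightarrow> (\<forall>\<psi>. schwartz \<psi> \<longrightarrow> (LINT \<kappa>|lborel. fourier \<psi> \<kappa> * D \<kappa>) = 0)"
    unfolding D_def using tested_equation_defect[OF _ s, of _ "of_real (Hs s)", symmetric] by auto
  have "D m = 0" if zero: "\<And>\<psi>. schwartz \<psi> \<Longrightarrow> (LINT \<kappa>|lborel. fourier \<psi> \<kappa> * D \<kappa>) = 0" for m
  proof -
    have U_cont: "continuous_on UNIV (\<lambda>\<kappa>. fourier_laplace u (- \<kappa>) s)"
      by (rule continuous_on_compose2[OF fourier_laplace_continuous[OF u s]]) (auto intro!: continuous_intros)
    have "continuous_on UNIV (\<lambda>\<kappa>::real. \<bar>\<kappa>\<bar> powr \<alpha>)"
      using \<alpha>_pos by (intro continuous_on_powr' continuous_intros) auto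
    then have D_cont: "continuous_on UNIV D"
      unfolding D_def
      by (intro continuous_on_add continuous_on_mult continuous_on_diff continuous_on_of_real continuous_on_const U_cont)
    obtain K where K: "\<And>\<kappa>. norm (fourier_laplace u (- \<kappa>) s) \<le> K" using fourier_laplace_bounded[OF u s] by blast
    have lim: "(\<lambda>n. LINT \<kappa>|lborel. D \<kappa> * of_real (normal_density m (1 / real (Suc n)) \<kappa>)) \<longlonglongrightarrow> D m"
    proof (rule normal_density_approx_identity)
      show "D \<in> borel_measurable borel" by (rule borel_measurable_continuous_onI[OF D_cont])
      show "isCont D m" using D_cont by (simp add: continuous_on_eq_continuous_at)
      show "norm (D \<kappa>) \<le> (norm (complex_of_real (Hs s)) * (norm (complex_of_real s) * K + 1) + 2 * K) * exp \<bar>\<kappa>\<bar>" for \<kappa>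
        unfolding D_def by (rule limit_equation_defect_growth[OF K \<alpha>])
    qed
    have "(LINT \<kappa>|lborel. D \<kappa> * of_real (normal_density m \<sigma> \<kappa>)) = 0" if \<sigma>: "\<sigma> > 0" for \<sigma>
    proof -
      \<comment> \<open>Its Fourier transform is \<open>2 * pi\<close> times the normal density at \<open>m\<close> with deviation \<open>\<sigma>\<close>.\<close>
      define \<psi> where "\<psi> = (\<lambda>x::real. exp ((- \<i> * of_real m) * of_real x - of_real (\<sigma>\<^sup>2 * x\<^sup>2 / 2)))"
      have \<psi>: "schwartz \<psi>" unfolding \<psi>_def using \<sigma> by (intro schwartz_gaussian) simp
      have "fourier \<psi> \<kappa> = of_real (2 * pi * normal_density m \<sigma> \<kappa>)" for \<kappa>
      proof -
        have "fourier \<psi> \<kappa> = (LINT x|lborel. iexp ((\<kappa> - m) * x) * of_real (exp (- (\<sigma>\<^sup>2 * x\<^sup>2 / 2))))"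
          unfolding fourier_def \<psi>_def
          by (rule Bochner_Integration.integral_cong[OF refl])
             (simp add: exp_of_real[symmetric] exp_add[symmetric] algebra_simps)
        also have "\<dots> = of_real (2 * pi * normal_density 0 \<sigma> (\<kappa> - m))" by (rule fourier_gaussian[OF \<sigma>])
        finally show ?thesis by (simp add: normal_density_def)
      qed
      then have "(LINT \<kappa>|lborel. of_real (2 * pi) * (D \<kappa> * of_real (normal_density m \<sigma> \<kappa>))) = 0"
        using zero[OF \<psi>] by (simp add: mult_ac)
      then show ?thesis by (simp only: integral_mult_right_zero) simp
    qed
    then show ?thesis using lim LIMSEQ_unique[OF _ tendsto_const] by simp
  qed
  then show ?thesis unfolding L R by auto
qed

text \<open>The limit equation gives \<open>s * U = s H / (s H + \<bar>\<kappa>\<bar> powr \<alpha>)\<close>, which tends to \<open>1\<close>, while the initial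
  value theorem identifies the limit as the characteristic function of \<open>u 0\<close>.\<close>

lemma limit_equation_imp_initial:
  assumes Hs: "\<And>s. s > 0 \<Longrightarrow> Hs s > 0" "filterlim (\<lambda>s. s * Hs s) at_top at_top"
    and eq: "\<And>\<kappa> s. s > 0 \<Longrightarrow> limit_equation Hs \<alpha> \<kappa> s (fourier_laplace u \<kappa> s)"
  shows "u 0 = return borel 0"
proof -
  interpret finite_measure "u 0" by (rule evolution_measure[OF u]) simp
  have sets0: "sets (u 0) = sets borel" by (rule evolution_measure[OF u]) simp
  have space0: "space (u 0) = UNIV" using sets_eq_imp_space_eq[OF sets0] by simp
  have char1: "char (u 0) \<kappa> = 1" for \<kappa>
  proof -
    let ?k = "\<bar>\<kappa>\<bar> powr \<alpha>"
    have 1: "((\<lambda>s. of_real s * laplace (\<lambda>t. char (u t) \<kappa>) s) \<longlongrightarrow> char (u 0) \<kappa>) at_top"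
      by (rule laplace_initial_value[OF char_evolution[OF u]])
    have "filterlim (\<lambda>s. ?k + s * Hs s) at_top at_top"
      by (rule filterlim_tendsto_add_at_top[OF tendsto_const Hs(2)])
    then have "((\<lambda>s. 1 - ?k / (?k + s * Hs s)) \<longlongrightarrow> 1 - 0) at_top"
      by (intro tendsto_diff tendsto_const real_tendsto_divide_at_top[OF tendsto_const])
    then have 2: "((\<lambda>s. complex_of_real (1 - ?k / (?k + s * Hs s))) \<longlongrightarrow> complex_of_real (1 - 0)) at_top"
      by (rule tendsto_of_real)
    have "\<forall>\<^sub>F s in at_top. complex_of_real (1 - ?k / (?k + s * Hs s)) = of_real s * laplace (\<lambda>t. char (u t) \<kappa>) s"
      using eventually_gt_at_top[of 0]
    proof eventually_elim
      case (elim s)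
      define U where "U = fourier_laplace u \<kappa> s"
      have X: "s * Hs s > 0" using Hs(1)[OF elim] elim by simp
      have nz: "?k + s * Hs s \<noteq> 0" using X powr_ge_zero[of "\<bar>\<kappa>\<bar>" \<alpha>] by linarith
      have "of_real (Hs s) * (of_real s * U - 1) = - of_real ?k * U"
        using eq[OF elim, of \<kappa>] by (simp add: limit_equation_def U_def)
      then have "of_real (?k + s * Hs s) * U = of_real (Hs s)"
        by (simp add: algebra_simps)
      then have "of_real (?k + s * Hs s) * (of_real s * U) = of_real (s * Hs s)"
        by (simp add: mult.left_commute[of _ "of_real s"])
      then have "of_real s * U = of_real (s * Hs s) / of_real (?k + s * Hs s)"
        using nz by (intro eq_divide_imp) (simp_all only: of_real_eq_0_iff mult.commute not_False_eq_True)
      also have "\<dots> = complex_of_real (1 - ?k / (?k + s * Hs s))"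
        unfolding of_real_divide[symmetric] using nz by (simp only: of_real_eq_iff) (simp add: field_simps)
      finally show ?case by (simp add: U_def fourier_laplace_eq_laplace[OF u])
    qed
    from Lim_transform_eventually[OF 2 this] have "((\<lambda>s. of_real s * laplace (\<lambda>t. char (u t) \<kappa>) s) \<longlongrightarrow> 1) at_top" by simp
    then show ?thesis using tendsto_unique[OF _ 1] by simp
  qed
  have "complex_of_real (measure (u 0) UNIV) = char (u 0) 0" by (simp add: char_def space0 scaleR_conv_of_real)
  then have "measure (u 0) UNIV = 1" by (simp add: char1)
  then have "prob_space (u 0)" by (intro prob_spaceI) (simp add: emeasure_eq_measure space0)
  then have d0: "real_distribution (u 0)"
    by (simp add: real_distribution_def real_distribution_axioms_def sets0)
  have d: "real_distribution (return borel 0)"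
    by (simp add: real_distribution_def real_distribution_axioms_def prob_space_return)
  have "char (return borel 0) \<kappa> = 1" for \<kappa> :: real
    by (simp add: char_def integral_return)
  then have "char (u 0) = char (return borel 0)" by (simp add: char1 fun_eq_iff)
  then show ?thesis by (rule Levy_uniqueness[OF d0 d])
qed

lemma pairing_initial: "schwartz \<psi> \<Longrightarrow> u 0 = return borel 0 \<Longrightarrow> pairing u \<psi> 0 = \<psi> 0"
  by (simp add: pairing_def integral_return schwartz_measurable)

text \<open>The intermediate form with which both Cauchy problems are compared.\<close>

lemma limit_equation_iff_initial_and_tested:
  assumes Hs: "\<And>s. s > 0 \<Longrightarrow> Hs s > 0" "filterlim (\<lambda>s. s * Hs s) at_top at_top"
  shows "(\<forall>\<kappa>. \<forall>s>0. limit_equation Hs \<alpha> \<kappa> s (fourier_laplace u \<kappa> s)) \<longleftrightarrow>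
    u 0 = return borel 0 \<and>
    (\<forall>\<psi>. schwartz \<psi> \<longrightarrow> (\<forall>s>0. of_real (Hs s) * (of_real s * laplace (pairing u \<psi>) s - pairing u \<psi> 0) = laplace (pairing u (riesz \<alpha> \<psi>)) s))"
    (is "?L \<longleftrightarrow> ?I \<and> ?R")
proof -
  have "?L \<longleftrightarrow> ?R" if ?I
  proof -
    have "?L \<longleftrightarrow> (\<forall>s>0. \<forall>\<kappa>. limit_equation Hs \<alpha> \<kappa> s (fourier_laplace u \<kappa> s))" by blast
    also have "\<dots> \<longleftrightarrow> (\<forall>s>0. \<forall>\<psi>. schwartz \<psi> \<longrightarrow>
        of_real (Hs s) * (of_real s * laplace (pairing u \<psi>) s - \<psi> 0) = laplace (pairing u (riesz \<alpha> \<psi>)) s)"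
      using limit_equation_iff_tested[of _ Hs] by simp
    also have "\<dots> \<longleftrightarrow> ?R" using pairing_initial[OF _ that] by auto
    finally show ?thesis .
  qed
  moreover have "?L \<Longrightarrow> ?I" by (rule limit_equation_imp_initial[OF Hs]) auto
  ultimately show ?thesis by blast
qed

text \<open>For fixed \<open>\<psi>\<close>, both sides of the equation with memory are generalized functions of time, so they agree
  exactly if their Laplace transforms do.\<close>

theorem memory_cauchy_problem_iff:
  assumes Hs: "\<And>s. s > 0 \<Longrightarrow> Hs s > 0" "filterlim (\<lambda>s. s * Hs s) at_top at_top"
    and H: "memory_function H Hs"
  shows "memory_cauchy_problem H \<alpha> u \<longleftrightarrow> (\<forall>\<kappa>. \<forall>s>0. limit_equation Hs \<alpha> \<kappa> s (fourier_laplace u \<kappa> s))"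
proof -
  have H_gf: "time_gf H" and H_laplace: "\<And>s. s > 0 \<Longrightarrow> gf_laplace H s = of_real (Hs s)"
    using H by (auto simp: memory_function_def)
  have tested: "(\<forall>\<phi>. time_test \<phi> \<longrightarrow> gf_conv H (gf_deriv (pairing u \<psi>)) \<phi> = gf_of_fun (pairing u (riesz \<alpha> \<psi>)) \<phi>) \<longleftrightarrow>
     (\<forall>s>0. of_real (Hs s) * (of_real s * laplace (pairing u \<psi>) s - pairing u \<psi> 0) = laplace (pairing u (riesz \<alpha> \<psi>)) s)"
    if \<psi>: "schwartz \<psi>" for \<psi>
  proof -
    note int = pairing_laplace_integrable[OF \<psi>]
    note D = time_gf_deriv[OF int(1)]
    have "gf_laplace (gf_conv H (gf_deriv (pairing u \<psi>))) s = of_real (Hs s) * (of_real s * laplace (pairing u \<psi>) s - pairing u \<psi> 0)" if "s > 0" for s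
      using that by (simp add: gf_laplace_conv[OF H_gf D] gf_laplace_deriv[OF int(1)] H_laplace laplace_def)
    then show ?thesis
      by (simp add: time_gf_eq_iff_laplace[OF time_gf_conv[OF H_gf D] time_gf_of_fun[OF int(2)]] laplace_def)
  qed
  have "memory_cauchy_problem H \<alpha> u \<longleftrightarrow> u 0 = return borel 0 \<and> (\<forall>\<psi>. schwartz \<psi> \<longrightarrow>
      (\<forall>\<phi>. time_test \<phi> \<longrightarrow> gf_conv H (gf_deriv (pairing u \<psi>)) \<phi> = gf_of_fun (pairing u (riesz \<alpha> \<psi>)) \<phi>))"
    unfolding memory_cauchy_problem_def by (simp only: conj_commute imp_conjL all_simps)
  also have "\<dots> \<longleftrightarrow> u 0 = return borel 0 \<and> (\<forall>\<psi>. schwartz \<psi> \<longrightarrow>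
      (\<forall>s>0. of_real (Hs s) * (of_real s * laplace (pairing u \<psi>) s - pairing u \<psi> 0) = laplace (pairing u (riesz \<alpha> \<psi>)) s))"
    by (rule conj_cong[OF refl], rule all_cong1, rule imp_cong[OF refl], rule tested)
  also have "\<dots> \<longleftrightarrow> (\<forall>\<kappa>. \<forall>s>0. limit_equation Hs \<alpha> \<kappa> s (fourier_laplace u \<kappa> s))"
    by (rule limit_equation_iff_initial_and_tested[OF Hs, symmetric])
  finally show ?thesis .
qed

end

section \<open>Derivatives on the open half-line\<close>

lemma subexponential_add: "subexponential f \<Longrightarrow> subexponential g \<Longrightarrow> subexponential (\<lambda>t. f t + g t)"
  unfolding subexponential_def
proof (intro allI impI)
  fix c :: real assume *: "\<forall>c>0. \<exists>C. \<forall>t\<ge>0. norm (f t) \<le> C * exp (c * t)" "\<forall>c>0. \<exists>C. \<forall>t\<ge>0. norm (g t) \<le> C * exp (c * t)" and c: "c > 0"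
  then obtain C C' where C: "\<And>t. t \<ge> 0 \<Longrightarrow> norm (f t) \<le> C * exp (c * t)" "\<And>t. t \<ge> 0 \<Longrightarrow> norm (g t) \<le> C' * exp (c * t)" by blast
  have "norm (f t + g t) \<le> (C + C') * exp (c * t)" if "t \<ge> 0" for t
    using C[OF that] norm_triangle_ineq[of "f t" "g t"] by (simp add: distrib_right)
  then show "\<exists>C. \<forall>t\<ge>0. norm (f t + g t) \<le> C * exp (c * t)" by blast
qed

lemma subexponential_cmult: "subexponential f \<Longrightarrow> subexponential (\<lambda>t. a * f t)"
  unfolding subexponential_def
proof (intro allI impI)
  fix c :: real assume *: "\<forall>c>0. \<exists>C. \<forall>t\<ge>0. norm (f t) \<le> C * exp (c * t)" and c: "c > 0"
  then obtain C where C: "\<And>t. t \<ge> 0 \<Longrightarrow> norm (f t) \<le> C * exp (c * t)" by blast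
  have "norm (a * f t) \<le> (norm a * C) * exp (c * t)" if "t \<ge> 0" for t
    using mult_left_mono[OF C[OF that], of "norm a"] by (simp add: norm_mult mult.assoc)
  then show "\<exists>C. \<forall>t\<ge>0. norm (a * f t) \<le> C * exp (c * t)" by blast
qed

lemma subexponential_linear_factor:
  assumes g: "\<And>t. t \<ge> 0 \<Longrightarrow> norm (g t) \<le> (1 + t) * B t"
    and B: "\<And>c. c > 0 \<Longrightarrow> \<exists>C\<ge>0. \<forall>t\<ge>0. B t \<le> C * exp (c * t)"
  shows "subexponential g"
  unfolding subexponential_def
proof (intro allI impI)
  fix c :: real assume c: "c > 0"
  then obtain C where C: "C \<ge> 0" "\<And>t. t \<ge> 0 \<Longrightarrow> B t \<le> C * exp (c / 2 * t)" using B[of "c / 2"] by auto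
  have "norm (g t) \<le> ((1 + 2 / c) * C) * exp (c * t)" if t: "t \<ge> 0" for t
  proof -
    have "1 + t \<le> (1 + 2 / c) * exp (c / 2 * t)"
    proof -
      have "1 + c / 2 * t \<le> exp (c / 2 * t)" by simp
      then have "2 / c * (1 + c / 2 * t) \<le> 2 / c * exp (c / 2 * t)" using c by (intro mult_left_mono) auto
      moreover have "2 / c * (1 + c / 2 * t) = 2 / c + t" using c by (simp add: field_simps)
      moreover have "1 \<le> exp (c / 2 * t)" using c t by simp
      moreover have "2 / c > 0" using c by simp
      ultimately show ?thesis by (simp only: distrib_right mult_1_left)
    qed
    then have "(1 + t) * B t \<le> ((1 + 2 / c) * exp (c / 2 * t)) * (C * exp (c / 2 * t))"
      using C c t by (intro mult_mono' order_trans[OF mult_left_mono[OF C(2)[OF t]] mult_right_mono]) auto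
    also have "\<dots> = ((1 + 2 / c) * C) * (exp (c / 2 * t) * exp (c / 2 * t))" by (simp only: mult_ac)
    also have "exp (c / 2 * t) * exp (c / 2 * t) = exp (c * t)" by (simp flip: exp_add)
    finally show ?thesis using g[OF t] by linarith
  qed
  then show "\<exists>C. \<forall>t\<ge>0. norm (g t) \<le> C * exp (c * t)" by blast
qed

lemma laplace_add:
  assumes "laplace_integrable f" "laplace_integrable g" "s > 0"
  shows "laplace (\<lambda>t. f t + g t) s = laplace f s + laplace g s"
  using laplace_integrable_set_integrable[OF assms(1,3)] laplace_integrable_set_integrable[OF assms(2,3)]
  unfolding laplace_eq by (simp add: distrib_right scaleR_add_right)

lemma laplace_cmult: "laplace (\<lambda>t. a * f t) s = a * laplace f s"
  unfolding laplace_eq by (simp add: mult.assoc mult_scaleR_right[symmetric] del: mult_scaleR_right)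

lemma laplace_integrable_add:
  "laplace_integrable f \<Longrightarrow> laplace_integrable g \<Longrightarrow> laplace_integrable (\<lambda>t. f t + g t)"
  unfolding laplace_integrable_def by (simp add: scaleR_add_right set_integral_add(1))

lemma laplace_integrable_cmult: "laplace_integrable f \<Longrightarrow> laplace_integrable (\<lambda>t. a * f t)"
  unfolding laplace_integrable_def
  by (simp add: mult_scaleR_right[symmetric] set_integrable_mult_right del: mult_scaleR_right)

text \<open>The functional defined by \<open>f\<close> vanishes on all test functions, in particular on Gaussians
  centred at any \<open>t > 0\<close>; continuity settles \<open>t = 0\<close>.\<close>

lemma laplace_unique:
  assumes cont: "continuous_on {0..} f" and growth: "subexponential f"
    and zero: "\<And>s. s > 0 \<Longrightarrow> laplace f s = 0" and t: "t \<ge> 0"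
  shows "f t = 0"
proof -
  define h where "h = (\<lambda>t. indicator {0..} t *\<^sub>R f t)"
  have tests: "gf_of_fun f \<phi> = 0" if "time_test \<phi>" for \<phi>
    using gf_laplace_zero_imp_zero[OF time_gf_of_fun[OF laplace_integrable_continuous[OF cont growth]] _ that] zero
    by (simp add: laplace_def)
  obtain C where C: "\<And>t. t \<ge> 0 \<Longrightarrow> norm (f t) \<le> C * exp (1 * t)"
    using growth unfolding subexponential_def by (meson zero_less_one)
  have C0: "C \<ge> 0" using C[of 0] by (simp add: order_trans[OF norm_ge_zero])
  have pos: "f t = 0" if t: "t > 0" for t
  proof -
    have "continuous_on {0<..} f" by (rule continuous_on_subset[OF cont]) auto
    then have "continuous_on {0<..} h" by (rule continuous_on_eq) (simp add: h_def)
    then have "isCont h t" using t by (simp add: continuous_on_eq_continuous_at)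
    moreover have "norm (h x) \<le> C * exp \<bar>x\<bar>" for x
      using C[of x] C0 by (simp add: h_def indicator_def)
    moreover have "h \<in> borel_measurable borel"
      unfolding h_def by (rule continuous_on_indicator_measurable[OF cont])
    ultimately have lim: "(\<lambda>n. LINT x|lborel. h x * of_real (normal_density t (1 / real (Suc n)) x)) \<longlonglongrightarrow> h t"
      by (intro normal_density_approx_identity)
    have "(LINT x|lborel. h x * of_real (normal_density t \<sigma> x)) = 0" if \<sigma>: "\<sigma> > 0" for \<sigma>
    proof -
      define k where "k = complex_of_real (1 / sqrt (2 * pi * \<sigma>\<^sup>2) * exp (- (t\<^sup>2 / (2 * \<sigma>\<^sup>2))))"
      define G where "G = (\<lambda>x::real. exp (of_real (t / \<sigma>\<^sup>2) * of_real x - of_real (1 / \<sigma>\<^sup>2 * x\<^sup>2 / 2)) :: complex)"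
      have "normal_density t \<sigma> x = 1 / sqrt (2 * pi * \<sigma>\<^sup>2) * exp (- (t\<^sup>2 / (2 * \<sigma>\<^sup>2))) * exp (t / \<sigma>\<^sup>2 * x - 1 / \<sigma>\<^sup>2 * x\<^sup>2 / 2)" for x
      proof -
        have "- (x - t)\<^sup>2 / (2 * \<sigma>\<^sup>2) = - (t\<^sup>2 / (2 * \<sigma>\<^sup>2)) + (t / \<sigma>\<^sup>2 * x - 1 / \<sigma>\<^sup>2 * x\<^sup>2 / 2)"
          using \<sigma> by (simp add: field_simps power2_eq_square)
        then show ?thesis unfolding normal_density_def by (simp only: exp_add mult.assoc)
      qed
      then have nd: "complex_of_real (normal_density t \<sigma> x) = k * G x" for x
        by (simp only: k_def G_def of_real_mult exp_of_real[symmetric] of_real_diff)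
      have "time_test G"
        unfolding time_test_def G_def using \<sigma> by (intro exI[of _ 1] conjI time_test_rate_gaussian) auto
      then have "gf_of_fun f (\<lambda>x. k * G x) = 0" by (intro tests time_test_cmult)
      then show ?thesis
        by (simp add: nd gf_of_fun_def set_lebesgue_integral_def h_def)
    qed
    then have "h t = 0" using lim LIMSEQ_unique[OF _ tendsto_const] by simp
    then show ?thesis using t by (simp add: h_def)
  qed
  show ?thesis
  proof (cases "t > 0")
    case False
    have "(\<lambda>n. f (inverse (real (Suc n)))) \<longlonglongrightarrow> f 0"
      by (rule continuous_on_tendsto_compose[OF cont LIMSEQ_inverse_real_of_nat]) auto
    moreover have "f (inverse (real (Suc n))) = 0" for n by (rule pos) simp
    ultimately have "f 0 = 0" using LIMSEQ_unique[OF _ tendsto_const] by simp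
    then show ?thesis using False t by simp
  qed (rule pos)
qed

text \<open>Partial integration on the open half-line.  The derivative \<open>R\<close> may be singular at \<open>0\<close>, as the
  term with the initial value in the Caputo derivative is.\<close>

lemma laplace_derivative:
  assumes K: "continuous_on {0..} K" "subexponential K"
    and R: "continuous_on {0<..} R" "laplace_integrable R"
    and deriv: "\<And>t. t > 0 \<Longrightarrow> (K has_vector_derivative R t) (at t)" and s: "s > 0"
  shows "of_real s * laplace K s - K 0 = laplace R s"
proof -
  define e where "e = (\<lambda>t. complex_of_real (exp (- s * t)))"
  note intK = laplace_integrable_set_integrable[OF laplace_integrable_continuous[OF K] s]
  note intR = laplace_integrable_set_integrable[OF R(2) s]
  let ?f = "\<lambda>t. R t * e t - of_real s * (K t * e t)"
  have e_deriv: "(e has_vector_derivative - of_real s * e t) (at t)" for t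
    using smooth_has_vector_derivative[OF smooth_exp[of s], of 0 t] unfolding e_def nth_deriv_0
    by (simp only: nth_deriv_exp) simp
  have e_cont: "continuous_on S e" for S unfolding e_def by (intro continuous_intros)
  have line: "einterval 0 \<infinity> = {0::real<..}" by (auto simp: einterval_def)
  have int: "integrable lborel (\<lambda>t. indicator {0..} t *\<^sub>R ?f t)"
  proof -
    have "integrable lborel (\<lambda>t. indicator {0..} t *\<^sub>R (R t * e t) - of_real s * (indicator {0..} t *\<^sub>R (K t * e t)))"
      using intK intR unfolding e_def by (intro Bochner_Integration.integrable_diff integrable_mult_right)
    then show ?thesis by (simp add: scaleR_diff_right)
  qed
  have "(LBINT t=0..\<infinity>. ?f t) = 0 - K 0"
  proof (rule interval_integral_FTC_integrable[where F = "\<lambda>t. K t * e t"])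
    fix t :: real assume "0 < ereal t"
    then have t: "t > 0" by simp
    show "((\<lambda>t. K t * e t) has_vector_derivative ?f t) (at t)"
      using has_vector_derivative_mult[OF deriv[OF t] e_deriv] by (simp add: algebra_simps)
    have "continuous_on {0<..} ?f"
      by (intro continuous_intros R(1) e_cont continuous_on_subset[OF K(1)]) auto
    then show "isCont ?f t" using t by (simp add: continuous_on_eq_continuous_at)
  next
    show "set_integrable lborel (einterval 0 \<infinity>) ?f"
      unfolding line
      by (rule set_integrable_subset[of lborel "{0..}"]) (use int in \<open>auto simp: set_integrable_def\<close>)
    have "(K \<longlongrightarrow> K 0) (at 0 within {0..})"
      using K(1) by (simp add: continuous_on_def)
    then have "(K \<longlongrightarrow> K 0) (at_right 0)" by (rule tendsto_within_subset) auto
    moreover have "(e \<longlongrightarrow> e 0) (at_right 0)"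
      using e_cont[of "{0..}"] by (auto simp: continuous_on_def intro: tendsto_within_subset)
    ultimately have "((\<lambda>t. K t * e t) \<longlongrightarrow> K 0 * e 0) (at_right 0)" by (rule tendsto_mult)
    then show "(((\<lambda>t. K t * e t) \<circ> real_of_ereal) \<longlongrightarrow> K 0) (at_right 0)"
      by (simp add: zero_ereal_def ereal_tendsto_simps e_def)
    obtain C where C: "\<And>t. t \<ge> 0 \<Longrightarrow> norm (K t) \<le> C * exp (s / 2 * t)"
      using K(2) s unfolding subexponential_def by (meson half_gt_zero)
    have "((\<lambda>t. K t * e t) \<longlongrightarrow> 0) at_top"
    proof (rule Lim_null_comparison)
      show "\<forall>\<^sub>F t in at_top. norm (K t * e t) \<le> C * exp (- (s / 2) * t)"
        using eventually_ge_at_top[of 0]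
      proof eventually_elim
        case (elim t)
        have "norm (K t) * exp (- s * t) \<le> (C * exp (s / 2 * t)) * exp (- s * t)"
          by (rule mult_right_mono[OF C[OF elim]]) simp
        also have "\<dots> = C * exp (- (s / 2) * t)" by (simp add: mult.assoc exp_add[symmetric])
        finally show ?case by (simp add: norm_mult e_def)
      qed
      have "((\<lambda>t. exp (- (s / 2) * t)) \<longlongrightarrow> 0) at_top"
        using s by (intro filterlim_compose[OF exp_at_bot] filterlim_tendsto_neg_mult_at_bot[OF tendsto_const])
         (auto simp: filterlim_ident)
      then show "((\<lambda>t. C * exp (- (s / 2) * t)) \<longlongrightarrow> 0) at_top" by (rule tendsto_mult_right_zero)
    qed
    then show "(((\<lambda>t. K t * e t) \<circ> real_of_ereal) \<longlongrightarrow> 0) (at_left \<infinity>)"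
      by (simp add: ereal_tendsto_simps)
  qed simp
  moreover have "(LBINT t=0..\<infinity>. ?f t) = laplace R s - of_real s * laplace K s"
  proof -
    have "(LBINT t=0..\<infinity>. ?f t) = (LINT t|lborel. indicator {0<..} t *\<^sub>R ?f t)"
      by (simp add: interval_lebesgue_integral_def set_lebesgue_integral_def line)
    also have "\<dots> = (LINT t|lborel. indicator {0..} t *\<^sub>R ?f t)"
    proof (rule integral_cong_AE)
      show "AE t in lborel. indicator {0<..} t *\<^sub>R ?f t = indicator {0..} t *\<^sub>R ?f t"
        using AE_lborel_singleton[of 0] by eventually_elim (auto simp: indicator_def)
      have "(\<lambda>t. indicator {0<..} t *\<^sub>R ?f t) = (\<lambda>t. indicator {0<..} t *\<^sub>R (indicator {0..} t *\<^sub>R ?f t))"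
        by (auto simp: indicator_def fun_eq_iff)
      moreover have [measurable]: "(\<lambda>t. indicator {0..} t *\<^sub>R ?f t) \<in> borel_measurable lborel"
        using int by (rule borel_measurable_integrable)
      have "(\<lambda>t. indicator {0<..} t *\<^sub>R (indicator {0..} t *\<^sub>R ?f t)) \<in> borel_measurable lborel"
        by (rule borel_measurable_scaleR) (simp_all del: scaleR_scaleR)
      ultimately show "(\<lambda>t. indicator {0<..} t *\<^sub>R ?f t) \<in> borel_measurable lborel" by (simp only:)
      show "(\<lambda>t. indicator {0..} t *\<^sub>R ?f t) \<in> borel_measurable lborel"
        using int by (rule borel_measurable_integrable)
    qed
    also have "\<dots> = (LINT t|lborel. indicator {0..} t *\<^sub>R (R t * e t) - of_real s * (indicator {0..} t *\<^sub>R (K t * e t)))"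
      by (simp add: scaleR_diff_right)
    also have "\<dots> = laplace R s - of_real s * laplace K s"
      unfolding laplace_eq using intK intR unfolding e_def
      by (subst Bochner_Integration.integral_diff) (auto simp only: integrable_mult_right integral_mult_right_zero)
    finally show ?thesis .
  qed
  ultimately show ?thesis by (simp add: algebra_simps)
qed

text \<open>Given some primitive \<open>Q\<close> of \<open>R\<close> with the same initial value, the transformed equation says that
  \<open>K\<close> and \<open>Q\<close> have the same Laplace transform, hence are equal.\<close>

lemma derivative_iff_laplace:
  assumes K: "continuous_on {0..} K" "subexponential K"
    and R: "continuous_on {0<..} R" "laplace_integrable R"
    and Q: "continuous_on {0..} Q" "subexponential Q" "Q 0 = K 0"
      "\<And>t. t > 0 \<Longrightarrow> (Q has_vector_derivative R t) (at t)"
  shows "(\<forall>t>0. (K has_vector_derivative R t) (at t)) \<longleftrightarrow> (\<forall>s>0. of_real s * laplace K s - K 0 = laplace R s)"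
proof
  assume "\<forall>t>0. (K has_vector_derivative R t) (at t)"
  then show "\<forall>s>0. of_real s * laplace K s - K 0 = laplace R s"
    using laplace_derivative[OF K R] by blast
next
  assume L: "\<forall>s>0. of_real s * laplace K s - K 0 = laplace R s"
  have eq: "K t = Q t" if "t \<ge> 0" for t
  proof -
    have "K t + (-1) * Q t = 0"
    proof (rule laplace_unique[OF _ _ _ that])
      show "continuous_on {0..} (\<lambda>t. K t + (-1) * Q t)" by (intro continuous_intros K Q)
      show "subexponential (\<lambda>t. K t + (-1) * Q t)" by (intro subexponential_add subexponential_cmult K Q)
      fix s :: real assume s: "s > 0"
      have "of_real s * laplace Q s = of_real s * laplace K s"
        using L s laplace_derivative[OF Q(1,2) R Q(4) s] Q(3) by (metis diff_add_cancel)
      then have "laplace Q s = laplace K s" using s by simp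
      then show "laplace (\<lambda>t. K t + (-1) * Q t) s = 0"
        by (simp only: laplace_add[OF laplace_integrable_continuous[OF K] laplace_integrable_cmult[OF laplace_integrable_continuous[OF Q(1,2)]] s]
            laplace_cmult) simp
    qed
    then show ?thesis by simp
  qed
  show "\<forall>t>0. (K has_vector_derivative R t) (at t)"
  proof (intro allI impI)
    fix t :: real assume t: "t > 0"
    show "(K has_vector_derivative R t) (at t)"
      by (rule has_vector_derivative_transform_within_open[OF Q(4)[OF t] open_greaterThan[of 0]]) (use t eq in auto)
  qed
qed

text \<open>A factor \<open>1 + t\<close> comes from integrating over \<open>{0..t}\<close>; it does not spoil subexponential growth.\<close>

lemma antiderivative_exists:
  assumes D: "continuous_on {0..} D" "subexponential D"
  obtains Q where "continuous_on {0..} Q" "subexponential Q" "Q 0 = (0::complex)"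
    "\<And>t. t > 0 \<Longrightarrow> (Q has_vector_derivative D t) (at t)"
proof -
  define Q where "Q = (\<lambda>t. integral {0..t} D)"
  have Dc: "continuous_on {0..b} D" for b by (rule continuous_on_subset[OF D(1)]) auto
  have Q': "(Q has_vector_derivative D t) (at t within {0..b})" if "t \<in> {0..b}" for t b
    unfolding Q_def by (rule integral_has_vector_derivative[OF Dc that])
  show thesis
  proof (rule that[of Q])
    show "Q 0 = 0" by (simp add: Q_def)
    show "(Q has_vector_derivative D t) (at t)" if t: "t > 0" for t
    proof -
      have "at t within {0..t + 1} = at t" using t by (intro at_within_interior) simp
      then show ?thesis using Q'[of t "t + 1"] t by simp
    qed
    show "continuous_on {0..} Q"
    proof (rule continuous_on_eq_continuous_within[THEN iffD2], rule ballI)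
      fix t :: real assume t: "t \<in> {0..}"
      have "continuous (at t within {0..t + 1}) Q"
        using Q'[of t "t + 1"] t by (intro has_vector_derivative_continuous) auto
      moreover have "at t within {0..t + 1} = at t within {0..}"
        using t by (intro at_within_nhd[of _ "{..<t + 1}"]) auto
      ultimately show "continuous (at t within {0..}) Q" by simp
    qed
    show "subexponential Q"
    proof (rule subexponential_linear_factor)
      define B where "B t = (SUP r\<in>{0..t}. norm (D r))" for t
      have bdd: "bdd_above ((\<lambda>r. norm (D r)) ` {0..t})" for t
        by (intro compact_imp_bounded[THEN bounded_imp_bdd_above] compact_continuous_image continuous_on_norm Dc compact_Icc)
      show "norm (Q t) \<le> (1 + t) * B t" if t: "t \<ge> 0" for t
      proof -
        have "norm (Q t) \<le> B t * (t - 0)"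
          unfolding Q_def by (rule integral_bound[OF t Dc]) (simp add: B_def cSUP_upper[OF _ bdd])
        moreover have "B t \<ge> 0"
          using cSUP_upper[OF _ bdd, of 0 t] t unfolding B_def by (meson atLeastAtMost_iff norm_ge_zero order_refl order_trans)
        ultimately show ?thesis by (simp add: algebra_simps)
      qed
      fix c :: real assume c: "c > 0"
      then obtain C where C: "\<And>t. t \<ge> 0 \<Longrightarrow> norm (D t) \<le> C * exp (c * t)"
        using D(2) unfolding subexponential_def by blast
      have C0: "C \<ge> 0" using C[of 0] by (simp add: order_trans[OF norm_ge_zero])
      have "B t \<le> C * exp (c * t)" if t: "t \<ge> 0" for t
        unfolding B_def
      proof (rule cSUP_least)
        fix r assume r: "r \<in> {0..t}"
        then have "C * exp (c * r) \<le> C * exp (c * t)" using c C0 by (intro mult_left_mono) auto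
        then show "norm (D r) \<le> C * exp (c * t)" using C[of r] r by auto
      qed (use t in auto)
      then show "\<exists>C\<ge>0. \<forall>t\<ge>0. B t \<le> C * exp (c * t)" using C0 by blast
    qed
  qed
qed

section \<open>Fractional integrals\<close>

text \<open>The Riemann-Liouville integral of order \<open>1 - \<beta>\<close>, without its factor \<open>1 / Gamma (1 - \<beta>)\<close>.\<close>

definition frac_integral :: "real \<Rightarrow> (real \<Rightarrow> complex) \<Rightarrow> real \<Rightarrow> complex" where
  "frac_integral \<beta> g r = (LINT t':{0..r}|lborel. g t' / of_real ((r - t') powr \<beta>))"

text \<open>In the variable \<open>v = 1 - t' / r\<close> the domain of integration no longer depends on \<open>r\<close>, and continuity
  and growth in \<open>r\<close> can be read off.\<close>

lemma frac_integral_rescale: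
  assumes r: "r > 0" and \<beta>: "\<beta> < 1"
  shows "frac_integral \<beta> g r = of_real (r powr (1 - \<beta>)) *
    (LINT v|lborel. indicator {0..1} v *\<^sub>R (g (r * (1 - v)) * of_real (v powr (- \<beta>))))"
proof -
  have "frac_integral \<beta> g r = \<bar>- r\<bar> *\<^sub>R (LINT v|lborel. indicator {0..r} (r + - r * v) *\<^sub>R (g (r + - r * v) / of_real ((r - (r + - r * v)) powr \<beta>)))"
    unfolding frac_integral_def set_lebesgue_integral_def
    using r by (intro lborel_integral_real_affine) simp
  also have "(LINT v|lborel. indicator {0..r} (r + - r * v) *\<^sub>R (g (r + - r * v) / of_real ((r - (r + - r * v)) powr \<beta>))) =
      (LINT v|lborel. of_real (r powr (- \<beta>)) * (indicator {0..1} v *\<^sub>R (g (r * (1 - v)) * of_real (v powr (- \<beta>)))))"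
  proof (rule Bochner_Integration.integral_cong[OF refl])
    fix v :: real
    have ind: "indicator {0..r} (r + - r * v) = (indicator {0..1} v :: real)"
      using r by (auto simp: indicator_def mult_le_cancel_left1 zero_le_mult_iff)
    have arg: "r + - r * v = r * (1 - v)" by (simp add: algebra_simps)
    show "indicator {0..r} (r + - r * v) *\<^sub>R (g (r + - r * v) / of_real ((r - (r + - r * v)) powr \<beta>)) =
       of_real (r powr (- \<beta>)) * (indicator {0..1} v *\<^sub>R (g (r * (1 - v)) * of_real (v powr (- \<beta>))))"
    proof (cases "v \<in> {0..1}")
      case True
      have "(r * v) powr \<beta> = r powr \<beta> * v powr \<beta>" using True r by (simp add: powr_mult)
      then show ?thesis unfolding ind unfolding arg
        by (simp add: powr_minus divide_inverse right_diff_distrib of_real_inverse mult_ac)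
    qed (simp only: ind, simp)
  qed
  also have "\<dots> = of_real (r powr (- \<beta>)) * (LINT v|lborel. indicator {0..1} v *\<^sub>R (g (r * (1 - v)) * of_real (v powr (- \<beta>))))"
    by (rule integral_mult_right_zero)
  also have "\<bar>- r\<bar> *\<^sub>R (of_real (r powr (- \<beta>)) * (LINT v|lborel. indicator {0..1} v *\<^sub>R (g (r * (1 - v)) * of_real (v powr (- \<beta>))))) =
     of_real (r * r powr (- \<beta>)) * (LINT v|lborel. indicator {0..1} v *\<^sub>R (g (r * (1 - v)) * of_real (v powr (- \<beta>))))"
    using r by (simp add: scaleR_conv_of_real)
  also have "r * r powr (- \<beta>) = r powr (1 - \<beta>)"
    using r by (simp add: powr_diff powr_minus divide_inverse)
  finally show ?thesis .
qed

context
  fixes \<beta> :: real and g :: "real \<Rightarrow> complex"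
  assumes \<beta>: "0 < \<beta>" "\<beta> < 1" and g: "continuous_on {0..} g" "subexponential g"
begin

definition "unit_average r = (LINT v|lborel. indicator {0..1} v *\<^sub>R (g (r * (1 - v)) * of_real (v powr (- \<beta>))))"

lemma power_integrable: "integrable lborel (\<lambda>v. indicator {0..1} v *\<^sub>R v powr (- \<beta>))"
  using set_integrable_powr_Icc[of "1 - \<beta>" 1] \<beta> by (simp add: set_integrable_def)

lemma unit_average_measurable:
  assumes "r \<ge> 0"
  shows "(\<lambda>v. indicator {0..1} v *\<^sub>R (g (r * (1 - v)) * of_real (v powr (- \<beta>)))) \<in> borel_measurable lborel"
proof -
  have "continuous_on {0..1} (\<lambda>v. g (r * (1 - v)))"
    by (rule continuous_on_compose2[OF g(1)]) (use assms in \<open>auto intro!: continuous_intros\<close>)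
  then have [measurable]: "(\<lambda>v. indicator {0..1} v *\<^sub>R g (r * (1 - v))) \<in> borel_measurable borel"
    by (intro borel_measurable_continuous_on_indicator) auto
  have "(\<lambda>v. (indicator {0..1} v *\<^sub>R g (r * (1 - v))) * of_real (v powr (- \<beta>))) \<in> borel_measurable borel"
    by measurable
  then show ?thesis by simp
qed

lemma unit_average_bound:
  assumes r: "r \<ge> 0" and B: "\<And>t. t \<in> {0..r} \<Longrightarrow> norm (g t) \<le> B"
  shows "norm (indicator {0..1} v *\<^sub>R (g (r * (1 - v)) * of_real (v powr (- \<beta>)))) \<le> B * (indicator {0..1} v *\<^sub>R v powr (- \<beta>))"
proof (cases "v \<in> {0..1}")
  case True
  then have "r * (1 - v) \<in> {0..r}" using r by (auto simp: mult_left_le)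
  then show ?thesis using True B by (simp add: norm_mult mult_right_mono)
qed simp

lemma unit_average_continuous: "continuous_on {0..} unit_average"
  unfolding continuous_on_sequentially comp_def
proof (intro ballI allI impI, elim conjE)
  fix X and r :: real assume r: "r \<in> {0..}" and X: "\<forall>n. X n \<in> {0..}" "X \<longlonglongrightarrow> r"
  obtain M where M: "\<And>n. X n \<le> M"
    using convergent_imp_Bseq[OF convergentI[OF X(2)]] unfolding Bseq_def by (metis abs_ge_self order_trans real_norm_def)
  have "bounded (g ` {0..M})"
    by (intro compact_imp_bounded compact_continuous_image continuous_on_subset[OF g(1)]) auto
  then have "\<exists>B. \<forall>t\<in>{0..M}. norm (g t) \<le> B" unfolding bounded_iff by simp
  then obtain B where B: "\<And>t. t \<in> {0..M} \<Longrightarrow> norm (g t) \<le> B" by blast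
  show "(\<lambda>n. unit_average (X n)) \<longlonglongrightarrow> unit_average r"
    unfolding unit_average_def
  proof (rule integral_dominated_convergence[where w = "\<lambda>v. B * (indicator {0..1} v *\<^sub>R v powr (- \<beta>))"])
    show "integrable lborel (\<lambda>v. B * (indicator {0..1} v *\<^sub>R v powr (- \<beta>)))"
      by (rule integrable_mult_right[OF power_integrable])
    show "AE v in lborel. norm (indicator {0..1} v *\<^sub>R (g (X n * (1 - v)) * of_real (v powr (- \<beta>)))) \<le> B * (indicator {0..1} v *\<^sub>R v powr (- \<beta>))" for n
      using X(1) M[of n] B by (intro AE_I2 unit_average_bound) auto
    show "AE v in lborel. (\<lambda>n. indicator {0..1} v *\<^sub>R (g (X n * (1 - v)) * of_real (v powr (- \<beta>)))) \<longlonglongrightarrow> indicator {0..1} v *\<^sub>R (g (r * (1 - v)) * of_real (v powr (- \<beta>)))"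
    proof (rule AE_I2)
      fix v :: real
      show "(\<lambda>n. indicator {0..1} v *\<^sub>R (g (X n * (1 - v)) * of_real (v powr (- \<beta>)))) \<longlonglongrightarrow> indicator {0..1} v *\<^sub>R (g (r * (1 - v)) * of_real (v powr (- \<beta>)))"
      proof (cases "v \<in> {0..1}")
        case True
        have "(\<lambda>n. g (X n * (1 - v))) \<longlonglongrightarrow> g (r * (1 - v))"
        proof (rule continuous_on_tendsto_compose[OF g(1)])
          show "(\<lambda>n. X n * (1 - v)) \<longlonglongrightarrow> r * (1 - v)" by (rule tendsto_mult[OF X(2) tendsto_const])
        qed (use r X(1) True in auto)
        then show ?thesis by (intro tendsto_scaleR tendsto_mult tendsto_const)
      qed simp
    qed
  qed (use unit_average_measurable r X(1) in auto)
qed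

lemma frac_integral_eq: "r \<ge> 0 \<Longrightarrow> frac_integral \<beta> g r = of_real (r powr (1 - \<beta>)) * unit_average r"
proof (cases "r = 0")
  case True
  have "frac_integral \<beta> g 0 = 0"
    unfolding frac_integral_def set_lebesgue_integral_def by (rule integral_eq_zero_AE) (auto simp: indicator_def)
  then show ?thesis using True by simp
qed (use frac_integral_rescale \<beta> in \<open>simp add: unit_average_def\<close>)

lemma frac_integral_continuous: "continuous_on {0..} (frac_integral \<beta> g)"
proof -
  have "continuous_on {0..} (\<lambda>r::real. r powr (1 - \<beta>))"
    using \<beta> by (intro continuous_on_powr' continuous_intros) auto
  then have "continuous_on {0..} (\<lambda>r. of_real (r powr (1 - \<beta>)) * unit_average r)"
    by (intro continuous_on_mult continuous_on_of_real unit_average_continuous)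
  then show ?thesis by (rule continuous_on_eq) (simp add: frac_integral_eq)
qed

lemma powr_le_1_plus: "r \<ge> 0 \<Longrightarrow> r powr (1 - \<beta>) \<le> 1 + r"
proof (cases "r \<le> 1")
  case True
  assume "r \<ge> 0"
  then have "r powr (1 - \<beta>) \<le> 1" using True \<beta> powr_mono2[of "1 - \<beta>" r 1] by simp
  then show ?thesis using \<open>r \<ge> 0\<close> by simp
next
  case False
  then have "r powr (1 - \<beta>) \<le> r powr 1" using \<beta> by (intro powr_mono) auto
  then show ?thesis using False by simp
qed

lemma frac_integral_subexponential: "subexponential (frac_integral \<beta> g)"
proof (rule subexponential_linear_factor)
  define N where "N = (LINT v|lborel. indicator {0..1} v *\<^sub>R v powr (- \<beta>))"
  have N: "N \<ge> 0" unfolding N_def by (rule Bochner_Integration.integral_nonneg) simp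
  show "norm (frac_integral \<beta> g r) \<le> (1 + r) * norm (unit_average r)" if "r \<ge> 0" for r
    unfolding frac_integral_eq[OF that] using powr_le_1_plus[OF that] by (simp add: norm_mult mult_right_mono)
  fix c :: real assume c: "c > 0"
  then obtain C where C: "\<And>t. t \<ge> 0 \<Longrightarrow> norm (g t) \<le> C * exp (c * t)"
    using g(2) unfolding subexponential_def by blast
  have C0: "C \<ge> 0" using C[of 0] by (simp add: order_trans[OF norm_ge_zero])
  have "norm (unit_average r) \<le> (C * N) * exp (c * r)" if r: "r \<ge> 0" for r
  proof -
    have B: "norm (g t) \<le> C * exp (c * r)" if "t \<in> {0..r}" for t
    proof -
      have "C * exp (c * t) \<le> C * exp (c * r)" using that c C0 by (intro mult_left_mono) auto
      then show ?thesis using C[of t] that by auto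
    qed
    note dom = integrable_mult_right[OF power_integrable, of "C * exp (c * r)"]
    have "integrable lborel (\<lambda>v. indicator {0..1} v *\<^sub>R (g (r * (1 - v)) * of_real (v powr (- \<beta>))))"
      by (rule Bochner_Integration.integrable_bound[OF dom unit_average_measurable[OF r]])
         (use order_trans[OF unit_average_bound[OF r B] abs_ge_self] in simp)
    then have "norm (unit_average r) \<le> (LINT v|lborel. C * exp (c * r) * (indicator {0..1} v *\<^sub>R v powr (- \<beta>)))"
      unfolding unit_average_def
      by (rule Bochner_Integration.integral_norm_bound_integral[OF _ dom]) (rule unit_average_bound[OF r B])
    also have "\<dots> = (C * N) * exp (c * r)" by (simp add: N_def)
    finally show ?thesis .
  qed
  moreover have "C * N \<ge> 0" using C0 N by simp
  ultimately show "\<exists>C\<ge>0. \<forall>t\<ge>0. norm (unit_average t) \<le> C * exp (c * t)" by blast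
qed

text \<open>A convolution with a power of \<open>t\<close>, hence a product of Laplace transforms.\<close>

lemma laplace_frac_integral:
  assumes s: "s > 0"
  shows "laplace (frac_integral \<beta> g) s = laplace g s * of_real (Gamma (1 - \<beta>) * s powr (\<beta> - 1))"
proof -
  define I where "I = Gamma (1 - \<beta>) / s powr (1 - \<beta>)"
  define gs where "gs = (\<lambda>t. indicator {0..} t *\<^sub>R (g t * of_real (exp (- s * t))))"
  define k where "k = (\<lambda>r::real. indicator {0..} r * (r powr (- \<beta>) * exp (- (s * r))))"
  define G where "G = (\<lambda>t r. gs t * of_real (k (r - t)))"
  have k: "has_bochner_integral lborel k I"
    unfolding k_def I_def using has_bochner_integral_Gamma[of "1 - \<beta>" s] \<beta> s by simp
  have k_shift: "has_bochner_integral lborel (\<lambda>r. k (r - t)) I" for t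
    using lborel_has_bochner_integral_real_affine_iff[of 1 k I "- t"] k by simp
  have k_nonneg: "k r \<ge> 0" for r by (simp add: k_def)
  have gs: "integrable lborel gs"
    unfolding gs_def by (rule laplace_integrable_set_integrable[OF laplace_integrable_continuous[OF g] s])
  have [measurable]: "gs \<in> borel_measurable borel" "k \<in> borel_measurable borel"
    using gs by (auto simp: k_def)
  have G_int: "has_bochner_integral lborel (G t) (gs t * of_real I)" for t
    unfolding G_def by (intro has_bochner_integral_mult_right has_bochner_integral_of_real k_shift)
  have G_norm: "has_bochner_integral lborel (\<lambda>r. norm (G t r)) (norm (gs t) * I)" for t
    unfolding G_def norm_mult norm_of_real abs_of_nonneg[OF k_nonneg]
    by (rule has_bochner_integral_mult_right[OF k_shift])
  have int: "integrable (lborel \<Otimes>\<^sub>M lborel) (\<lambda>(t, r). G t r)"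
  proof (rule lborel_pair.Fubini_integrable)
    show "(\<lambda>(t, r). G t r) \<in> borel_measurable (lborel \<Otimes>\<^sub>M lborel)" unfolding G_def by measurable
    show "integrable lborel (\<lambda>t. LINT r|lborel. norm (case (t, r) of (t, r) \<Rightarrow> G t r))"
      using integrable_mult_left[OF integrable_norm[OF gs], of I]
      by (simp add: has_bochner_integral_integral_eq[OF G_norm])
  qed (use G_int in \<open>auto simp: has_bochner_integral_iff\<close>)
  have inner: "(LINT t|lborel. G t r) = indicator {0..} r *\<^sub>R (frac_integral \<beta> g r * of_real (exp (- s * r)))" for r
  proof -
    have "(LINT t|lborel. G t r) = (LINT t|lborel. of_real (exp (- s * r)) * (indicator {0..r} t *\<^sub>R (g t / of_real ((r - t) powr \<beta>))))"
    proof (rule Bochner_Integration.integral_cong[OF refl])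
      fix t :: real
      have "exp (- s * t) * exp (- (s * (r - t))) = exp (- s * r)"
        by (simp add: exp_add[symmetric] algebra_simps)
      then have e: "complex_of_real (exp (- s * t)) * of_real (exp (- (s * (r - t)))) = of_real (exp (- s * r))"
        by (simp only: of_real_mult[symmetric])
      show "G t r = of_real (exp (- s * r)) * (indicator {0..r} t *\<^sub>R (g t / of_real ((r - t) powr \<beta>)))"
        unfolding e[symmetric] by (auto simp: G_def gs_def k_def indicator_def powr_minus divide_inverse of_real_inverse)
    qed
    also have "\<dots> = of_real (exp (- s * r)) * frac_integral \<beta> g r"
      unfolding frac_integral_def set_lebesgue_integral_def by (rule integral_mult_right_zero)
    also have "\<dots> = indicator {0..} r *\<^sub>R (frac_integral \<beta> g r * of_real (exp (- s * r)))"
    proof (cases "r \<ge> 0")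
      case False
      then have "{0..r} = {}" by simp
      then show ?thesis using False by (simp add: frac_integral_def set_lebesgue_integral_def)
    qed simp
    finally show ?thesis .
  qed
  have "laplace (frac_integral \<beta> g) s = (LINT r|lborel. LINT t|lborel. G t r)"
    unfolding laplace_eq inner ..
  also have "\<dots> = (LINT t|lborel. LINT r|lborel. G t r)"
    by (rule lborel_pair.Fubini_integral[OF int])
  also have "\<dots> = (LINT t|lborel. gs t) * of_real I"
    by (simp add: has_bochner_integral_integral_eq[OF G_int])
  also have "(LINT t|lborel. gs t) = laplace g s" by (simp add: gs_def laplace_eq)
  also have "I = Gamma (1 - \<beta>) * s powr (\<beta> - 1)"
    using powr_minus[of s "1 - \<beta>"] by (simp add: I_def divide_inverse)
  finally show ?thesis .
qed

end

section \<open>The Mittag-Leffler memory function\<close>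

context
  fixes \<beta> :: real
  assumes \<beta>: "0 < \<beta>" "\<beta> < 1"
begin

lemma power_memory_laplace_integrable: "laplace_integrable (\<lambda>t. of_real (t powr (- \<beta>) / Gamma (1 - \<beta>)))"
  unfolding laplace_integrable_def
proof (intro allI impI)
  fix c :: real assume c: "c > 0"
  have "integrable lborel (\<lambda>t::real. indicator {0..} t * (t powr (- \<beta>) * exp (- (c * t))))"
    using has_bochner_integral_Gamma[of "1 - \<beta>" c] \<beta> c by (simp add: has_bochner_integral_iff)
  then have "integrable lborel (\<lambda>t::real. complex_of_real (indicator {0..} t * (t powr (- \<beta>) * exp (- (c * t))) / Gamma (1 - \<beta>)))"
    by (intro integrable_of_real integrable_divide)
  then show "set_integrable lborel {0..} (\<lambda>t. exp (- c * t) *\<^sub>R complex_of_real (t powr (- \<beta>) / Gamma (1 - \<beta>)))"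
    unfolding set_integrable_def
    by (rule back_subst[of "integrable lborel"]) (auto simp: fun_eq_iff indicator_def scaleR_conv_of_real)
qed

lemma laplace_power_memory:
  assumes s: "s > 0"
  shows "laplace (\<lambda>t. of_real (t powr (- \<beta>) / Gamma (1 - \<beta>))) s = of_real (s powr (\<beta> - 1))"
proof -
  have G: "Gamma (1 - \<beta>) > 0" using \<beta> by (simp add: Gamma_real_pos)
  have "laplace (\<lambda>t. of_real (t powr (- \<beta>) / Gamma (1 - \<beta>))) s =
      (LINT t|lborel. complex_of_real (indicator {0..} t * (t powr (- \<beta>) * exp (- (s * t))) / Gamma (1 - \<beta>)))"
    unfolding laplace_eq by (rule Bochner_Integration.integral_cong) (auto simp: indicator_def)
  also have "\<dots> = of_real (Gamma (1 - \<beta>) / s powr (1 - \<beta>) / Gamma (1 - \<beta>))"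
    using has_bochner_integral_integral_eq[OF has_bochner_integral_Gamma[of "1 - \<beta>" s]] \<beta> s
    by (simp only: integral_complex_of_real integral_divide_zero) simp
  also have "Gamma (1 - \<beta>) / s powr (1 - \<beta>) / Gamma (1 - \<beta>) = s powr (\<beta> - 1)"
    using G powr_minus[of s "1 - \<beta>"] by (simp add: divide_inverse)
  finally show ?thesis .
qed

end

lemma memory_function_mittag_leffler:
  assumes \<beta>: "0 < \<beta>" "\<beta> \<le> 1" and Hs: "\<And>s. s > 0 \<Longrightarrow> Hs s = s powr (\<beta> - 1)"
  shows "memory_function (mittag_leffler_memory \<beta>) Hs"
proof (cases "\<beta> = 1")
  case True
  have "time_gf (\<lambda>\<phi>. \<phi> 0)"
  proof (rule time_gfI)
    fix c :: real
    have "norm (\<phi> 0) \<le> 1 * (\<Sum>n\<le>0. test_norm c n \<phi>)" if "time_test_rate c \<phi>" for \<phi>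
      using test_norm_bound[OF that order_refl, of 0] by simp
    then show "\<exists>C N. \<forall>\<phi>. time_test_rate c \<phi> \<longrightarrow> norm (\<phi> 0) \<le> C * (\<Sum>n\<le>N. test_norm c n \<phi>)" by blast
  qed simp_all
  then show ?thesis using True by (simp add: memory_function_def mittag_leffler_memory_def gf_laplace_def Hs)
next
  case False
  then have \<beta>': "0 < \<beta>" "\<beta> < 1" using \<beta> by auto
  show ?thesis
    using time_gf_of_fun[OF power_memory_laplace_integrable[OF \<beta>']] laplace_power_memory[OF \<beta>'] False
    by (simp add: memory_function_def mittag_leffler_memory_def Hs laplace_def)
qed

text \<open>For \<open>\<beta> < 1\<close> the Caputo equation prescribes the derivative of the fractional integral \<open>K\<close>
  of \<open>g\<close>: it is \<open>D\<close> plus the initial value times a power of \<open>t\<close>.  Both that power and its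
  primitive are explicit.\<close>

lemma caputo_iff_laplace:
  assumes \<beta>: "0 < \<beta>" "\<beta> \<le> 1" and g: "continuous_on {0..} g" "subexponential g"
    and D: "continuous_on {0..} D" "subexponential D"
  shows "(\<forall>t>0. has_caputo_derivative \<beta> g (D t) t) \<longleftrightarrow>
    (\<forall>s>0. of_real (s powr (\<beta> - 1)) * (of_real s * laplace g s - g 0) = laplace D s)"
proof (cases "\<beta> = 1")
  case True
  obtain Q where Q: "continuous_on {0..} Q" "subexponential Q" "Q 0 = (0::complex)"
    "\<And>t. t > 0 \<Longrightarrow> (Q has_vector_derivative D t) (at t)"
    using antiderivative_exists[OF D] by blast
  have const: "subexponential (\<lambda>t. g 0)"
    unfolding subexponential_def by (intro allI impI exI[of _ "norm (g 0)"]) (simp add: mult_le_cancel_left1)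
  have "(\<forall>t>0. (g has_vector_derivative D t) (at t)) \<longleftrightarrow> (\<forall>s>0. of_real s * laplace g s - g 0 = laplace D s)"
  proof (rule derivative_iff_laplace[OF g, where Q = "\<lambda>t. Q t + g 0"])
    show "continuous_on {0<..} D" by (rule continuous_on_subset[OF D(1)]) auto
    show "laplace_integrable D" by (rule laplace_integrable_continuous[OF D])
    show "continuous_on {0..} (\<lambda>t. Q t + g 0)" by (intro continuous_intros Q)
    show "subexponential (\<lambda>t. Q t + g 0)" by (intro subexponential_add Q const)
    show "((\<lambda>t. Q t + g 0) has_vector_derivative D t) (at t)" if "t > 0" for t
      using has_vector_derivative_add[OF Q(4)[OF that] has_vector_derivative_const[of "g 0"]] by simp
  qed (simp add: Q(3))
  then show ?thesis using True by (simp add: has_caputo_derivative_def)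
next
  case False
  then have \<beta>': "0 < \<beta>" "\<beta> < 1" using \<beta> by auto
  define \<Gamma> where "\<Gamma> = Gamma (1 - \<beta>)"
  have \<Gamma>: "\<Gamma> > 0" using \<beta>' by (simp add: \<Gamma>_def Gamma_real_pos)
  define K where "K = (\<lambda>t. inverse (of_real \<Gamma>) * frac_integral \<beta> g t)"
  define m where "m = (\<lambda>t. complex_of_real (t powr (- \<beta>) / \<Gamma>))"
  define R where "R = (\<lambda>t. D t + g 0 * m t)"
  define P where "P = (\<lambda>t. complex_of_real (t powr (1 - \<beta>) / ((1 - \<beta>) * \<Gamma>)))"
  note frac = frac_integral_continuous[OF \<beta>' g] frac_integral_subexponential[OF \<beta>' g]
  have K: "continuous_on {0..} K" "subexponential K"
    unfolding K_def by (intro continuous_intros subexponential_cmult frac)+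
  have K0: "K 0 = 0" using frac_integral_eq[OF \<beta>' g, of 0] by (simp add: K_def)
  have m: "laplace_integrable m" "\<And>s. s > 0 \<Longrightarrow> laplace m s = of_real (s powr (\<beta> - 1))"
    unfolding m_def \<Gamma>_def using power_memory_laplace_integrable[OF \<beta>'] laplace_power_memory[OF \<beta>'] by blast+
  have m_cont: "continuous_on {0<..} m"
    unfolding m_def using \<Gamma> by (intro continuous_intros) auto
  note D_int = laplace_integrable_continuous[OF D]
  obtain Q where Q: "continuous_on {0..} Q" "subexponential Q" "Q 0 = (0::complex)"
    "\<And>t. t > 0 \<Longrightarrow> (Q has_vector_derivative D t) (at t)"
    using antiderivative_exists[OF D] by blast
  have P_cont: "continuous_on {0..} P"
    unfolding P_def using \<beta>' \<Gamma> by (intro continuous_on_of_real continuous_on_divide continuous_on_const continuous_on_powr' continuous_on_id) auto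
  have P_growth: "subexponential P"
  proof (rule subexponential_linear_factor)
    show "norm (P t) \<le> (1 + t) * (1 / ((1 - \<beta>) * \<Gamma>))" if "t \<ge> 0" for t
      unfolding P_def norm_of_real using powr_le_1_plus[OF \<beta>' g that] \<beta>' \<Gamma> by (simp add: abs_mult divide_right_mono)
    have "1 / ((1 - \<beta>) * \<Gamma>) \<le> 1 / ((1 - \<beta>) * \<Gamma>) * exp (c * t)" if "c > 0" "t \<ge> 0" for c t :: real
      using mult_left_mono[of 1 "exp (c * t)" "1 / ((1 - \<beta>) * \<Gamma>)"] that \<beta>' \<Gamma> by simp
    moreover have "1 / ((1 - \<beta>) * \<Gamma>) \<ge> 0" using \<beta>' \<Gamma> by simp
    ultimately show "\<exists>C\<ge>0. \<forall>t\<ge>0. 1 / ((1 - \<beta>) * \<Gamma>) \<le> C * exp (c * t)" if "c > 0" for c :: real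
      using that by blast
  qed
  have P_deriv: "(P has_vector_derivative m t) (at t)" if t: "t > 0" for t
    unfolding P_def m_def
  proof (rule has_vector_derivative_of_real)
    have "((\<lambda>t. t powr (1 - \<beta>) / ((1 - \<beta>) * \<Gamma>)) has_real_derivative ((1 - \<beta>) * t powr (1 - \<beta> - 1)) / ((1 - \<beta>) * \<Gamma>)) (at t)"
      by (rule DERIV_cdivide[OF has_real_derivative_powr[OF t]])
    then show "((\<lambda>t. t powr (1 - \<beta>) / ((1 - \<beta>) * \<Gamma>)) has_real_derivative t powr - \<beta> / \<Gamma>) (at t)"
      using \<beta>' by simp
  qed
  have "(\<forall>t>0. has_caputo_derivative \<beta> g (D t) t) \<longleftrightarrow> (\<forall>t>0. (K has_vector_derivative R t) (at t))"
  proof -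
    have K_eq: "K = (\<lambda>r. (LINT t':{0..r}|lborel. g t' / of_real ((r - t') powr \<beta>)) / of_real \<Gamma>)"
      by (simp add: K_def frac_integral_def[abs_def] divide_inverse mult.commute)
    have "has_caputo_derivative \<beta> g (D t) t \<longleftrightarrow> (K has_vector_derivative R t) (at t)" for t
      using False unfolding has_caputo_derivative_def K_eq[unfolded \<Gamma>_def] R_def m_def \<Gamma>_def
      by (auto simp: algebra_simps)
    then show ?thesis by simp
  qed
  also have "\<dots> \<longleftrightarrow> (\<forall>s>0. of_real s * laplace K s - K 0 = laplace R s)"
  proof (rule derivative_iff_laplace[OF K, where Q = "\<lambda>t. Q t + g 0 * P t"])
    show "continuous_on {0<..} R"
      unfolding R_def by (intro continuous_intros m_cont continuous_on_subset[OF D(1)]) auto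
    show "laplace_integrable R"
      unfolding R_def by (intro laplace_integrable_add laplace_integrable_cmult D_int m)
    show "continuous_on {0..} (\<lambda>t. Q t + g 0 * P t)" by (intro continuous_intros Q P_cont)
    show "subexponential (\<lambda>t. Q t + g 0 * P t)" by (intro subexponential_add subexponential_cmult Q P_growth)
    show "Q 0 + g 0 * P 0 = K 0" by (simp add: Q(3) K0 P_def)
    show "((\<lambda>t. Q t + g 0 * P t) has_vector_derivative R t) (at t)" if "t > 0" for t
      unfolding R_def by (intro has_vector_derivative_add has_vector_derivative_mult_right Q(4) P_deriv that)
  qed
  also have "\<dots> \<longleftrightarrow> (\<forall>s>0. of_real (s powr (\<beta> - 1)) * (of_real s * laplace g s - g 0) = laplace D s)"
  proof -
    have LK: "laplace K s = of_real (s powr (\<beta> - 1)) * laplace g s" if "s > 0" for s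
      unfolding K_def laplace_cmult laplace_frac_integral[OF \<beta>' g that] using \<Gamma> by (simp add: \<Gamma>_def[symmetric])
    have LR: "laplace R s = laplace D s + g 0 * of_real (s powr (\<beta> - 1))" if "s > 0" for s
      unfolding R_def by (simp only: laplace_add[OF D_int laplace_integrable_cmult[OF m(1)] that] laplace_cmult m(2)[OF that])
    have "of_real s * laplace K s - K 0 = laplace R s \<longleftrightarrow>
       of_real (s powr (\<beta> - 1)) * (of_real s * laplace g s - g 0) = laplace D s" if "s > 0" for s
      unfolding LK[OF that] LR[OF that] K0 by (auto simp: algebra_simps)
    then show ?thesis by simp
  qed
  finally show ?thesis .
qed

theorem fractional_cauchy_problem_iff:
  assumes \<beta>: "0 < \<beta>" "\<beta> \<le> 1" and Hs: "\<And>s. s > 0 \<Longrightarrow> Hs s = s powr (\<beta> - 1)"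
    and u: "density_evolution u" and \<alpha>: "0 < \<alpha>" "\<alpha> \<le> 2"
    and Hs': "\<And>s. s > 0 \<Longrightarrow> Hs s > 0" "filterlim (\<lambda>s. s * Hs s) at_top at_top"
  shows "fractional_cauchy_problem \<beta> \<alpha> u \<longleftrightarrow> (\<forall>\<kappa>. \<forall>s>0. limit_equation Hs \<alpha> \<kappa> s (fourier_laplace u \<kappa> s))"
proof -
  have tested: "(\<forall>t>0. has_caputo_derivative \<beta> (pairing u \<psi>) (pairing u (riesz \<alpha> \<psi>) t) t) \<longleftrightarrow>
     (\<forall>s>0. of_real (Hs s) * (of_real s * laplace (pairing u \<psi>) s - pairing u \<psi> 0) = laplace (pairing u (riesz \<alpha> \<psi>)) s)"
    if "schwartz \<psi>" for \<psi>
    using caputo_iff_laplace[OF \<beta> pairing_regular[OF u \<alpha> that]] by (simp add: Hs)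
  have "fractional_cauchy_problem \<beta> \<alpha> u \<longleftrightarrow> u 0 = return borel 0 \<and> (\<forall>\<psi>. schwartz \<psi> \<longrightarrow>
      (\<forall>t>0. has_caputo_derivative \<beta> (pairing u \<psi>) (pairing u (riesz \<alpha> \<psi>) t) t))"
    unfolding fractional_cauchy_problem_def by (rule conj_commute)
  also have "\<dots> \<longleftrightarrow> u 0 = return borel 0 \<and> (\<forall>\<psi>. schwartz \<psi> \<longrightarrow>
      (\<forall>s>0. of_real (Hs s) * (of_real s * laplace (pairing u \<psi>) s - pairing u \<psi> 0) = laplace (pairing u (riesz \<alpha> \<psi>)) s))"
    by (rule conj_cong[OF refl], rule all_cong1, rule imp_cong[OF refl], rule tested)
  also have "\<dots> \<longleftrightarrow> (\<forall>\<kappa>. \<forall>s>0. limit_equation Hs \<alpha> \<kappa> s (fourier_laplace u \<kappa> s))"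
    by (rule limit_equation_iff_initial_and_tested[OF u \<alpha> Hs', symmetric])
  finally show ?thesis .
qed

section \<open>Convergence of the solutions and the limiting Cauchy problems\<close>

text \<open>The rescaled equation and the limit equation are both of this form.\<close>

lemma resolvent_equation_iff:
  fixes z q :: complex
  assumes "A > 0" "s > 0" "Re z \<le> 0"
  shows "of_real A * (of_real s * q - 1) = z * q \<longleftrightarrow> q = of_real A / (of_real (A * s) - z)"
    and resolvent_denominator_nonzero: "of_real (A * s) - z \<noteq> 0"
proof -
  have "Re (of_real (A * s) - z) > 0" using mult_pos_pos[OF assms(1,2)] assms(3) by simp
  then show nz: "of_real (A * s) - z \<noteq> 0" by auto
  have "of_real A * (of_real s * q - 1) = z * q \<longleftrightarrow> q * (of_real (A * s) - z) = of_real A"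
    by (simp add: algebra_simps)
  then show "of_real A * (of_real s * q - 1) = z * q \<longleftrightarrow> q = of_real A / (of_real (A * s) - z)"
    using nz by (simp add: eq_divide_eq)
qed

lemma jump_scaling_order: "jump_scaling W \<alpha> \<mu> \<Longrightarrow> 0 < \<alpha> \<and> \<alpha> \<le> 2"
  by (auto simp: jump_scaling_def)

theorem mainTheorem3:
  fixes \<Phi> W :: "real measure" and \<alpha> \<mu> :: real
  assumes "real_distribution \<Phi>" and "AE t in \<Phi>. 0 < t"
    and "real_distribution W" and "symmetric_law W"
    and "jump_scaling W \<alpha> \<mu>" and "\<mu> > 0"
  shows "(\<forall>h>0. \<forall>\<kappa>. \<forall>s>0. \<exists>!q. rescaled_equation (memory_laplace \<Phi>) W \<alpha> \<mu> h \<kappa> s q)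
    \<and> (\<forall>\<kappa>. \<forall>s>0. \<exists>!v. limit_equation (memory_laplace \<Phi>) \<alpha> \<kappa> s v)
    \<and> (\<forall>q v. (\<forall>h>0. \<forall>\<kappa>. \<forall>s>0. rescaled_equation (memory_laplace \<Phi>) W \<alpha> \<mu> h \<kappa> s (q h \<kappa> s))
          \<longrightarrow> (\<forall>\<kappa>. \<forall>s>0. limit_equation (memory_laplace \<Phi>) \<alpha> \<kappa> s (v \<kappa> s))
          \<longrightarrow> (\<forall>\<kappa>. \<forall>s>0. ((\<lambda>h. q h \<kappa> s) \<longlongrightarrow> v \<kappa> s) (at_right 0)))
    \<and> (\<forall>H u. memory_function H (memory_laplace \<Phi>) \<longrightarrow> density_evolution u \<longrightarrow>
          (memory_cauchy_problem H \<alpha> u \<longleftrightarrow>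
           (\<forall>\<kappa>. \<forall>s>0. limit_equation (memory_laplace \<Phi>) \<alpha> \<kappa> s (fourier_laplace u \<kappa> s))))
    \<and> (\<forall>\<beta>. 0 < \<beta> \<longrightarrow> \<beta> \<le> 1 \<longrightarrow> (\<forall>s>0. memory_laplace \<Phi> s = s powr (\<beta> - 1)) \<longrightarrow>
          memory_function (mittag_leffler_memory \<beta>) (memory_laplace \<Phi>) \<and>
          (\<forall>u. density_evolution u \<longrightarrow>
             (fractional_cauchy_problem \<beta> \<alpha> u \<longleftrightarrow>
              (\<forall>\<kappa>. \<forall>s>0. limit_equation (memory_laplace \<Phi>) \<alpha> \<kappa> s (fourier_laplace u \<kappa> s)))))"
proof -
  define Hs where "Hs = memory_laplace \<Phi>"
  define z where "z h \<kappa> = (char W (\<kappa> * h) - 1) / of_real (\<mu> * h powr \<alpha>)" for h \<kappa>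
  define z0 where "z0 \<kappa> = - complex_of_real (\<bar>\<kappa>\<bar> powr \<alpha>)" for \<kappa>
  interpret W: real_distribution W by (rule assms)
  have Hs_pos: "\<And>s. s > 0 \<Longrightarrow> Hs s > 0"
    unfolding Hs_def by (rule memory_laplace_pos[OF assms(1,2)])
  have Hs_top: "filterlim (\<lambda>s. s * Hs s) at_top at_top"
    unfolding Hs_def by (rule memory_laplace_at_top[OF assms(1,2)])
  have \<alpha>: "0 < \<alpha>" "\<alpha> \<le> 2" using jump_scaling_order[OF assms(5)] by auto
  have z: "Re (z h \<kappa>) \<le> 0" if "h > 0" for h \<kappa>
  proof -
    have "Re (char W (\<kappa> * h)) \<le> 1"
      using complex_Re_le_cmod W.cmod_char_le_1 by (rule order_trans)
    moreover have "\<mu> * h powr \<alpha> > 0" using that assms(6) by simp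
    ultimately show ?thesis
      unfolding z_def Re_divide_of_real by (intro divide_nonpos_pos) auto
  qed
  have z0: "Re (z0 \<kappa>) \<le> 0" for \<kappa> by (simp add: z0_def)
  have rescaled: "rescaled_equation Hs W \<alpha> \<mu> h \<kappa> s q \<longleftrightarrow> q = of_real (Hs s) / (of_real (Hs s * s) - z h \<kappa>)"
    if "h > 0" "s > 0" for h \<kappa> s q
    unfolding rescaled_equation_def z_def[symmetric]
    by (rule resolvent_equation_iff[OF Hs_pos[OF that(2)] that(2) z[OF that(1)]])
  have limit: "limit_equation Hs \<alpha> \<kappa> s v \<longleftrightarrow> v = of_real (Hs s) / (of_real (Hs s * s) - z0 \<kappa>)"
    if "s > 0" for \<kappa> s v
    unfolding limit_equation_def z0_def[symmetric]
    by (rule resolvent_equation_iff[OF Hs_pos[OF that] that z0])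
  have conv: "((\<lambda>h. q h \<kappa> s) \<longlongrightarrow> v \<kappa> s) (at_right 0)"
    if q: "\<forall>h>0. \<forall>\<kappa>. \<forall>s>0. rescaled_equation Hs W \<alpha> \<mu> h \<kappa> s (q h \<kappa> s)"
      and v: "\<forall>\<kappa>. \<forall>s>0. limit_equation Hs \<alpha> \<kappa> s (v \<kappa> s)" and s: "s > 0" for q v \<kappa> s
  proof -
    have "((\<lambda>h. z h \<kappa>) \<longlongrightarrow> z0 \<kappa>) (at_right 0)"
      unfolding z_def z0_def by (rule jump_symbol_limit[OF assms(3-6)])
    then have "((\<lambda>h. of_real (Hs s) / (of_real (Hs s * s) - z h \<kappa>)) \<longlongrightarrow> of_real (Hs s) / (of_real (Hs s * s) - z0 \<kappa>)) (at_right 0)"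
      by (rule tendsto_divide[OF tendsto_const tendsto_diff[OF tendsto_const]])
        (rule resolvent_denominator_nonzero[OF Hs_pos[OF s] s z0])
    moreover have "\<forall>\<^sub>F h in at_right 0. of_real (Hs s) / (of_real (Hs s * s) - z h \<kappa>) = q h \<kappa> s"
      using eventually_at_right_less[of 0]
    proof eventually_elim
      case (elim h)
      then have "rescaled_equation Hs W \<alpha> \<mu> h \<kappa> s (q h \<kappa> s)" using q s by simp
      then show ?case using rescaled[OF elim s] by simp
    qed
    ultimately have "((\<lambda>h. q h \<kappa> s) \<longlongrightarrow> of_real (Hs s) / (of_real (Hs s * s) - z0 \<kappa>)) (at_right 0)"
      by (rule Lim_transform_eventually)
    then show ?thesis using v limit s by simp
  qed
  have memory: "memory_cauchy_problem H \<alpha> u \<longleftrightarrow> (\<forall>\<kappa>. \<forall>s>0. limit_equation Hs \<alpha> \<kappa> s (fourier_laplace u \<kappa> s))"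
    if "memory_function H Hs" "density_evolution u" for H u
    by (rule memory_cauchy_problem_iff[OF that(2) \<alpha> Hs_pos Hs_top that(1)])
  have fractional: "memory_function (mittag_leffler_memory \<beta>) Hs \<and> (\<forall>u. density_evolution u \<longrightarrow>
      (fractional_cauchy_problem \<beta> \<alpha> u \<longleftrightarrow> (\<forall>\<kappa>. \<forall>s>0. limit_equation Hs \<alpha> \<kappa> s (fourier_laplace u \<kappa> s))))"
    if \<beta>: "0 < \<beta>" "\<beta> \<le> 1" and Hs: "\<forall>s>0. Hs s = s powr (\<beta> - 1)" for \<beta>
  proof (intro conjI allI impI)
    show "memory_function (mittag_leffler_memory \<beta>) Hs"
      using Hs by (intro memory_function_mittag_leffler \<beta>) auto
    show "fractional_cauchy_problem \<beta> \<alpha> u \<longleftrightarrow> (\<forall>\<kappa>. \<forall>s>0. limit_equation Hs \<alpha> \<kappa> s (fourier_laplace u \<kappa> s))"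
      if "density_evolution u" for u
      using Hs by (intro fractional_cauchy_problem_iff \<beta> that \<alpha> Hs_pos Hs_top) auto
  qed
  show ?thesis
    unfolding Hs_def[symmetric]
  proof (intro conjI)
    show "\<forall>h>0. \<forall>\<kappa>. \<forall>s>0. \<exists>!q. rescaled_equation Hs W \<alpha> \<mu> h \<kappa> s q" by (simp add: rescaled)
    show "\<forall>\<kappa>. \<forall>s>0. \<exists>!v. limit_equation Hs \<alpha> \<kappa> s v" by (simp add: limit)
  qed (intro allI impI, (rule conv memory fractional; assumption))+
qed

end
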